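(* Let $N\ge1$, $n\ge2$ be integers and $\mu,\lambda\in\{1,-1\}$. The Suzuki algebra $A_{Nn}^{\mu\lambda}$ is of set-theoretical type, i.e. all Yetter-Drinfeld modules over $A_{Nn}^{\mu\lambda}$ are of set-theoretical type.
   Context: $\Bbbk$ is an algebraically closed field of characteristic $0$, $\Bbbk^\times=\Bbbk\setminus\{0\}$. Suzuki algebra: $A_{Nn}^{\mu\lambda}$ is the Hopf algebra over $\Bbbk$ generated by $x_{11},x_{12},x_{21},x_{22}$ with relations $x_{11}^2=x_{22}^2$, $x_{12}^2=x_{21}^2$, $\chi_{21}^n=\lambda\chi_{12}^n$, $\chi_{11}^n=\chi_{22}^n$, $x_{11}^{2N}+\mu x_{12}^{2N}=1$, and $x_{ij}x_{kl}=0$ whenever $i+j+k+l$ is odd, where, for $m\ge1$, $\chi_{11}^m=x_{11}x_{22}x_{11}\cdots$, $\chi_{22}^m=x_{22}x_{11}x_{22}\cdots$, $\chi_{12}^m=x_{12}x_{21}x_{12}\cdots$, $\chi_{21}^m=x_{21}x_{12}x_{21}\cdots$ (alternating products of $m$ factors). Its comultiplication, counit and antipode are given by $\Delta(\chi_{ij}^k)=\chi_{i1}^k\otimes\chi_{1j}^k+\chi_{i2}^k\otimes\chi_{2j}^k$, $\varepsilon(x_{ij})=\delta_{ij}$, $S(x_{ij})=x_{ji}^{4N-1}$ for $k\ge1$, $i,j=1,2$. Yetter-Drinfeld modules over a Hopf algebra $H$ are objects of ${}^H_H\mathcal{YD}$ (left-left), regarded as braided vector spaces with the braiding $c(v\otimes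 w)=v_{(-1)}\cdot w\otimes v_{(0)}$. A set-theoretical solution of the Yang-Baxter equation is a pair $(X,r)$ with $X$ a non-empty set and $r:X\times X\to X\times X$ a bijection with $(r\times\mathrm{id})(\mathrm{id}\times r)(r\times\mathrm{id})=(\mathrm{id}\times r)(r\times\mathrm{id})(\mathrm{id}\times r)$. Write $r(i,j)=(\sigma_i(j),\tau_j(i))$; the solution is non-degenerate if all the maps $\sigma_i,\tau_i:X\to X$ ($i\in X$) are bijective. Braided vector spaces of set-theoretical type: let $(X,r)$ be a non-degenerate set-theoretical solution of the Yang-Baxter equation with $|X|=m\in\mathbb{Z}^{\ge2}$. Then $W_{X,r}=\bigoplus_{i\in X}\Bbbk w_i$ is a braided vector space with braiding $c(w_i\otimes w_j)=R_{i,j}\,w_{\sigma_i(j)}\otimes w_{\tau_j(i)}$, where $R_{i,j}\in\Bbbk^\times$ satisfy $R_{i,j}R_{\tau_j(i),k}R_{\sigma_i(j),\sigma_{\tau_j(i)}(k)}=R_{j,k}R_{i,\sigma_j(k)}R_{\tau_{\sigma_j(k)}(i),\tau_k(j)}$ for all $i,j,k\in X$. Such a braided vector space $W_{X,r}$ is called of set-theoretical type. A Hopf algebra $H$ is said to be of set-theoretical type if all Yetter-Drinfeld modules over $H$ are of set-theoretical type.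
   Formalization: "All Yetter-Drinfeld modules" is read as all those of finite dimension at least 2, because set-theoretical type requires a finite X with |X| ≥ 2, so a one-dimensional (e.g. trivial) or infinite-dimensional module can never be of that type. *)

theory Defs
  imports
    Complex_Main
    "HOL-Library.Poly_Mapping"
    "HOL-Library.Function_Algebras"
    "HOL-Computational_Algebra.Polynomial"
begin

section \<open>Tensor products of vector spaces\<close>

text \<open>
  Over a field, \<open>A \<otimes> B\<close> embeds into the bilinear forms on \<open>A\<^sup>* \<times> B\<^sup>*\<close> by sending \<open>a \<otimes> b\<close>
  to \<open>(f, g) \<mapsto> f a * g b\<close>; we take the image of this embedding as the tensor product.  Tensors are
  then functions, added pointwise, and iterated tensor products are obtained by nesting.
  The universal property is lemma \<open>tensor_lift_sum_list\<close> below.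
\<close>

type_synonym ('k, 'a, 'b) tensor = "('a \<Rightarrow> 'k) \<Rightarrow> ('b \<Rightarrow> 'k) \<Rightarrow> 'k"

definition tensor ::
  "('k::field \<Rightarrow> 'a::ab_group_add \<Rightarrow> 'a) \<Rightarrow> ('k \<Rightarrow> 'b::ab_group_add \<Rightarrow> 'b) \<Rightarrow> 'a \<Rightarrow> 'b \<Rightarrow> ('k, 'a, 'b) tensor"
  where "tensor sA sB a b = (\<lambda>f g.
    if Vector_Spaces.linear sA (*) f \<and> Vector_Spaces.linear sB (*) g then f a * g b else 0)"

definition tensor_scale :: "'k::field \<Rightarrow> ('k, 'a, 'b) tensor \<Rightarrow> ('k, 'a, 'b) tensor"
  where "tensor_scale c t = (\<lambda>f g. c * t f g)"

definition tensor_space ::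
  "('k::field \<Rightarrow> 'a::ab_group_add \<Rightarrow> 'a) \<Rightarrow> ('k \<Rightarrow> 'b::ab_group_add \<Rightarrow> 'b) \<Rightarrow> ('k, 'a, 'b) tensor set"
  where "tensor_space sA sB = module.span tensor_scale {tensor sA sB a b | a b. True}"

text \<open>
  The linear map on \<open>A \<otimes> B\<close> induced by a bilinear map \<open>\<beta>\<close>.  It also serves as Sweedler notation:
  for \<open>\<Delta> h = h\<^sub>1 \<otimes> h\<^sub>2\<close>, the element \<open>\<beta> h\<^sub>1 h\<^sub>2\<close> is \<open>tensor_lift s s \<beta> (\<Delta> h)\<close>.
\<close>

definition tensor_lift ::
  "('k::field \<Rightarrow> 'a::ab_group_add \<Rightarrow> 'a) \<Rightarrow> ('k \<Rightarrow> 'b::ab_group_add \<Rightarrow> 'b) \<Rightarrow>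
   ('a \<Rightarrow> 'b \<Rightarrow> 'c::ab_group_add) \<Rightarrow> ('k, 'a, 'b) tensor \<Rightarrow> 'c"
  where "tensor_lift sA sB \<beta> t =
    (let xs = (SOME xs. t = (\<Sum>(a, b)\<leftarrow>xs. tensor sA sB a b)) in \<Sum>(a, b)\<leftarrow>xs. \<beta> a b)"

lemma vector_space_tensor_scale:
  "vector_space (tensor_scale :: 'k::field \<Rightarrow> ('k, 'a, 'b) tensor \<Rightarrow> ('k, 'a, 'b) tensor)"
  by unfold_locales (auto simp: tensor_scale_def fun_eq_iff algebra_simps)

lemma sum_list_fun2:
  "(\<Sum>(a, b)\<leftarrow>xs. F a b) f g = (\<Sum>(a, b)\<leftarrow>xs. (F a b f g :: 'k::comm_monoid_add))"
  by (induction xs) (auto simp: zero_fun_def plus_fun_def)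

lemma sum_list_bilinear_eq:
  fixes sA :: "'k::field \<Rightarrow> 'a::ab_group_add \<Rightarrow> 'a" and sB :: "'k \<Rightarrow> 'b::ab_group_add \<Rightarrow> 'b"
    and sC :: "'k \<Rightarrow> 'c::ab_group_add \<Rightarrow> 'c" and \<beta> :: "'a \<Rightarrow> 'b \<Rightarrow> 'c"
  assumes "vector_space sA" "vector_space sB" "vector_space sC"
    and lin1: "\<And>b. Vector_Spaces.linear sA sC (\<lambda>a. \<beta> a b)"
    and lin2: "\<And>a. Vector_Spaces.linear sB sC (\<beta> a)"
    and eq: "(\<Sum>(a, b)\<leftarrow>xs. tensor sA sB a b) = (\<Sum>(a, b)\<leftarrow>ys. tensor sA sB a b)"
  shows "(\<Sum>(a, b)\<leftarrow>xs. \<beta> a b) = (\<Sum>(a, b)\<leftarrow>ys. \<beta> a b)"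
proof -
  interpret A: vector_space sA by fact
  interpret B: vector_space sB by fact
  interpret C: vector_space sC by fact
  define Bs where "Bs = B.extend_basis {}"
  have Bs: "B.independent Bs" "B.span Bs = UNIV"
    using B.independent_extend_basis[OF B.independent_empty] B.span_extend_basis[OF B.independent_empty]
    by (auto simp: Bs_def)
  define rep where "rep = B.representation Bs"
  define As where "As = A.extend_basis {}"
  have As: "A.independent As" "A.span As = UNIV"
    using A.independent_extend_basis[OF A.independent_empty] A.span_extend_basis[OF A.independent_empty]
    by (auto simp: As_def)
  define E where "E = (\<Union>(a, b)\<in>set (xs @ ys). {e. rep b e \<noteq> 0})"
  have finE: "finite E"
    by (auto simp: E_def rep_def B.finite_representation)
  define coef where "coef = (\<lambda>zs e. \<Sum>(a, b)\<leftarrow>zs. sA (rep b e) a)"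
  have \<beta>E: "\<beta> a b = (\<Sum>e\<in>E. \<beta> (sA (rep b e) a) e)" if "(a, b) \<in> set (xs @ ys)" for a b
  proof -
    have "b = (\<Sum>e | rep b e \<noteq> 0. sB (rep b e) e)"
      using B.sum_nonzero_representation_eq[of Bs b] Bs by (simp add: rep_def)
    also have "\<dots> = (\<Sum>e\<in>E. sB (rep b e) e)"
      by (rule sum.mono_neutral_left) (use that finE in \<open>auto simp: E_def\<close>)
    finally have b: "b = (\<Sum>e\<in>E. sB (rep b e) e)" .
    interpret l2: Vector_Spaces.linear sB sC "\<beta> a" by (rule lin2)
    have "\<beta> a b = (\<Sum>e\<in>E. sC (rep b e) (\<beta> a e))"
      by (subst b) (simp add: l2.sum l2.scale)
    also have "\<dots> = (\<Sum>e\<in>E. \<beta> (sA (rep b e) a) e)"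
    proof (rule sum.cong[OF refl])
      fix e
      interpret l1: Vector_Spaces.linear sA sC "\<lambda>a. \<beta> a e" by (rule lin1)
      show "sC (rep b e) (\<beta> a e) = \<beta> (sA (rep b e) a) e" by (simp add: l1.scale)
    qed
    finally show ?thesis .
  qed
  have expand: "(\<Sum>(a, b)\<leftarrow>zs. \<beta> a b) = (\<Sum>e\<in>E. \<beta> (coef zs e) e)"
    if "set zs \<subseteq> set (xs @ ys)" for zs
    using that
  proof (induction zs)
    case Nil
    have "\<beta> 0 e = 0" for e
    proof -
      interpret l1: Vector_Spaces.linear sA sC "\<lambda>a. \<beta> a e" by (rule lin1)
      show ?thesis by (rule l1.zero)
    qed
    then show ?case by (simp add: coef_def)
  next
    case (Cons z zs)
    obtain a b where z: "z = (a, b)" by fastforce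
    have "\<beta> (coef (z # zs) e) e = \<beta> (sA (rep b e) a) e + \<beta> (coef zs e) e" for e
    proof -
      interpret l1: Vector_Spaces.linear sA sC "\<lambda>a. \<beta> a e" by (rule lin1)
      show ?thesis by (simp add: coef_def z l1.add)
    qed
    moreover have "\<beta> a b = (\<Sum>e\<in>E. \<beta> (sA (rep b e) a) e)"
      using Cons.prems z by (intro \<beta>E) auto
    ultimately show ?case using Cons by (simp add: z sum.distrib)
  qed
  have "coef xs e = coef ys e" for e
  proof -
    define g where "g = (\<lambda>b. rep b e)"
    have lg: "Vector_Spaces.linear sB (*) g"
      unfolding g_def rep_def by (rule B.linear_representation) (use Bs in auto)
    have f: "f (coef zs e) = (\<Sum>(a, b)\<leftarrow>zs. tensor sA sB a b) f g"
      if lf: "Vector_Spaces.linear sA (*) f" for f zs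
    proof -
      interpret lf: Vector_Spaces.linear sA "(*)" f by (rule lf)
      have t: "tensor sA sB a b f g = f a * rep b e" for a b
        by (simp only: tensor_def lf lg simp_thms if_True) (simp add: g_def)
      show ?thesis
        by (induction zs) (auto simp: coef_def lf.zero lf.add lf.scale zero_fun_def t)
    qed
    define d where "d = coef xs e - coef ys e"
    have "A.representation As d a = 0" for a
    proof -
      define f where "f = (\<lambda>v. A.representation As v a)"
      have lf: "Vector_Spaces.linear sA (*) f"
        unfolding f_def by (rule A.linear_representation) (use As in auto)
      interpret lf: Vector_Spaces.linear sA "(*)" f by (rule lf)
      have "f d = 0" by (simp add: d_def lf.diff f[OF lf] eq)
      then show ?thesis by (simp add: f_def)
    qed
    then have "d = 0"
      using A.sum_nonzero_representation_eq[of As d] As by simp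
    then show ?thesis by (simp add: d_def)
  qed
  then show ?thesis using expand[of xs] expand[of ys] by simp
qed

lemma tensor_lift_sum_list:
  fixes sA :: "'k::field \<Rightarrow> 'a::ab_group_add \<Rightarrow> 'a" and sB :: "'k \<Rightarrow> 'b::ab_group_add \<Rightarrow> 'b"
    and sC :: "'k \<Rightarrow> 'c::ab_group_add \<Rightarrow> 'c" and \<beta> :: "'a \<Rightarrow> 'b \<Rightarrow> 'c"
  assumes "vector_space sA" "vector_space sB" "vector_space sC"
    and "\<And>b. Vector_Spaces.linear sA sC (\<lambda>a. \<beta> a b)"
    and "\<And>a. Vector_Spaces.linear sB sC (\<beta> a)"
  shows "tensor_lift sA sB \<beta> (\<Sum>(a, b)\<leftarrow>xs. tensor sA sB a b) = (\<Sum>(a, b)\<leftarrow>xs. \<beta> a b)"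
proof -
  let ?P = "\<lambda>ys. (\<Sum>(a, b)\<leftarrow>xs. tensor sA sB a b) = (\<Sum>(a, b)\<leftarrow>ys. tensor sA sB a b)"
  have "?P (SOME ys. ?P ys)" by (rule someI[of ?P xs]) simp
  from sum_list_bilinear_eq[OF assms this] show ?thesis
    by (simp add: tensor_lift_def Let_def)
qed


section \<open>Hopf algebras and Yetter-Drinfeld modules\<close>

locale hopf_algebra = vector_space scale
  for scale :: "'k::field \<Rightarrow> 'h::ring_1 \<Rightarrow> 'h" +
  fixes comult :: "'h \<Rightarrow> ('k, 'h, 'h) tensor"
    and counit :: "'h \<Rightarrow> 'k"
    and antipode :: "'h \<Rightarrow> 'h"
  assumes scale_mult_left: "scale c (a * b) = scale c a * b"
    and scale_mult_right: "scale c (a * b) = a * scale c b"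
    and comult_linear: "Vector_Spaces.linear scale tensor_scale comult"
    and comult_in_tensor_space: "comult a \<in> tensor_space scale scale"
    and counit_linear: "Vector_Spaces.linear scale (*) counit"
    and antipode_linear: "Vector_Spaces.linear scale scale antipode"
    and coassoc:
      "tensor_lift scale scale (\<lambda>p q. tensor_lift scale scale
           (\<lambda>a b. tensor scale tensor_scale a (tensor scale scale b q)) (comult p)) (comult h) =
       tensor_lift scale scale (\<lambda>p q. tensor scale tensor_scale p (comult q)) (comult h)"
    and counit_left: "tensor_lift scale scale (\<lambda>p q. scale (counit p) q) (comult h) = h"
    and counit_right: "tensor_lift scale scale (\<lambda>p q. scale (counit q) p) (comult h) = h"
    and comult_one: "comult 1 = tensor scale scale 1 1"
    and comult_mult: "comult (g * h) =
       tensor_lift scale scale (\<lambda>a b. tensor_lift scale scale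
           (\<lambda>c d. tensor scale scale (a * c) (b * d)) (comult h)) (comult g)"
    and counit_one: "counit 1 = 1"
    and counit_mult: "counit (g * h) = counit g * counit h"
    and antipode_left:
      "tensor_lift scale scale (\<lambda>p q. antipode p * q) (comult h) = scale (counit h) 1"
    and antipode_right:
      "tensor_lift scale scale (\<lambda>p q. p * antipode q) (comult h) = scale (counit h) 1"

text \<open>
  Left-left Yetter-Drinfeld modules: left modules and left comodules with
  \<open>\<delta>(h \<cdot> v) = h\<^sub>1 v\<^bsub>(-1)\<^esub> S(h\<^sub>3) \<otimes> h\<^sub>2 \<cdot> v\<^bsub>(0)\<^esub>\<close>.
\<close>

locale yd_module = hopf_algebra scale comult counit antipode + V: vector_space scaleV
  for scale :: "'k::field \<Rightarrow> 'h::ring_1 \<Rightarrow> 'h"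
    and comult :: "'h \<Rightarrow> ('k, 'h, 'h) tensor"
    and counit :: "'h \<Rightarrow> 'k"
    and antipode :: "'h \<Rightarrow> 'h"
    and scaleV :: "'k \<Rightarrow> 'v::ab_group_add \<Rightarrow> 'v" +
  fixes act :: "'h \<Rightarrow> 'v \<Rightarrow> 'v"
    and coact :: "'v \<Rightarrow> ('k, 'h, 'v) tensor"
  assumes act_linear_left: "Vector_Spaces.linear scale scaleV (\<lambda>h. act h v)"
    and act_linear_right: "Vector_Spaces.linear scaleV scaleV (act h)"
    and act_one: "act 1 v = v"
    and act_mult: "act (g * h) v = act g (act h v)"
    and coact_linear: "Vector_Spaces.linear scaleV tensor_scale coact"
    and coact_in_tensor_space: "coact v \<in> tensor_space scale scaleV"
    and coact_coassoc:
      "tensor_lift scale scaleV (\<lambda>p u. tensor_lift scale scale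
           (\<lambda>a b. tensor scale tensor_scale a (tensor scale scaleV b u)) (comult p)) (coact v) =
       tensor_lift scale scaleV (\<lambda>p u. tensor scale tensor_scale p (coact u)) (coact v)"
    and coact_counit: "tensor_lift scale scaleV (\<lambda>p u. scaleV (counit p) u) (coact v) = v"
    and yetter_drinfeld:
      "coact (act h v) =
       tensor_lift scale scale (\<lambda>h1 h'. tensor_lift scale scale
         (\<lambda>h2 h3. tensor_lift scale scaleV
           (\<lambda>a u. tensor scale scaleV (h1 * a * antipode h3) (act h2 u))
           (coact v)) (comult h')) (comult h)"

definition yd_braiding ::
  "('k::field \<Rightarrow> 'h::ring_1 \<Rightarrow> 'h) \<Rightarrow> ('k \<Rightarrow> 'v::ab_group_add \<Rightarrow> 'v) \<Rightarrow> ('h \<Rightarrow> 'v \<Rightarrow> 'v) \<Rightarrow>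
   ('v \<Rightarrow> ('k, 'h, 'v) tensor) \<Rightarrow> ('k, 'v, 'v) tensor \<Rightarrow> ('k, 'v, 'v) tensor"
  where "yd_braiding scale scaleV act coact =
    tensor_lift scaleV scaleV (\<lambda>v w.
      tensor_lift scale scaleV (\<lambda>h u. tensor scaleV scaleV (act h w) u) (coact v))"


section \<open>Set-theoretical type\<close>

definition sigma :: "('x \<times> 'x \<Rightarrow> 'x \<times> 'x) \<Rightarrow> 'x \<Rightarrow> 'x \<Rightarrow> 'x"
  where "sigma r i j = fst (r (i, j))"

definition tau :: "('x \<times> 'x \<Rightarrow> 'x \<times> 'x) \<Rightarrow> 'x \<Rightarrow> 'x \<Rightarrow> 'x"
  where "tau r j i = snd (r (i, j))"

definition r_times_id :: "('x \<times> 'x \<Rightarrow> 'x \<times> 'x) \<Rightarrow> 'x \<times> 'x \<times> 'x \<Rightarrow> 'x \<times> 'x \<times> 'x"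
  where "r_times_id r = (\<lambda>(x, y, z). case r (x, y) of (x', y') \<Rightarrow> (x', y', z))"

definition id_times_r :: "('x \<times> 'x \<Rightarrow> 'x \<times> 'x) \<Rightarrow> 'x \<times> 'x \<times> 'x \<Rightarrow> 'x \<times> 'x \<times> 'x"
  where "id_times_r r = (\<lambda>(x, y, z). (x, r (y, z)))"

definition ybe_solution :: "'x set \<Rightarrow> ('x \<times> 'x \<Rightarrow> 'x \<times> 'x) \<Rightarrow> bool"
  where "ybe_solution X r \<longleftrightarrow>
    X \<noteq> {} \<and> bij_betw r (X \<times> X) (X \<times> X) \<and>
    (\<forall>t \<in> X \<times> X \<times> X. r_times_id r (id_times_r r (r_times_id r t)) =
                       id_times_r r (r_times_id r (id_times_r r t)))"

definition nondegenerate :: "'x set \<Rightarrow> ('x \<times> 'x \<Rightarrow> 'x \<times> 'x) \<Rightarrow> bool"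
  where "nondegenerate X r \<longleftrightarrow> (\<forall>i\<in>X. bij_betw (sigma r i) X X \<and> bij_betw (tau r i) X X)"

text \<open>
  \<open>(V, c)\<close> is isomorphic to some \<open>W\<^bsub>X,r\<^esub> = \<Oplus>\<^bsub>i\<in>X\<^esub> k w\<^sub>i\<close>, where \<open>w\<close> below is the image in \<open>V\<close> of the
  defining basis.  As \<open>X\<close> is finite, taking \<open>X \<subseteq> \<nat>\<close> is no restriction.
\<close>

definition set_theoretical_type ::
  "('k::field \<Rightarrow> 'v::ab_group_add \<Rightarrow> 'v) \<Rightarrow> (('k, 'v, 'v) tensor \<Rightarrow> ('k, 'v, 'v) tensor) \<Rightarrow> bool"
  where "set_theoretical_type scaleV c \<longleftrightarrow>
    (\<exists>(X :: nat set) r (R :: nat \<Rightarrow> nat \<Rightarrow> 'k) (w :: nat \<Rightarrow> 'v).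
       finite X \<and> card X \<ge> 2 \<and> ybe_solution X r \<and> nondegenerate X r \<and>
       (\<forall>i\<in>X. \<forall>j\<in>X. R i j \<noteq> 0) \<and>
       (\<forall>i\<in>X. \<forall>j\<in>X. \<forall>k\<in>X.
          R i j * R (tau r j i) k * R (sigma r i j) (sigma r (tau r j i) k) =
          R j k * R i (sigma r j k) * R (tau r (sigma r j k) i) (tau r k j)) \<and>
       inj_on w X \<and> \<not> module.dependent scaleV (w ` X) \<and> module.span scaleV (w ` X) = UNIV \<and>
       (\<forall>i\<in>X. \<forall>j\<in>X. c (tensor scaleV scaleV (w i) (w j)) =
          tensor_scale (R i j) (tensor scaleV scaleV (w (sigma r i j)) (w (tau r j i)))))"

text \<open>
  A braided vector space of set-theoretical type has a finite dimension \<open>\<ge> 2\<close> by definition, so the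
  Yetter-Drinfeld modules in question are those of such a dimension; a one-dimensional one
  (for instance the trivial one) can never satisfy \<open>set_theoretical_type\<close>.
  The type argument is the carrier type of the Yetter-Drinfeld modules.
\<close>

definition hopf_of_set_theoretical_type ::
  "'v::ab_group_add itself \<Rightarrow> ('k::field \<Rightarrow> 'h::ring_1 \<Rightarrow> 'h) \<Rightarrow> ('h \<Rightarrow> ('k, 'h, 'h) tensor) \<Rightarrow>
   ('h \<Rightarrow> 'k) \<Rightarrow> ('h \<Rightarrow> 'h) \<Rightarrow> bool"
  where "hopf_of_set_theoretical_type (_ :: 'v itself) scale comult counit antipode \<longleftrightarrow>
    (\<forall>(scaleV :: 'k \<Rightarrow> 'v \<Rightarrow> 'v) act coact.
       yd_module scale comult counit antipode scaleV act coact \<and>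
       (\<exists>B. finite B \<and> module.span scaleV B = UNIV) \<and> vector_space.dim scaleV UNIV \<ge> 2 \<longrightarrow>
       set_theoretical_type scaleV (yd_braiding scale scaleV act coact))"


section \<open>Algebras given by generators and relations\<close>

datatype 'g word = Word (letters: "'g list")

instantiation word :: (type) monoid_add
begin
definition zero_word :: "'a word" where "zero_word = Word []"
definition plus_word :: "'a word \<Rightarrow> 'a word \<Rightarrow> 'a word"
  where "plus_word u v = Word (letters u @ letters v)"
instance by standard (auto simp: zero_word_def plus_word_def)
end

text \<open>The free algebra on \<open>'g\<close> is the monoid algebra of the free monoid on \<open>'g\<close>.\<close>

type_synonym ('k, 'g) free_algebra = "'g word \<Rightarrow>\<^sub>0 'k"

definition free_gen :: "'g \<Rightarrow> ('k::field, 'g) free_algebra"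
  where "free_gen g = Poly_Mapping.single (Word [g]) 1"

definition free_const :: "'k::field \<Rightarrow> ('k, 'g) free_algebra"
  where "free_const c = Poly_Mapping.single 0 c"

definition free_eval ::
  "('k::field \<Rightarrow> 'h::ring_1 \<Rightarrow> 'h) \<Rightarrow> ('g \<Rightarrow> 'h) \<Rightarrow> ('k, 'g) free_algebra \<Rightarrow> 'h"
  where "free_eval scale X p =
    (\<Sum>u\<in>Poly_Mapping.keys p. scale (Poly_Mapping.lookup p u) (prod_list (map X (letters u))))"

definition two_sided_ideal :: "'a::ring_1 set \<Rightarrow> bool"
  where "two_sided_ideal I \<longleftrightarrow>
    0 \<in> I \<and> (\<forall>a\<in>I. \<forall>b\<in>I. a + b \<in> I) \<and> (\<forall>a\<in>I. \<forall>p. p * a \<in> I \<and> a * p \<in> I)"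

definition presented_by ::
  "('k::field \<Rightarrow> 'h::ring_1 \<Rightarrow> 'h) \<Rightarrow> ('g \<Rightarrow> 'h) \<Rightarrow> ('k, 'g) free_algebra set \<Rightarrow> bool"
  where "presented_by scale X Rel \<longleftrightarrow>
    (\<forall>h. \<exists>p. free_eval scale X p = h) \<and>
    (\<forall>p. free_eval scale X p = 0 \<longleftrightarrow> p \<in> two_sided_ideal hull Rel)"


section \<open>Suzuki algebras\<close>

datatype idx = I1 | I2

primrec flip :: "idx \<Rightarrow> idx"
  where "flip I1 = I2" | "flip I2 = I1"

primrec idx_val :: "idx \<Rightarrow> nat"
  where "idx_val I1 = 1" | "idx_val I2 = 2"

text \<open>\<open>chi x i j m = x\<^bsub>ij\<^esub> x\<^bsub>i'j'\<^esub> x\<^bsub>ij\<^esub> \<dots>\<close> (\<open>m\<close> factors), where the prime exchanges the two indices.\<close>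

primrec chi :: "(idx \<Rightarrow> idx \<Rightarrow> 'a::monoid_mult) \<Rightarrow> idx \<Rightarrow> idx \<Rightarrow> nat \<Rightarrow> 'a" where
  "chi x i j 0 = 1"
| "chi x i j (Suc m) = x i j * chi x (flip i) (flip j) m"

definition suzuki_relations ::
  "nat \<Rightarrow> nat \<Rightarrow> 'k::field \<Rightarrow> 'k \<Rightarrow> ('k, idx \<times> idx) free_algebra set"
  where "suzuki_relations N n \<mu> lam =
    (let x = (\<lambda>i j. free_gen (i, j)) in
      {x I1 I1 ^ 2 - x I2 I2 ^ 2,
       x I1 I2 ^ 2 - x I2 I1 ^ 2,
       chi x I2 I1 n - free_const lam * chi x I1 I2 n,
       chi x I1 I1 n - chi x I2 I2 n,
       x I1 I1 ^ (2 * N) + free_const \<mu> * x I1 I2 ^ (2 * N) - 1} \<union>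
      {x i j * x k l | i j k l. odd (idx_val i + idx_val j + idx_val k + idx_val l)})"

locale suzuki_algebra = hopf_algebra scale comult counit antipode
  for N n :: nat and \<mu> lam :: "'k::field"
    and scale :: "'k \<Rightarrow> 'h::ring_1 \<Rightarrow> 'h"
    and comult :: "'h \<Rightarrow> ('k, 'h, 'h) tensor"
    and counit :: "'h \<Rightarrow> 'k"
    and antipode :: "'h \<Rightarrow> 'h"
    and x :: "idx \<Rightarrow> idx \<Rightarrow> 'h" +
  assumes presentation: "presented_by scale (\<lambda>(i, j). x i j) (suzuki_relations N n \<mu> lam)"
    and comult_chi: "k \<ge> 1 \<Longrightarrow> comult (chi x i j k) =
       tensor scale scale (chi x i I1 k) (chi x I1 j k) +
       tensor scale scale (chi x i I2 k) (chi x I2 j k)"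
    and counit_gen: "counit (x i j) = (if i = j then 1 else 0)"
    and antipode_gen: "antipode (x i j) = x j i ^ (4 * N - 1)"

end

theory Submission
  imports Defs
begin

text \<open>
  With \<open>a = x\<^sub>1\<^sub>1 + x\<^sub>1\<^sub>2\<close>, \<open>b = x\<^sub>2\<^sub>2 + x\<^sub>2\<^sub>1\<close> and the central idempotents
  \<open>e = x\<^sub>1\<^sub>1\<^bsup>2N\<^esup>\<close>, \<open>f = 1 - e\<close>, the algebra is spanned by the elements \<open>e W\<close> and \<open>f W\<close>, where \<open>W\<close> is a
  word in \<open>a, b\<close>.  Writing \<open>W'\<close> for the word with \<open>a\<close> and \<open>b\<close> exchanged,
  \<open>\<Delta>(e W) = e W \<otimes> e W + f W \<otimes> f W'\<close> and \<open>\<Delta>(f W) = e W \<otimes> f W + f W \<otimes> e W'\<close>, so modulo \<open>f\<close> the algebra is the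
  group algebra of \<open>G = {e W}\<close>, and \<open>f W\<close> is determined by \<open>e W\<close> up to a scalar.  Hence a Yetter-Drinfeld module \<open>V\<close>
  is \<open>G\<close>-graded and carries an operator \<open>T\<close>, of square a scalar in each degree, with
  \<open>\<delta>(v) = g \<otimes> v + f W \<otimes> T v\<close> for \<open>v\<close> of degree \<open>g = e W\<close>.  Consequently \<open>c(v \<otimes> w) = W w \<otimes> v\<close> for \<open>w\<close> in \<open>e V\<close>
  and \<open>c(v \<otimes> w) = W w \<otimes> T v\<close> for \<open>w\<close> in \<open>f V\<close>.

  It remains to find a homogeneous basis of \<open>V\<close> on which \<open>a\<close>, \<open>b\<close> and \<open>T\<close> act by monomial matrices.  Up to
  scalars \<open>T a = b T\<close> and \<open>a\<^sup>2 = b\<^sup>2\<close> is central, so on the pieces cut out by the grading and the eigenvalues of \<open>a\<^sup>2\<close>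
  the operators \<open>a\<close> and \<open>T\<close> act projectively as two involutions, generating a finite dihedral group.  The
  stabiliser of a piece consists of powers of a diagonalisable rotation and at most one further class of
  reflections; such a group acts monomially on the piece, and the bases are transported along the orbits.
\<close>

section \<open>Eigenspace decompositions of operators of finite projective order\<close>

text \<open>The signs \<open>\<mu>\<close> and \<open>lam\<close> are the obstacle: words with equal
  \<open>e\<close>-part may have \<open>f\<close>-parts that differ by a scalar, so relations
  between the operators hold only up to factors that depend on the piece. Relations are therefore
  stated as proportionality on one piece at a time, and monomial matrices suffice because the
  scalars \<open>R\<close> of a set-theoretical braiding absorb the factors. What must be kept is
  that one and the same \<open>\<kappa>\<close> occurs in the exchange of \<open>T\<close> with a
  word and in the twisted conjugation of the \<open>f\<close>-parts: it then cancels in the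
  condition on \<open>R\<close>. The Yang-Baxter equation for \<open>r\<close> is read off from the
  indices in these same identities on basis vectors. The presentation supplies no basis of the
  algebra. Coactions are therefore handled through the dual algebra, and independence of
  \<open>G\<close> comes from the classical argument for group-like elements. Finiteness of the
  dihedral group comes from the relations between alternating words of length \<open>n\<close>:
  multiplied by a reversed word, they make \<open>(b a)^n\<close> proportional to
  \<open>a^(2 n)\<close> on each of \<open>e\<close> and \<open>f\<close>. As \<open>(T a)^2\<close>
  is proportional to \<open>b a\<close> on each piece, the exponent \<open>2 n\<close> serves for
  \<open>T a\<close>.\<close>

lemma card_roots_of_unity:
  fixes m :: nat
  assumes "m > 0"
  shows "finite {z :: 'k::{alg_closed_field, field_char_0}. z ^ m = 1}"
    and "card {z :: 'k. z ^ m = 1} = m"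
proof -
  define p :: "'k poly" where "p = monom 1 m - 1"
  have deg: "degree p = m"
    unfolding p_def using degree_add_eq_left[of "-1" "monom 1 m"] assms by (simp add: degree_monom_eq)
  then have nz: "p \<noteq> 0" using assms by auto
  have poly_p: "poly p z = z ^ m - 1" for z
    by (simp add: p_def poly_monom)
  have roots: "{z. z ^ m = 1} = set_mset (proots p)"
    using nz by (auto simp: poly_p)
  then show "finite {z :: 'k. z ^ m = 1}" by simp
  \<comment> \<open>Characteristic 0 enters here: the derivative \<open>m z^(m-1)\<close> vanishes
    at most at 0, which is not a root, so all roots are simple and their number is the
    degree.\<close>
  have "rsquarefree p"
    unfolding rsquarefree_roots
  proof (intro allI notI)
    fix z assume z: "poly p z = 0 \<and> poly (pderiv p) z = 0"
    then have "z ^ m = 1" "of_nat m * z ^ (m - 1) = 0"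
      by (auto simp: p_def poly_monom pderiv_diff pderiv_monom)
    then show False using assms by (cases m) (auto simp del: of_nat_Suc)
  qed
  then have "count (proots p) z \<le> 1" for z
    using nz by (auto simp: rsquarefree_def le_eq_less_or_eq)
  then have "proots p = mset_set (set_mset (proots p))"
    by (intro multiset_eqI) (metis count_mset_set(1,3) count_greater_eq_one_iff
        finite_set_mset le_antisym not_in_iff)
  then have card_size: "card (set_mset (proots p)) = size (proots p)"
    by (metis size_mset_set)
  obtain A where A: "size A = m" "p = smult (lead_coeff p) (\<Prod>x\<in>#A. [:-x, 1:])"
    using alg_closed_imp_factorization[OF nz] deg by auto
  have "proots p = proots (\<Prod>x\<in>#A. [:-x, 1:])"
    by (subst A(2)) (use nz in simp)
  also have "\<dots> = A"
    proof (induction A)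
    case (add x A)
    have "(\<Prod>x\<in>#A. [:-x, 1:]) \<noteq> 0" by (auto simp: prod_mset_zero_iff)
    then have "proots ([:-x, 1:] * (\<Prod>x\<in>#A. [:-x, 1:])) = {#x#} + A"
      using add by (subst proots_mult) (auto simp del: mult_pCons_left)
    then show ?case by (simp del: mult_pCons_left)
  qed simp
  finally have "proots p = A" .
  then show "card {z :: 'k. z ^ m = 1} = m"
    using A(1) roots card_size by simp
qed

text \<open>The solutions form a coset of the \<open>m\<close>-th roots of unity. Multiplication by
  a root of unity \<open>w\<close> permutes them and multiplies the sum by a power of
  \<open>w\<close>, which forces the sum to be 0 when that power is not 1. This orthogonality
  inverts the discrete Fourier transform in \<open>eigenspace_decomp\<close>.\<close>

lemma sum_inverse_powers_of_roots:
  fixes c :: "'k::{alg_closed_field, field_char_0}"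
  assumes "m > 0" "c \<noteq> 0"
  shows "finite {z. z ^ m = c}"
    and "k < m \<Longrightarrow> (\<Sum>z | z ^ m = c. inverse z ^ k) = (if k = 0 then of_nat m else 0)"
proof -
  obtain z0 where z0: "z0 ^ m = c"
    using nth_root_exists[OF assms(1)] by metis
  then have z0_nz: "z0 \<noteq> 0" using assms by (auto simp: power_0_left)
  have roots: "{z. z ^ m = c} = (*) z0 ` {z. z ^ m = 1}"
  proof (intro equalityI subsetI)
    fix z assume "z \<in> {z. z ^ m = c}"
    then have "(z / z0) ^ m = 1" using z0 assms by (simp add: power_divide)
    then show "z \<in> (*) z0 ` {z. z ^ m = 1}"
      using z0_nz by (intro image_eqI[of _ _ "z / z0"]) auto
  qed (auto simp: power_mult_distrib z0)
  show fin: "finite {z. z ^ m = c}"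
    unfolding roots by (intro finite_imageI card_roots_of_unity(1) assms(1))
  assume k: "k < m"
  show "(\<Sum>z | z ^ m = c. inverse z ^ k) = (if k = 0 then of_nat m else 0)"
  proof (cases "k = 0")
    case True
    have "card {z. z ^ m = c} = m"
      unfolding roots using z0_nz card_roots_of_unity(2)[OF assms(1), where 'k = 'k]
      by (subst card_image) (auto simp: inj_on_def)
    then show ?thesis using True by simp
  next
    case False
    \<comment> \<open>Counting supplies \<open>w\<close>: there are \<open>m\<close> roots of unity
      of exponent \<open>m\<close>, but only \<open>k < m\<close> of exponent
      \<open>k\<close>.\<close>
    have "\<not> {z :: 'k. z ^ m = 1} \<subseteq> {z. z ^ k = 1}"
      using card_mono[of "{z :: 'k. z ^ k = 1}" "{z. z ^ m = 1}"] card_roots_of_unity[of k, where 'k = 'k]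
        card_roots_of_unity[of m, where 'k = 'k] False k by auto
    then obtain w :: 'k where w: "w ^ m = 1" "w ^ k \<noteq> 1" by auto
    then have w_nz: "w \<noteq> 0" using assms by (auto simp: power_0_left)
    have "(\<Sum>z | z ^ m = c. inverse z ^ k) = (\<Sum>z | z ^ m = c. inverse (w * z) ^ k)"
      by (rule sum.reindex_bij_witness[of _ "\<lambda>z. w * z" "\<lambda>z. z / w"])
        (use w w_nz in \<open>auto simp: power_mult_distrib power_divide\<close>)
    also have "\<dots> = inverse (w ^ k) * (\<Sum>z | z ^ m = c. inverse z ^ k)"
      by (simp add: sum_distrib_left power_mult_distrib power_inverse)
    finally have "(1 - inverse (w ^ k)) * (\<Sum>z | z ^ m = c. inverse z ^ k) = 0"
      by (simp add: algebra_simps)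
    then show ?thesis using False w w_nz by (auto simp: field_simps)
  qed
qed

locale ac_vector_space = vector_space scale
  for scale :: "'k::{alg_closed_field, field_char_0} \<Rightarrow> 'v::ab_group_add \<Rightarrow> 'v" (infixr "*s" 75)
begin

definition direct_decomp :: "'i set \<Rightarrow> ('i \<Rightarrow> 'v set) \<Rightarrow> 'v set \<Rightarrow> bool" where
  "direct_decomp I U W \<longleftrightarrow>
     finite I \<and> (\<forall>i\<in>I. subspace (U i)) \<and> W = span (\<Union>i\<in>I. U i) \<and>
     (\<forall>v. (\<forall>i\<in>I. v i \<in> U i) \<and> (\<Sum>i\<in>I. v i) = 0 \<longrightarrow> (\<forall>i\<in>I. v i = 0))"

definition basis_of :: "'v set \<Rightarrow> 'v set \<Rightarrow> bool"
  where "basis_of B W \<longleftrightarrow> independent B \<and> span B = W"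

text \<open>Injectivity on the basis lines is not included; it is recovered from invertibility in
  \<open>monomial_permutation\<close>.\<close>

definition monomial_on :: "'v set \<Rightarrow> ('v \<Rightarrow> 'v) \<Rightarrow> bool"
  where "monomial_on B f \<longleftrightarrow> (\<forall>b\<in>B. \<exists>b'\<in>B. \<exists>c. c \<noteq> 0 \<and> f b = c *s b')"

lemma direct_decomp_cong:
  "direct_decomp I U W \<Longrightarrow> (\<And>i. i \<in> I \<Longrightarrow> U i = U' i) \<Longrightarrow> direct_decomp I U' W"
  by (simp add: direct_decomp_def)

lemma direct_decomp_disjoint:
  assumes "direct_decomp I U W" "i \<in> I" "j \<in> I" "v \<in> U i" "v \<in> U j" "v \<noteq> 0"
  shows "i = j"
proof (rule ccontr)
  assume ne: "i \<noteq> j"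
  define x where "x = (\<lambda>k. if k = i then v else if k = j then - v else 0)"
  have sub: "\<forall>k\<in>I. subspace (U k)" and fin: "finite I"
    and ind: "\<forall>v. (\<forall>i\<in>I. v i \<in> U i) \<and> (\<Sum>i\<in>I. v i) = 0 \<longrightarrow> (\<forall>i\<in>I. v i = 0)"
    using assms(1) by (auto simp: direct_decomp_def)
  have "\<forall>k\<in>I. x k \<in> U k"
    using sub assms subspace_0 subspace_neg by (auto simp: x_def)
  moreover have "(\<Sum>k\<in>I. x k) = 0"
  proof -
    have "(\<Sum>k\<in>I. x k) = (\<Sum>k\<in>{i, j}. x k)"
      by (rule sum.mono_neutral_right) (use fin assms in \<open>auto simp: x_def\<close>)
    then show ?thesis using ne by (simp add: x_def)
  qed
  ultimately have "x i = 0" using ind assms by blast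
  then show False using assms by (simp add: x_def)
qed

lemma direct_decomp_basis:
  assumes dd: "direct_decomp I U W" and B: "\<And>i. i \<in> I \<Longrightarrow> basis_of (B i) (U i)"
  shows "basis_of (\<Union>i\<in>I. B i) W"
  unfolding basis_of_def
proof
  have fin: "finite I" and sub: "\<forall>k\<in>I. subspace (U k)"
    and ind: "\<And>v. \<lbrakk>\<forall>i\<in>I. v i \<in> U i; (\<Sum>i\<in>I. v i) = 0\<rbrakk> \<Longrightarrow> \<forall>i\<in>I. v i = 0"
    and W: "W = span (\<Union>i\<in>I. U i)"
    using dd by (auto simp: direct_decomp_def)
  have BU: "B i \<subseteq> U i" if "i \<in> I" for i
    using B[OF that] span_superset by (auto simp: basis_of_def)
  have B0: "0 \<notin> B i" if "i \<in> I" for i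
    using B[OF that] dependent_zero by (auto simp: basis_of_def)
  have disj: "B i \<inter> B j = {}" if "i \<in> I" "j \<in> I" "i \<noteq> j" for i j
    using direct_decomp_disjoint[OF dd that(1,2)] BU that B0 by blast
  show "independent (\<Union>i\<in>I. B i)"
    unfolding independent_explicit_module
  proof (intro allI impI)
    fix t u v
    assume t: "finite t" "t \<subseteq> (\<Union>i\<in>I. B i)" "(\<Sum>v\<in>t. u v *s v) = 0" "v \<in> t"
    define x where "x = (\<lambda>i. \<Sum>b\<in>t \<inter> B i. u b *s b)"
    have "(\<Sum>i\<in>I. x i) = (\<Sum>b\<in>(\<Union>i\<in>I. t \<inter> B i). u b *s b)"
      unfolding x_def
      by (rule sum.UNION_disjoint[symmetric]) (use fin t disj in blast)+
    also have "(\<Union>i\<in>I. t \<inter> B i) = t" using t by auto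
    finally have "(\<Sum>i\<in>I. x i) = 0" using t by simp
    moreover have "\<forall>i\<in>I. x i \<in> U i"
      using sub BU by (auto simp: x_def intro!: subspace_sum subspace_scale)
    ultimately have x0: "\<forall>i\<in>I. x i = 0" using ind by blast
    obtain i where i: "i \<in> I" "v \<in> B i" using t by auto
    have "independent (B i)" using B[OF i(1)] by (simp add: basis_of_def)
    then show "u v = 0"
      by (rule independentD[where t = "t \<inter> B i"]) (use x0 i t in \<open>auto simp: x_def\<close>)
  qed
  show "span (\<Union>i\<in>I. B i) = W"
  proof
    show "span (\<Union>i\<in>I. B i) \<subseteq> W"
      unfolding W by (rule span_mono) (use BU in blast)
    have "U i \<subseteq> span (\<Union>i\<in>I. B i)" if "i \<in> I" for i
      using B[OF that] span_mono[of "B i" "\<Union>i\<in>I. B i"] that by (auto simp: basis_of_def)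
    then show "W \<subseteq> span (\<Union>i\<in>I. B i)"
      unfolding W by (intro span_minimal) auto
  qed
qed

text \<open>The orbit argument of \<open>transport_basis\<close> recognises an index by a nonzero
  vector in its summand, so zero summands have to be removed first.\<close>

lemma direct_decomp_nonzero:
  assumes "direct_decomp I U W"
  shows "direct_decomp {i \<in> I. U i \<noteq> {0}} U W"
proof -
  have fin: "finite I" and sub: "\<forall>k\<in>I. subspace (U k)"
    and ind: "\<And>v. \<lbrakk>\<forall>i\<in>I. v i \<in> U i; (\<Sum>i\<in>I. v i) = 0\<rbrakk> \<Longrightarrow> \<forall>i\<in>I. v i = 0"
    and W: "W = span (\<Union>i\<in>I. U i)"
    using assms by (auto simp: direct_decomp_def)
  have "span (\<Union>i\<in>I. U i) \<subseteq> span (\<Union>i\<in>{i \<in> I. U i \<noteq> {0}}. U i)"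
  proof (rule span_minimal)
    have "x \<in> span (\<Union>i\<in>{i \<in> I. U i \<noteq> {0}}. U i)" if "i \<in> I" "x \<in> U i" for i x
      using that by (cases "x = 0") (auto intro: span_zero span_base)
    then show "(\<Union>i\<in>I. U i) \<subseteq> span (\<Union>i\<in>{i \<in> I. U i \<noteq> {0}}. U i)" by blast
  qed simp
  then have "W = span (\<Union>i\<in>{i \<in> I. U i \<noteq> {0}}. U i)"
    unfolding W by (intro equalityI) (assumption, rule span_mono, blast)
  moreover have "\<forall>i\<in>{i \<in> I. U i \<noteq> {0}}. v i = 0"
    if v: "\<forall>i\<in>{i \<in> I. U i \<noteq> {0}}. v i \<in> U i" "(\<Sum>i\<in>{i \<in> I. U i \<noteq> {0}}. v i) = 0" for v
  proof -
    define x where "x = (\<lambda>i. if U i \<noteq> {0} then v i else 0)"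
    have "(\<Sum>i\<in>I. x i) = (\<Sum>i\<in>{i \<in> I. U i \<noteq> {0}}. v i)"
      by (rule sum.mono_neutral_cong_right) (use fin in \<open>auto simp: x_def\<close>)
    then have "\<forall>i\<in>I. x i = 0"
      by (intro ind) (use v sub subspace_0 in \<open>auto simp: x_def\<close>)
    then show ?thesis unfolding x_def by (metis (mono_tags, lifting) mem_Collect_eq)
  qed
  ultimately show ?thesis
    using fin sub by (auto simp: direct_decomp_def)
qed

lemma direct_decomp_refine:
  assumes dd: "direct_decomp I U W" and J: "\<And>i. i \<in> I \<Longrightarrow> direct_decomp (J i) (U' i) (U i)"
  shows "direct_decomp (SIGMA i:I. J i) (\<lambda>(i, j). U' i j) W"
proof -
  have fin: "finite I" and sub: "\<forall>k\<in>I. subspace (U k)"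
    and ind: "\<And>v. \<lbrakk>\<forall>i\<in>I. v i \<in> U i; (\<Sum>i\<in>I. v i) = 0\<rbrakk> \<Longrightarrow> \<forall>i\<in>I. v i = 0"
    and W: "W = span (\<Union>i\<in>I. U i)"
    using dd by (auto simp: direct_decomp_def)
  have finJ: "finite (J i)" and subJ: "\<forall>k\<in>J i. subspace (U' i k)"
    and indJ: "\<And>v. \<lbrakk>\<forall>j\<in>J i. v j \<in> U' i j; (\<Sum>j\<in>J i. v j) = 0\<rbrakk> \<Longrightarrow> \<forall>j\<in>J i. v j = 0"
    and UJ: "U i = span (\<Union>j\<in>J i. U' i j)" if "i \<in> I" for i
    using J[OF that] by (auto simp: direct_decomp_def)
  let ?S = "SIGMA i:I. J i"
  have sub': "U' i j \<subseteq> U i" if "i \<in> I" "j \<in> J i" for i j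
    unfolding UJ[OF that(1)] by (rule order_trans[OF _ span_superset]) (use that in auto)
  have "W = span (\<Union>p\<in>?S. case p of (i, j) \<Rightarrow> U' i j)"
  proof
    have "U i \<subseteq> span (\<Union>p\<in>?S. case p of (i, j) \<Rightarrow> U' i j)" if "i \<in> I" for i
      unfolding UJ[OF that] by (rule span_mono) (use that in auto)
    then show "W \<subseteq> span (\<Union>p\<in>?S. case p of (i, j) \<Rightarrow> U' i j)"
      unfolding W by (intro span_minimal) auto
    show "span (\<Union>p\<in>?S. case p of (i, j) \<Rightarrow> U' i j) \<subseteq> W"
      unfolding W by (rule span_mono) (use sub' in auto)
  qed
  moreover have "\<forall>p\<in>?S. v p = 0"
    if v: "\<forall>p\<in>?S. v p \<in> (case p of (i, j) \<Rightarrow> U' i j)" "(\<Sum>p\<in>?S. v p) = 0" for v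
  proof -
    have "(\<Sum>i\<in>I. \<Sum>j\<in>J i. v (i, j)) = 0"
      using v(2) fin finJ by (subst sum.Sigma) (auto simp: case_prod_beta)
    moreover have "\<forall>i\<in>I. (\<Sum>j\<in>J i. v (i, j)) \<in> U i"
    proof
      fix i assume i: "i \<in> I"
      then have "v (i, j) \<in> U i" if "j \<in> J i" for j
        using v(1) sub'[OF i that] that by auto
      then show "(\<Sum>j\<in>J i. v (i, j)) \<in> U i"
        using sub i by (intro subspace_sum) auto
    qed
    ultimately have "\<forall>i\<in>I. (\<Sum>j\<in>J i. v (i, j)) = 0" by (intro ind)
    then have "\<forall>j\<in>J i. v (i, j) = 0" if "i \<in> I" for i
      using indJ[OF that, of "\<lambda>j. v (i, j)"] v(1) that by auto
    then show ?thesis by auto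
  qed
  ultimately show ?thesis
    using fin finJ subJ by (auto simp: direct_decomp_def)
qed

lemma basis_of_spanning_subset:
  assumes "span S = W"
  obtains B where "B \<subseteq> S" "basis_of B W"
proof -
  obtain B where B: "B \<subseteq> S" "independent B" "S \<subseteq> span B"
    by (rule maximal_independent_subset)
  then have "span B = span S"
    by (simp add: span_eq) (metis span_superset subset_trans)
  then show ?thesis using that B assms by (auto simp: basis_of_def)
qed

lemma funpow_scale_linear:
  assumes "Vector_Spaces.linear scale scale f"
  shows "Vector_Spaces.linear scale scale (f ^^ n)"
proof (induction n)
  case 0
  then show ?case by (simp add: id_def linear_id[unfolded id_def])
next
  case (Suc n)
  then show ?case using Vector_Spaces.linear_compose[OF Suc assms] by (simp add: o_def)
qed

text \<open>Discrete Fourier transform: since \<open>f ^^ m\<close> is the scalar \<open>c\<close>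
  on \<open>W\<close>, the average \<open>\<pi> z\<close> of the operators \<open>z^-k f^k\<close>
  over \<open>k < m\<close> is the projection of \<open>W\<close> onto the eigenspace of
  \<open>z\<close>, for each of the \<open>m\<close> roots \<open>z\<close> of
  \<open>c\<close>.\<close>

lemma eigenspace_decomp:
  assumes lin: "Vector_Spaces.linear scale scale f" and W: "subspace W" "f ` W \<subseteq> W"
    and m: "m > 0" "c \<noteq> 0" and fm: "\<And>v. v \<in> W \<Longrightarrow> (f ^^ m) v = c *s v"
  shows "direct_decomp {z. z ^ m = c} (\<lambda>z. {v \<in> W. f v = z *s v}) W"
proof -
  interpret f: Vector_Spaces.linear scale scale f by fact
  define E where "E = (\<lambda>z. {v \<in> W. f v = z *s v})"
  define \<pi> where "\<pi> = (\<lambda>z v. inverse (of_nat m) *s (\<Sum>k<m. inverse z ^ k *s (f ^^ k) v))"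
  have fk_W: "(f ^^ k) v \<in> W" if "v \<in> W" for k v
    using that W(2) by (induction k) auto
  have z_nz: "z \<noteq> 0" if "z ^ m = c" for z
    using that m by (auto simp: power_0_left)
  have \<pi>_E: "\<pi> z v \<in> E z" if "v \<in> W" "z ^ m = c" for z v
  proof -
    have "\<pi> z v \<in> W"
      using W(1) fk_W[OF that(1)] by (auto simp: \<pi>_def intro!: subspace_scale subspace_sum)
    moreover have "f (\<pi> z v) = z *s \<pi> z v"
    proof -
      let ?g = "\<lambda>k. inverse z ^ k *s (f ^^ k) v"
      \<comment> \<open>\<open>?g m\<close> equals \<open>?g 0\<close>, so applying \<open>f\<close>
        shifts the sum cyclically at the cost of a factor \<open>z\<close>.\<close>
      have "?g m = v"
        using fm[OF that(1)] that(2) m(2) by (simp add: power_inverse)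
      then have "(\<Sum>k<m. ?g (Suc k)) = (\<Sum>k<m. ?g k)"
        using sum.lessThan_Suc_shift[of ?g m] by (simp add: add.commute)
      moreover have "f (?g k) = z *s ?g (Suc k)" for k
        using z_nz[OF that(2)] by (simp add: f.scale)
      ultimately have "f (\<Sum>k<m. ?g k) = z *s (\<Sum>k<m. ?g k)"
        unfolding f.sum by (simp only: scale_sum_right[symmetric])
      then show ?thesis
        by (simp only: \<pi>_def f.scale scale_left_commute)
    qed
    ultimately show ?thesis by (simp add: E_def)
  qed
  have sum_\<pi>: "(\<Sum>z | z ^ m = c. \<pi> z v) = v" for v
  proof -
    have "(\<Sum>z | z ^ m = c. \<pi> z v) =
        inverse (of_nat m) *s (\<Sum>z | z ^ m = c. \<Sum>k<m. inverse z ^ k *s (f ^^ k) v)"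
      by (simp only: \<pi>_def scale_sum_right)
    also have "(\<Sum>z | z ^ m = c. \<Sum>k<m. inverse z ^ k *s (f ^^ k) v) =
        (\<Sum>k<m. (\<Sum>z | z ^ m = c. inverse z ^ k) *s (f ^^ k) v)"
      unfolding scale_sum_left by (rule sum.swap)
    finally have "(\<Sum>z | z ^ m = c. \<pi> z v) =
        inverse (of_nat m) *s (\<Sum>k<m. (\<Sum>z | z ^ m = c. inverse z ^ k) *s (f ^^ k) v)" .
    also have "\<dots> = inverse (of_nat m) *s (\<Sum>k<m. if k = 0 then of_nat m *s v else 0)"
      by (intro arg_cong2[where f = scale] sum.cong refl)
        (auto simp: sum_inverse_powers_of_roots(2)[OF m])
    also have "\<dots> = v"
      using m by (simp add: sum.delta)
    finally show ?thesis .
  qed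
  have \<pi>_eig: "\<pi> z v = (if z = y then v else 0)" if "v \<in> E y" "z ^ m = c" "y ^ m = c" for z y v
  proof -
    have fk: "(f ^^ k) v = y ^ k *s v" for k
      using that(1) by (induction k) (auto simp: E_def f.scale mult.commute)
    have "\<pi> z v = (inverse (of_nat m) * (\<Sum>k<m. (y / z) ^ k)) *s v"
      by (simp add: \<pi>_def fk scale_sum_left[symmetric] divide_inverse power_mult_distrib mult.commute)
    moreover have "(\<Sum>k<m. (y / z) ^ k) = 0" if "z \<noteq> y"
    proof -
      have "(y / z - 1) * (\<Sum>k<m. (y / z) ^ k) = (y / z) ^ m - 1"
        by (rule power_diff_1_eq[symmetric])
      also have "\<dots> = 0" using \<open>z ^ m = c\<close> \<open>y ^ m = c\<close> m by (simp add: power_divide)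
      finally show ?thesis using that z_nz[OF \<open>z ^ m = c\<close>] by auto
    qed
    ultimately show ?thesis using m z_nz[OF that(2)] by (auto simp: divide_self)
  qed
  have lin\<pi>: "\<pi> z (\<Sum>i\<in>A. x i) = (\<Sum>i\<in>A. \<pi> z (x i))" for z A and x :: "'k \<Rightarrow> 'v"
  proof -
    have "(f ^^ k) (\<Sum>i\<in>A. x i) = (\<Sum>i\<in>A. (f ^^ k) (x i))" for k
      by (induction k) (auto simp: f.sum)
    then have "\<pi> z (\<Sum>i\<in>A. x i) =
        inverse (of_nat m) *s (\<Sum>k<m. \<Sum>i\<in>A. inverse z ^ k *s (f ^^ k) (x i))"
      by (simp only: \<pi>_def scale_sum_right)
    also have "(\<Sum>k<m. \<Sum>i\<in>A. inverse z ^ k *s (f ^^ k) (x i)) =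
        (\<Sum>i\<in>A. \<Sum>k<m. inverse z ^ k *s (f ^^ k) (x i))"
      by (rule sum.swap)
    finally show ?thesis
      by (simp only: \<pi>_def scale_sum_right)
  qed
  have "W = span (\<Union>z\<in>{z. z ^ m = c}. E z)"
  proof
    show "W \<subseteq> span (\<Union>z\<in>{z. z ^ m = c}. E z)"
    proof
      fix v assume "v \<in> W"
      then have "(\<Sum>z | z ^ m = c. \<pi> z v) \<in> span (\<Union>z\<in>{z. z ^ m = c}. E z)"
        by (intro span_sum span_base) (auto intro: \<pi>_E)
      then show "v \<in> span (\<Union>z\<in>{z. z ^ m = c}. E z)" by (simp add: sum_\<pi>)
    qed
    show "span (\<Union>z\<in>{z. z ^ m = c}. E z) \<subseteq> W"
      by (rule span_minimal) (use W in \<open>auto simp: E_def\<close>)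
  qed
  moreover have "\<forall>z\<in>{z. z ^ m = c}. x z = 0"
    if x: "\<forall>z\<in>{z. z ^ m = c}. x z \<in> E z" "(\<Sum>z | z ^ m = c. x z) = 0" for x
  proof
    fix y assume y: "y \<in> {z. z ^ m = c}"
    have "\<pi> y 0 = 0" using lin\<pi>[of y x "{}"] by simp
    then have "0 = (\<Sum>z | z ^ m = c. \<pi> y (x z))"
      using x(2) lin\<pi>[of y x "{z. z ^ m = c}"] by simp
    also have "\<dots> = (\<Sum>z | z ^ m = c. if y = z then x z else 0)"
      by (rule sum.cong[OF refl]) (use x(1) y \<pi>_eig in auto)
    also have "\<dots> = x y"
      using y sum_inverse_powers_of_roots(1)[OF m] by (simp add: sum.delta')
    finally show "x y = 0" by simp
  qed
  moreover have "subspace (E z)" for z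
    using W(1) by (auto simp: subspace_def E_def f.add f.scale scale_right_distrib scale_left_commute f.zero)
  ultimately show ?thesis
    using sum_inverse_powers_of_roots(1)[OF m] by (simp add: direct_decomp_def E_def)
qed

lemma eigenbasis:
  assumes lin: "Vector_Spaces.linear scale scale f" and W: "subspace W" "f ` W \<subseteq> W"
    and m: "m > 0" "c \<noteq> 0" and fm: "\<And>v. v \<in> W \<Longrightarrow> (f ^^ m) v = c *s v"
  obtains B where "basis_of B W" "\<And>b. b \<in> B \<Longrightarrow> \<exists>z. z \<noteq> 0 \<and> f b = z *s b"
proof -
  have dd: "direct_decomp {z. z ^ m = c} (\<lambda>z. {v \<in> W. f v = z *s v}) W"
    by (rule eigenspace_decomp) (fact assms)+
  then have "span (\<Union>z\<in>{z. z ^ m = c}. {v \<in> W. f v = z *s v}) = W"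
    by (simp add: direct_decomp_def)
  then obtain B where B: "B \<subseteq> (\<Union>z\<in>{z. z ^ m = c}. {v \<in> W. f v = z *s v})" "basis_of B W"
    by (rule basis_of_spanning_subset)
  have "\<exists>z. z \<noteq> 0 \<and> f b = z *s b" if b: "b \<in> B" for b
  proof -
    obtain z where "z ^ m = c" "f b = z *s b" using B(1) b by auto
    moreover from this have "z \<noteq> 0" using m by (auto simp: power_0_left)
    ultimately show ?thesis by blast
  qed
  then show ?thesis using that B(2) by blast
qed

end

section \<open>Monomial bases for projective dihedral actions\<close>

context ac_vector_space
begin

abbreviation lin :: "('v \<Rightarrow> 'v) \<Rightarrow> bool"
  where "lin f \<equiv> Vector_Spaces.linear scale scale f"

lemma lin_scale: "lin f \<Longrightarrow> f (c *s v) = c *s f v"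
  by (simp add: Vector_Spaces.linear_iff)

lemma lin_comp: "lin f \<Longrightarrow> lin g \<Longrightarrow> lin (f \<circ> g)"
  by (rule Vector_Spaces.linear_compose)

lemma lin_id: "lin id"
  by (rule linear_id)

text \<open>One scalar serves for the whole of \<open>U\<close>, but different pieces may have
  different scalars: this is the form in which a projective action is available here.\<close>

definition proportional_on :: "'v set \<Rightarrow> ('v \<Rightarrow> 'v) \<Rightarrow> ('v \<Rightarrow> 'v) \<Rightarrow> bool"
  where "proportional_on U f g \<longleftrightarrow> (\<exists>c. c \<noteq> 0 \<and> (\<forall>v\<in>U. f v = c *s g v))"

lemma proportional_on_refl [simp]: "proportional_on U f f"
  unfolding proportional_on_def by (rule exI[of _ 1]) simp

lemma proportional_on_sym: "proportional_on U f g \<Longrightarrow> proportional_on U g f"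
  unfolding proportional_on_def
proof (elim exE conjE)
  fix c assume "c \<noteq> 0" "\<forall>v\<in>U. f v = c *s g v"
  then show "\<exists>c. c \<noteq> 0 \<and> (\<forall>v\<in>U. g v = c *s f v)"
    by (intro exI[of _ "inverse c"]) auto
qed

lemma proportional_on_trans [trans]:
  "proportional_on U f g \<Longrightarrow> proportional_on U g h \<Longrightarrow> proportional_on U f h"
  unfolding proportional_on_def
proof (elim exE conjE)
  fix c d assume "c \<noteq> 0" "\<forall>v\<in>U. f v = c *s g v" "d \<noteq> 0" "\<forall>v\<in>U. g v = d *s h v"
  then show "\<exists>c. c \<noteq> 0 \<and> (\<forall>v\<in>U. f v = c *s h v)"
    by (intro exI[of _ "c * d"]) auto
qed

lemma proportional_on_comp_left:
  "lin h \<Longrightarrow> proportional_on U f g \<Longrightarrow> proportional_on U (h \<circ> f) (h \<circ> g)"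
  unfolding proportional_on_def by (auto simp: lin_scale)

lemma proportional_on_comp_right:
  "proportional_on U' f g \<Longrightarrow> h ` U \<subseteq> U' \<Longrightarrow> proportional_on U (f \<circ> h) (g \<circ> h)"
  unfolding proportional_on_def by (metis comp_apply image_subset_iff)

lemma proportional_on_image:
  "proportional_on U f g \<Longrightarrow> subspace U' \<Longrightarrow> g ` U \<subseteq> U' \<Longrightarrow> f ` U \<subseteq> U'"
  unfolding proportional_on_def by (auto intro!: subspace_scale)

lemma monomial_on_proportional:
  "monomial_on B g \<Longrightarrow> proportional_on U f g \<Longrightarrow> B \<subseteq> U \<Longrightarrow> monomial_on B f"
  unfolding proportional_on_def monomial_on_def
proof (elim exE conjE, intro ballI)
  fix c b
  assume "\<forall>b\<in>B. \<exists>b'\<in>B. \<exists>c. c \<noteq> 0 \<and> g b = c *s b'" "B \<subseteq> U" "c \<noteq> 0" "\<forall>v\<in>U. f v = c *s g v" "b \<in> B"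
  then obtain b' d where "b' \<in> B" "d \<noteq> 0" "g b = d *s b'" "f b = c *s g b" by blast
  then show "\<exists>b'\<in>B. \<exists>c. c \<noteq> 0 \<and> f b = c *s b'"
    using \<open>c \<noteq> 0\<close> by (intro bexI[of _ b'] exI[of _ "c * d"]) auto
qed

lemma monomial_on_comp:
  "lin f \<Longrightarrow> monomial_on B f \<Longrightarrow> monomial_on B g \<Longrightarrow> monomial_on B (f \<circ> g)"
  unfolding monomial_on_def
proof (intro ballI)
  fix b
  assume f: "lin f" "\<forall>b\<in>B. \<exists>b'\<in>B. \<exists>c. c \<noteq> 0 \<and> f b = c *s b'"
    and "\<forall>b\<in>B. \<exists>b'\<in>B. \<exists>c. c \<noteq> 0 \<and> g b = c *s b'" "b \<in> B"
  then obtain b' c where b': "b' \<in> B" "c \<noteq> 0" "g b = c *s b'" by blast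
  then obtain b'' d where "b'' \<in> B" "d \<noteq> 0" "f b' = d *s b''" using f by blast
  then show "\<exists>b'\<in>B. \<exists>c. c \<noteq> 0 \<and> (f \<circ> g) b = c *s b'"
    using b' f(1) by (intro bexI[of _ b''] exI[of _ "c * d"]) (auto simp: lin_scale)
qed

lemma monomial_on_id: "monomial_on B id"
  unfolding monomial_on_def id_apply by (metis one_neq_zero scale_one)

lemma monomial_on_funpow: "lin f \<Longrightarrow> monomial_on B f \<Longrightarrow> monomial_on B (f ^^ n)"
  by (induction n) (auto simp: monomial_on_id monomial_on_comp)

lemma basis_of_subset: "basis_of B W \<Longrightarrow> B \<subseteq> W"
  unfolding basis_of_def using span_superset by blast

text \<open>The argument for induced representations, for a set \<open>\<Gamma>\<close> that is a
  group only up to scalars on each summand. In each orbit of summands one representative gets a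
  basis that is monomial for its stabiliser, and fixed elements \<open>\<gamma> i\<close> carry it
  to the other summands.\<close>

lemma transport_basis:
  assumes dd: "direct_decomp I U W" and nz: "\<And>i. i \<in> I \<Longrightarrow> U i \<noteq> {0}"
    and lin: "\<And>f. f \<in> \<Gamma> \<Longrightarrow> lin f" and id: "id \<in> \<Gamma>"
    and perm: "\<And>f i. f \<in> \<Gamma> \<Longrightarrow> i \<in> I \<Longrightarrow> \<exists>j\<in>I. f ` U i \<subseteq> U j"
    and comp: "\<And>f g. f \<in> \<Gamma> \<Longrightarrow> g \<in> \<Gamma> \<Longrightarrow> \<exists>h\<in>\<Gamma>. \<forall>i\<in>I. proportional_on (U i) (f \<circ> g) h"
    and inv: "\<And>f. f \<in> \<Gamma> \<Longrightarrow> \<exists>g\<in>\<Gamma>. \<forall>i\<in>I. proportional_on (U i) (g \<circ> f) id \<and>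
                                            proportional_on (U i) (f \<circ> g) id"
    and stab: "\<And>i. i \<in> I \<Longrightarrow> \<exists>B. basis_of B (U i) \<and> (\<forall>f\<in>\<Gamma>. f ` U i \<subseteq> U i \<longrightarrow> monomial_on B f)"
  obtains B where "basis_of B W" "B \<subseteq> (\<Union>i\<in>I. U i)" "\<And>f. f \<in> \<Gamma> \<Longrightarrow> monomial_on B f"
proof -
  have sub: "subspace (U i)" if "i \<in> I" for i
    using dd that by (auto simp: direct_decomp_def)
  \<comment> \<open>The inverse maps \<open>U j\<close> into some summand; the image of one nonzero
    vector under \<open>g \<circ> f\<close> shows that this summand is \<open>U i\<close>.\<close>
  have inv': "\<exists>g\<in>\<Gamma>. g ` U j \<subseteq> U i \<and> proportional_on (U i) (g \<circ> f) id \<and> proportional_on (U j) (f \<circ> g) id"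
    if f: "f \<in> \<Gamma>" "i \<in> I" "j \<in> I" "f ` U i \<subseteq> U j" for f i j
  proof -
    obtain g where g: "g \<in> \<Gamma>" "\<And>i. i \<in> I \<Longrightarrow> proportional_on (U i) (g \<circ> f) id"
        "\<And>i. i \<in> I \<Longrightarrow> proportional_on (U i) (f \<circ> g) id"
      using inv[OF f(1)] by blast
    obtain k where k: "k \<in> I" "g ` U j \<subseteq> U k" using perm[OF g(1) f(3)] by blast
    obtain v where v: "v \<in> U i" "v \<noteq> 0" using nz[OF f(2)] subspace_0[OF sub[OF f(2)]] by blast
    obtain c where c: "c \<noteq> 0" "g (f v) = c *s v"
      using g(2)[OF f(2)] v(1) by (auto simp: proportional_on_def)
    have "g (f v) \<in> U k" using k f v by blast
    moreover have "g (f v) \<in> U i" using c v sub[OF f(2)] by (auto intro: subspace_scale)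
    ultimately have "i = k"
      by (metis c v(2) direct_decomp_disjoint[OF dd f(2) k(1)] scale_eq_0_iff)
    then show ?thesis using g k f by blast
  qed
  have comp': "\<exists>h\<in>\<Gamma>. h ` U i \<subseteq> U k \<and> proportional_on (U i) (f \<circ> g) h"
    if fg: "f \<in> \<Gamma>" "g \<in> \<Gamma>" "i \<in> I" "k \<in> I" "g ` U i \<subseteq> U j" "f ` U j \<subseteq> U k" for f g i j k
  proof -
    obtain h where h: "h \<in> \<Gamma>" "proportional_on (U i) (f \<circ> g) h"
      using comp[OF fg(1,2)] fg(3) by blast
    have "h ` U i \<subseteq> U k"
      by (rule proportional_on_image[OF proportional_on_sym[OF h(2)] sub]) (use fg in auto)
    then show ?thesis using h by blast
  qed
  define rel where "rel = (\<lambda>i j. i \<in> I \<and> j \<in> I \<and> (\<exists>f\<in>\<Gamma>. f ` U i \<subseteq> U j))"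
  have rel_refl: "rel i i" if "i \<in> I" for i
    using that id by (auto simp: rel_def intro!: bexI[of _ id])
  have rel_sym: "rel j i" if "rel i j" for i j
    using that inv' unfolding rel_def by meson
  have rel_trans: "rel i k" if "rel i j" "rel j k" for i j k
    using that comp' unfolding rel_def by meson
  \<comment> \<open>Related indices satisfy the same predicate, so the choice is constant on
    orbits.\<close>
  define rep where "rep = (\<lambda>i. SOME r. rel r i)"
  have rep: "rel (rep i) i" if "i \<in> I" for i
    unfolding rep_def by (rule someI[of _ i]) (rule rel_refl[OF that])
  have rep_eq: "rep i = rep j" if "rel i j" for i j
  proof -
    have "(\<lambda>r. rel r i) = (\<lambda>r. rel r j)"
      using that rel_sym rel_trans by blast
    then show ?thesis by (simp add: rep_def)
  qed
  have rep_I: "rep i \<in> I" if "i \<in> I" for i using rep[OF that] by (simp add: rel_def)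
  have "\<forall>i\<in>I. \<exists>f\<in>\<Gamma>. f ` U (rep i) \<subseteq> U i" using rep by (auto simp: rel_def)
  then obtain \<gamma> where \<gamma>: "\<And>i. i \<in> I \<Longrightarrow> \<gamma> i \<in> \<Gamma>" "\<And>i. i \<in> I \<Longrightarrow> \<gamma> i ` U (rep i) \<subseteq> U i"
    by metis
  obtain Bs where Bs: "\<And>i. i \<in> I \<Longrightarrow> basis_of (Bs i) (U i)"
      "\<And>i f. i \<in> I \<Longrightarrow> f \<in> \<Gamma> \<Longrightarrow> f ` U i \<subseteq> U i \<Longrightarrow> monomial_on (Bs i) f"
    using stab by metis
  define B where "B = (\<lambda>i. \<gamma> i ` Bs (rep i))"
  have basisB: "basis_of (B i) (U i)" if i: "i \<in> I" for i
  proof -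
    note r = rep_I[OF i]
    interpret \<gamma>i: Vector_Spaces.linear scale scale "\<gamma> i" by (rule lin[OF \<gamma>(1)[OF i]])
    obtain g where g: "g \<in> \<Gamma>" "g ` U i \<subseteq> U (rep i)" "proportional_on (U (rep i)) (g \<circ> \<gamma> i) id"
        "proportional_on (U i) (\<gamma> i \<circ> g) id"
      using inv'[OF \<gamma>(1)[OF i] r i \<gamma>(2)[OF i]] by blast
    have sp: "span (Bs (rep i)) = U (rep i)" "independent (Bs (rep i))"
      using Bs(1)[OF r] by (auto simp: basis_of_def)
    obtain c where c: "c \<noteq> 0" "\<And>v. v \<in> U (rep i) \<Longrightarrow> g (\<gamma> i v) = c *s v"
      using g(3) by (auto simp: proportional_on_def)
    obtain d where d: "d \<noteq> 0" "\<And>v. v \<in> U i \<Longrightarrow> \<gamma> i (g v) = d *s v"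
      using g(4) by (auto simp: proportional_on_def)
    have "inj_on (\<gamma> i) (span (Bs (rep i)))"
      unfolding sp by (rule inj_onI) (metis c scale_left_imp_eq)
    then have "independent (B i)"
      unfolding B_def by (rule \<gamma>i.independent_injective_image[OF sp(2)])
    moreover have "span (B i) = \<gamma> i ` U (rep i)"
      unfolding B_def \<gamma>i.span_image sp ..
    moreover have "U i \<subseteq> \<gamma> i ` U (rep i)"
    proof
      fix v assume v: "v \<in> U i"
      have "v = \<gamma> i (inverse d *s g v)" using d v by (simp add: \<gamma>i.scale)
      moreover have "inverse d *s g v \<in> U (rep i)"
        using g(2) v sub[OF r] by (auto intro!: subspace_scale)
      ultimately show "v \<in> \<gamma> i ` U (rep i)" by blast
    qed
    ultimately show ?thesis using \<gamma>(2)[OF i] by (auto simp: basis_of_def)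
  qed
  have "basis_of (\<Union>i\<in>I. B i) W"
    by (rule direct_decomp_basis[OF dd basisB])
  moreover have "(\<Union>i\<in>I. B i) \<subseteq> (\<Union>i\<in>I. U i)"
    using basisB basis_of_subset by blast
  moreover have "monomial_on (\<Union>i\<in>I. B i) f" if f: "f \<in> \<Gamma>" for f
    unfolding monomial_on_def
  proof
    fix b assume "b \<in> (\<Union>i\<in>I. B i)"
    then obtain i b0 where i: "i \<in> I" and b0: "b0 \<in> Bs (rep i)" "b = \<gamma> i b0"
      by (auto simp: B_def)
    obtain k where k: "k \<in> I" "f ` U i \<subseteq> U k" using perm[OF f i] by blast
    then have "rel i k" using i f by (auto simp: rel_def)
    then have repk: "rep k = rep i" using rep_eq by simp
    note r = rep_I[OF i]
    have b0U: "b0 \<in> U (rep i)" using Bs(1)[OF r] b0 basis_of_subset by blast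
    \<comment> \<open>\<open>g\<close> inverts \<open>\<gamma> k\<close> up to a scalar. The element
      \<open>h2\<close> obtained below is proportional to
      \<open>g \<circ> f \<circ> \<gamma> i\<close>, which stabilises the representative and hence
      is monomial on its basis.\<close>
    obtain g where g: "g \<in> \<Gamma>" "g ` U k \<subseteq> U (rep i)" "proportional_on (U k) (\<gamma> k \<circ> g) id"
      using inv'[OF \<gamma>(1)[OF k(1)] rep_I[OF k(1)] k(1) \<gamma>(2)[OF k(1)]] repk by auto
    obtain h1 where h1: "h1 \<in> \<Gamma>" "h1 ` U (rep i) \<subseteq> U k" "proportional_on (U (rep i)) (f \<circ> \<gamma> i) h1"
      using comp'[OF f \<gamma>(1)[OF i] r k(1) \<gamma>(2)[OF i] k(2)] by blast
    obtain h2 where h2: "h2 \<in> \<Gamma>" "h2 ` U (rep i) \<subseteq> U (rep i)" "proportional_on (U (rep i)) (g \<circ> h1) h2"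
      using comp'[OF g(1) h1(1) r r h1(2) g(2)] by blast
    obtain b1 c where b1: "b1 \<in> Bs (rep i)" "c \<noteq> 0" "h2 b0 = c *s b1"
      using Bs(2)[OF r h2(1,2)] b0 unfolding monomial_on_def by blast
    obtain c1 where c1: "c1 \<noteq> 0" "f b = c1 *s h1 b0"
      using h1(3) b0U b0 by (auto simp: proportional_on_def)
    obtain c2 where c2: "c2 \<noteq> 0" "g (h1 b0) = c2 *s h2 b0"
      using h2(3) b0U by (auto simp: proportional_on_def)
    have "h1 b0 \<in> U k" using h1(2) b0U by blast
    then obtain c3 where c3: "c3 \<noteq> 0" "\<gamma> k (g (h1 b0)) = c3 *s h1 b0"
      using g(3) by (auto simp: proportional_on_def)
    have "c3 *s h1 b0 = (c2 * c) *s \<gamma> k b1"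
      using c3(2) by (simp add: c2 b1 lin_scale[OF lin[OF \<gamma>(1)[OF k(1)]]])
    then have "h1 b0 = inverse c3 *s ((c2 * c) *s \<gamma> k b1)"
      using c3(1) by (metis scale_scale left_inverse scale_one)
    then have "f b = (c1 * inverse c3 * c2 * c) *s \<gamma> k b1"
      by (simp add: c1 mult.assoc)
    moreover have "\<gamma> k b1 \<in> (\<Union>i\<in>I. B i)"
      using k(1) b1(1) repk by (auto simp: B_def intro!: bexI[of _ k])
    moreover have "c1 * inverse c3 * c2 * c \<noteq> 0" using c1 c2 c3 b1 by simp
    ultimately show "\<exists>b'\<in>\<Union>i\<in>I. B i. \<exists>c. c \<noteq> 0 \<and> f b = c *s b'" by blast
  qed
  ultimately show ?thesis using that by blast
qed

lemma monomial_on_eigenvectors: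
  "(\<And>b. b \<in> B \<Longrightarrow> \<exists>z. z \<noteq> 0 \<and> f b = z *s b) \<Longrightarrow> monomial_on B f"
  unfolding monomial_on_def by blast

text \<open>\<open>R s R = c2 s\<close> makes \<open>s\<close> send the eigenspace of
  \<open>R\<close> for \<open>z\<close> to that for \<open>c2 / z\<close>. As \<open>s\<close> is an
  involution up to a scalar, \<open>transport_basis\<close> applies to \<open>{id, s}\<close>: an
  eigenspace fixed by \<open>s\<close> gets an eigenbasis of \<open>s\<close>, the others are
  exchanged in pairs, and every basis vector remains an eigenvector of \<open>R\<close>.\<close>

lemma rotation_reflection_basis:
  assumes lin: "lin R" "lin s" and U: "subspace U" "R ` U \<subseteq> U" "s ` U \<subseteq> U"
    and m: "m > 0" and Rm: "proportional_on U (R ^^ m) id"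
    and ss: "proportional_on U (s \<circ> s) id" and RsR: "proportional_on U (R \<circ> s \<circ> R) s"
  obtains B where "basis_of B U" "monomial_on B R" "monomial_on B s"
proof -
  obtain c where c: "c \<noteq> 0" "\<And>v. v \<in> U \<Longrightarrow> (R ^^ m) v = c *s v"
    using Rm by (auto simp: proportional_on_def)
  obtain c1 where c1: "c1 \<noteq> 0" "\<And>v. v \<in> U \<Longrightarrow> s (s v) = c1 *s v"
    using ss by (auto simp: proportional_on_def)
  obtain c2 where c2: "c2 \<noteq> 0" "\<And>v. v \<in> U \<Longrightarrow> R (s (R v)) = c2 *s s v"
    using RsR by (auto simp: proportional_on_def)
  define E where "E = (\<lambda>z. {v \<in> U. R v = z *s v})"
  have dd0: "direct_decomp {z. z ^ m = c} E U"
    unfolding E_def by (rule eigenspace_decomp) (fact lin U m c)+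
  define Z where "Z = {z \<in> {z. z ^ m = c}. E z \<noteq> {0}}"
  have dd: "direct_decomp Z E U"
    unfolding Z_def by (rule direct_decomp_nonzero[OF dd0])
  have subE: "subspace (E z)" if "z \<in> Z" for z
    using dd that by (auto simp: direct_decomp_def)
  have z_nz: "z \<noteq> 0" if "z \<in> Z" for z
    using that c m by (auto simp: Z_def power_0_left)
  have s_E: "c2 / z \<in> Z \<and> s ` E z \<subseteq> E (c2 / z)" if z: "z \<in> Z" for z
  proof -
    have im: "s ` E z \<subseteq> E (c2 / z)"
    proof
      fix w assume "w \<in> s ` E z"
      then obtain v where v: "v \<in> U" "R v = z *s v" "w = s v" by (auto simp: E_def)
      have "z *s R (s v) = c2 *s s v"
        using c2(2)[OF v(1)] v(2) lin by (simp add: lin_scale)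
      then have "R (s v) = inverse z *s (c2 *s s v)"
        using z_nz[OF z] by (metis scale_scale left_inverse scale_one)
      then show "w \<in> E (c2 / z)"
        using v U by (auto simp: E_def divide_inverse mult.commute)
    qed
    obtain v where v: "v \<in> E z" "v \<noteq> 0" using z subspace_0[OF subE[OF z]] by (auto simp: Z_def)
    then have vU: "v \<in> U" by (simp add: E_def)
    have sv: "s v \<noteq> 0" "s v \<in> E (c2 / z)"
      using c1(1) c1(2)[OF vU] v im lin_scale[OF lin(2), of 0 v] by auto
    \<comment> \<open>Membership in \<open>Z\<close> also requires \<open>c2 / z\<close> to be an
      \<open>m\<close>-th root of \<open>c\<close>; comparing \<open>R ^^ m\<close> on the nonzero
      vector \<open>s v\<close> shows this.\<close>
    have "(R ^^ k) (s v) = (c2 / z) ^ k *s s v" for k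
      using sv(2) by (induction k) (auto simp: E_def lin_scale[OF lin(1)] mult.commute)
    then have "(c2 / z) ^ m *s s v = c *s s v"
      using c(2)[of "s v"] vU U by auto
    then have "(c2 / z) ^ m = c" using sv(1) by simp
    then show ?thesis using im sv by (auto simp: Z_def)
  qed
  obtain B where B: "basis_of B U" "B \<subseteq> (\<Union>z\<in>Z. E z)" "\<And>f. f \<in> {id, s} \<Longrightarrow> monomial_on B f"
  proof (rule transport_basis[OF dd, of "{id, s}"])
    show "E z \<noteq> {0}" if "z \<in> Z" for z using that by (simp add: Z_def)
    show "lin f" if "f \<in> {id, s}" for f using that lin lin_id by auto
    show "\<exists>j\<in>Z. f ` E z \<subseteq> E j" if "f \<in> {id, s}" "z \<in> Z" for f z
      using that s_E[OF that(2)] by auto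
    have EU: "E z \<subseteq> U" for z by (auto simp: E_def)
    have ssE: "proportional_on (E z) (s \<circ> s) id" for z
      using ss EU unfolding proportional_on_def by blast
    show "\<exists>h\<in>{id, s}. \<forall>i\<in>Z. proportional_on (E i) (f \<circ> g) h" if "f \<in> {id, s}" "g \<in> {id, s}" for f g
      using that ssE by auto
    show "\<exists>g\<in>{id, s}. \<forall>i\<in>Z. proportional_on (E i) (g \<circ> f) id \<and> proportional_on (E i) (f \<circ> g) id"
      if "f \<in> {id, s}" for f
      using that ssE by auto
    show "\<exists>B. basis_of B (E z) \<and> (\<forall>f\<in>{id, s}. f ` E z \<subseteq> E z \<longrightarrow> monomial_on B f)" if z: "z \<in> Z" for z
    proof (cases "s ` E z \<subseteq> E z")
      case True
      obtain B where "basis_of B (E z)" "\<And>b. b \<in> B \<Longrightarrow> \<exists>z. z \<noteq> 0 \<and> s b = z *s b"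
        by (rule eigenbasis[OF lin(2) subE[OF z] True, of 2 c1])
          (use c1 EU in \<open>auto simp: numeral_2_eq_2\<close>)
      then show ?thesis
        using monomial_on_eigenvectors[of B s] monomial_on_id by blast
    next
      case False
      obtain B where "basis_of B (E z)"
        using basis_of_spanning_subset[of "E z" "E z"] subE[OF z] by (auto simp: span_eq_iff)
      then show ?thesis using False monomial_on_id by blast
    qed
  qed auto
  have "monomial_on B R"
    by (rule monomial_on_eigenvectors) (use B(2) z_nz in \<open>auto simp: E_def\<close>)
  then show ?thesis using that B by blast
qed

text \<open>Up to scalars \<open>P\<close> and \<open>T\<close> are involutions with product
  \<open>\<rho>\<close> of finite order, so the elements \<open>\<rho>^k\<close> and
  \<open>\<rho>^k P\<close> form a dihedral group permuting the summands. By
  \<open>transport_basis\<close> only stabilisers matter; these are generated by one rotation and at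
  most one reflection.\<close>

lemma dihedral_monomial_basis:
  assumes dd: "direct_decomp I U W" and lin: "lin P" "lin T"
    and P: "\<And>i. i \<in> I \<Longrightarrow> \<exists>j\<in>I. P ` U i \<subseteq> U j"
    and T: "\<And>i. i \<in> I \<Longrightarrow> \<exists>j\<in>I. T ` U i \<subseteq> U j"
    and PP: "\<And>i. i \<in> I \<Longrightarrow> proportional_on (U i) (P \<circ> P) id"
    and TT: "\<And>i. i \<in> I \<Longrightarrow> proportional_on (U i) (T \<circ> T) id"
    and m: "m > 0" and TPm: "\<And>i. i \<in> I \<Longrightarrow> proportional_on (U i) ((T \<circ> P) ^^ m) id"
    and nz: "\<And>i. i \<in> I \<Longrightarrow> U i \<noteq> {0}"
  obtains B where "basis_of B W" "B \<subseteq> (\<Union>i\<in>I. U i)" "monomial_on B P" "monomial_on B T"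
proof -
  have sub: "subspace (U i)" if "i \<in> I" for i
    using dd that by (auto simp: direct_decomp_def)
  define \<rho> where "\<rho> = T \<circ> P"
  \<comment> \<open>Exponents run over all natural numbers, which gives closure under products
    without reduction modulo \<open>m\<close>; the inverse of \<open>\<rho>\<close> is represented
    by \<open>\<rho>^(m-1)\<close>.\<close>
  define \<Gamma> where "\<Gamma> = range (\<lambda>k. \<rho> ^^ k) \<union> range (\<lambda>k. \<rho> ^^ k \<circ> P)"
  have lin_\<rho>: "lin (\<rho> ^^ k)" for k
    unfolding \<rho>_def by (intro funpow_scale_linear lin_comp lin)
  have perm_\<rho>: "\<exists>j\<in>I. (\<rho> ^^ k) ` U i \<subseteq> U j" if "i \<in> I" for i k
  proof (induction k)
    case (Suc k)
    then obtain j where j: "j \<in> I" "(\<rho> ^^ k) ` U i \<subseteq> U j" by blast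
    obtain j1 where j1: "j1 \<in> I" "P ` U j \<subseteq> U j1" using P[OF j(1)] by blast
    obtain j2 where j2: "j2 \<in> I" "T ` U j1 \<subseteq> U j2" using T[OF j1(1)] by blast
    have "(\<rho> ^^ Suc k) ` U i = T ` P ` (\<rho> ^^ k) ` U i"
      by (simp only: funpow.simps image_comp \<rho>_def o_assoc)
    then have "(\<rho> ^^ Suc k) ` U i \<subseteq> U j2" using j(2) j1(2) j2(2) by blast
    then show ?case using j2(1) by blast
  qed (use that in auto)
  have \<rho>_mk: "proportional_on (U i) (\<rho> ^^ (m * k)) id" if "i \<in> I" for i k
  proof (induction k)
    case (Suc k)
    have "proportional_on (U i) (\<rho> ^^ (m * k) \<circ> \<rho> ^^ m) (\<rho> ^^ (m * k) \<circ> id)"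
      by (intro proportional_on_comp_left lin_\<rho>) (use TPm[OF that] in \<open>simp add: \<rho>_def\<close>)
    also have "proportional_on (U i) (\<rho> ^^ (m * k) \<circ> id) id" unfolding comp_id by (rule Suc)
    finally show ?case by (simp only: funpow_add[symmetric] mult_Suc_right add.commute)
  qed auto
  \<comment> \<open>The dihedral relation \<open>P \<rho>^k = \<rho>^-k P\<close>, with
    \<open>(m - 1) * k\<close> in place of \<open>-k\<close>.\<close>
  have P\<rho>: "proportional_on (U i) (P \<circ> \<rho> ^^ k) (\<rho> ^^ ((m - 1) * k) \<circ> P)" if i: "i \<in> I" for i k
  proof (induction k)
    case (Suc k)
    have step: "proportional_on (U j) (P \<circ> \<rho>) (\<rho> ^^ (m - 1) \<circ> P)" if j: "j \<in> I" for j
    proof -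
      obtain j1 where j1: "j1 \<in> I" "P ` U j \<subseteq> U j1" using P[OF j] by blast
      obtain j2 where j2: "j2 \<in> I" "T ` U j1 \<subseteq> U j2" using T[OF j1(1)] by blast
      obtain j3 where j3: "j3 \<in> I" "P ` U j2 \<subseteq> U j3" using P[OF j2(1)] by blast
      have TPj: "(T \<circ> P) ` U j \<subseteq> U j2" using j1 j2 by auto
      have "proportional_on (U j) (\<rho> \<circ> P \<circ> \<rho>) (T \<circ> ((P \<circ> P) \<circ> (T \<circ> P)))"
        by (simp add: \<rho>_def o_assoc)
      also have "proportional_on (U j) (T \<circ> ((P \<circ> P) \<circ> (T \<circ> P))) (T \<circ> (id \<circ> (T \<circ> P)))"
        by (intro proportional_on_comp_left lin proportional_on_comp_right[OF PP[OF j2(1)] TPj])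
      also have "proportional_on (U j) (T \<circ> (id \<circ> (T \<circ> P))) ((T \<circ> T) \<circ> P)"
        by (simp add: o_assoc)
      also have "proportional_on (U j) ((T \<circ> T) \<circ> P) (id \<circ> P)"
        by (rule proportional_on_comp_right[OF TT[OF j1(1)] j1(2)])
      finally have "proportional_on (U j) (\<rho> \<circ> P \<circ> \<rho>) P" by simp
      then have *: "proportional_on (U j) (\<rho> ^^ (m - 1) \<circ> (\<rho> \<circ> P \<circ> \<rho>)) (\<rho> ^^ (m - 1) \<circ> P)"
        by (intro proportional_on_comp_left lin_\<rho>)
      have "proportional_on (U j3) (\<rho> ^^ m) id" using \<rho>_mk[OF j3(1), of 1] by (simp only: mult_1_right)
      then have "proportional_on (U j) (\<rho> ^^ m \<circ> (P \<circ> \<rho>)) (id \<circ> (P \<circ> \<rho>))"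
        by (rule proportional_on_comp_right) (use j3 TPj in \<open>auto simp: \<rho>_def\<close>)
      moreover have "\<rho> ^^ m \<circ> (P \<circ> \<rho>) = \<rho> ^^ (m - 1) \<circ> (\<rho> \<circ> P \<circ> \<rho>)"
        using m by (cases m) (auto simp: o_assoc funpow_swap1 fun_eq_iff)
      ultimately show ?thesis
        using * proportional_on_sym proportional_on_trans by (metis id_comp)
    qed
    obtain j where j: "j \<in> I" "(\<rho> ^^ k) ` U i \<subseteq> U j" using perm_\<rho>[OF i] by blast
    have "proportional_on (U i) ((P \<circ> \<rho>) \<circ> \<rho> ^^ k) ((\<rho> ^^ (m - 1) \<circ> P) \<circ> \<rho> ^^ k)"
      by (rule proportional_on_comp_right[OF step[OF j(1)] j(2)])
    also have "proportional_on (U i) ((\<rho> ^^ (m - 1) \<circ> P) \<circ> \<rho> ^^ k) (\<rho> ^^ (m - 1) \<circ> (\<rho> ^^ ((m - 1) * k) \<circ> P))"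
      unfolding o_assoc[symmetric] by (intro proportional_on_comp_left lin_\<rho> Suc)
    finally show ?case
      by (simp only: o_assoc funpow_add funpow.simps mult_Suc_right)
  qed auto
  have P\<rho>P: "proportional_on (U i) (P \<circ> (\<rho> ^^ k \<circ> P)) (\<rho> ^^ ((m - 1) * k))" if i: "i \<in> I" for i k
  proof -
    obtain j where j: "j \<in> I" "P ` U i \<subseteq> U j" using P[OF i] by blast
    have "proportional_on (U i) (P \<circ> (\<rho> ^^ k \<circ> P)) ((\<rho> ^^ ((m - 1) * k) \<circ> P) \<circ> P)"
      unfolding o_assoc by (rule proportional_on_comp_right[OF P\<rho>[OF j(1)] j(2)])
    also have "proportional_on (U i) ((\<rho> ^^ ((m - 1) * k) \<circ> P) \<circ> P) (\<rho> ^^ ((m - 1) * k) \<circ> id)"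
      unfolding o_assoc[symmetric] by (intro proportional_on_comp_left lin_\<rho> PP i)
    finally show ?thesis unfolding comp_id .
  qed
  have mk: "k + (m - 1) * k = m * k" for k using m by (cases m) auto
  have \<rho>P\<rho>P: "proportional_on (U i) ((\<rho> ^^ j \<circ> P) \<circ> (\<rho> ^^ k \<circ> P)) (\<rho> ^^ (j + (m - 1) * k))" if "i \<in> I" for i j k
    unfolding funpow_add o_assoc[symmetric] by (intro proportional_on_comp_left lin_\<rho> P\<rho>P[unfolded o_assoc[symmetric]] that)
  have \<rho>P_square: "proportional_on (U i) ((\<rho> ^^ k \<circ> P) \<circ> (\<rho> ^^ k \<circ> P)) id" if "i \<in> I" for i k
    using proportional_on_trans[OF \<rho>P\<rho>P[OF that, of k k, unfolded mk] \<rho>_mk[OF that]] .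
  obtain B where B: "basis_of B W" "B \<subseteq> (\<Union>i\<in>I. U i)" "\<And>f. f \<in> \<Gamma> \<Longrightarrow> monomial_on B f"
  proof (rule transport_basis[OF dd nz, of \<Gamma>])
    show "lin f" if "f \<in> \<Gamma>" for f
      using that lin_\<rho> lin_comp[OF lin_\<rho> lin(1)] by (auto simp only: \<Gamma>_def)
    have "\<rho> ^^ 0 = id" by (simp add: fun_eq_iff)
    then show "id \<in> \<Gamma>" unfolding \<Gamma>_def by (metis UnI1 rangeI)
    show "\<exists>j\<in>I. f ` U i \<subseteq> U j" if "f \<in> \<Gamma>" and i: "i \<in> I" for f i
    proof -
      obtain j where j: "j \<in> I" "P ` U i \<subseteq> U j" using P[OF i] by blast
      have "\<exists>l\<in>I. (\<rho> ^^ k \<circ> P) ` U i \<subseteq> U l" for k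
        using perm_\<rho>[OF j(1), of k] j(2) by (fastforce simp: image_subset_iff)
      then show ?thesis using that perm_\<rho>[OF i] unfolding \<Gamma>_def by blast
    qed
    show "\<exists>h\<in>\<Gamma>. \<forall>i\<in>I. proportional_on (U i) (f \<circ> g) h" if fg: "f \<in> \<Gamma>" "g \<in> \<Gamma>" for f g
    proof -
      have rot: "\<rho> ^^ k \<in> \<Gamma>" and refl: "\<rho> ^^ k \<circ> P \<in> \<Gamma>" for k unfolding \<Gamma>_def by blast+
      have rr: "\<exists>h\<in>\<Gamma>. \<forall>i\<in>I. proportional_on (U i) (\<rho> ^^ j \<circ> \<rho> ^^ k) h"
        "\<exists>h\<in>\<Gamma>. \<forall>i\<in>I. proportional_on (U i) (\<rho> ^^ j \<circ> (\<rho> ^^ k \<circ> P)) h" for j k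
        using rot[of "j + k"] refl[of "j + k"] unfolding funpow_add o_assoc
        by (metis proportional_on_refl)+
      have "proportional_on (U i) ((\<rho> ^^ j \<circ> P) \<circ> \<rho> ^^ k) (\<rho> ^^ j \<circ> (\<rho> ^^ ((m - 1) * k) \<circ> P))" if "i \<in> I" for i j k
        unfolding o_assoc[symmetric] by (intro proportional_on_comp_left lin_\<rho> P\<rho> that)
      then have pr: "\<exists>h\<in>\<Gamma>. \<forall>i\<in>I. proportional_on (U i) ((\<rho> ^^ j \<circ> P) \<circ> \<rho> ^^ k) h" for j k
        using refl[of "j + (m - 1) * k"] unfolding funpow_add o_assoc by blast
      have pp: "\<exists>h\<in>\<Gamma>. \<forall>i\<in>I. proportional_on (U i) ((\<rho> ^^ j \<circ> P) \<circ> (\<rho> ^^ k \<circ> P)) h" for j k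
        using \<rho>P\<rho>P rot by blast
      from fg obtain j k where "f = \<rho> ^^ j \<or> f = \<rho> ^^ j \<circ> P" "g = \<rho> ^^ k \<or> g = \<rho> ^^ k \<circ> P"
        unfolding \<Gamma>_def by blast
      then show ?thesis using rr pr pp by metis
    qed
    show "\<exists>g\<in>\<Gamma>. \<forall>i\<in>I. proportional_on (U i) (g \<circ> f) id \<and> proportional_on (U i) (f \<circ> g) id"
      if "f \<in> \<Gamma>" for f
    proof -
      have "\<rho> ^^ ((m - 1) * k) \<circ> \<rho> ^^ k = \<rho> ^^ (m * k)" "\<rho> ^^ k \<circ> \<rho> ^^ ((m - 1) * k) = \<rho> ^^ (m * k)" for k
        by (simp_all only: funpow_add[symmetric] mk[symmetric] add.commute)
      then have "\<exists>g\<in>\<Gamma>. \<forall>i\<in>I. proportional_on (U i) (g \<circ> \<rho> ^^ k) id \<and> proportional_on (U i) (\<rho> ^^ k \<circ> g) id" for k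
        using \<rho>_mk by (intro bexI[of _ "\<rho> ^^ ((m - 1) * k)"]) (auto simp only: \<Gamma>_def)
      moreover have "\<exists>g\<in>\<Gamma>. \<forall>i\<in>I. proportional_on (U i) (g \<circ> (\<rho> ^^ k \<circ> P)) id \<and>
          proportional_on (U i) ((\<rho> ^^ k \<circ> P) \<circ> g) id" for k
        using \<rho>P_square by (intro bexI[of _ "\<rho> ^^ k \<circ> P"]) (auto simp only: \<Gamma>_def)
      ultimately show ?thesis using that unfolding \<Gamma>_def by blast
    qed
    show "\<exists>B. basis_of B (U i) \<and> (\<forall>f\<in>\<Gamma>. f ` U i \<subseteq> U i \<longrightarrow> monomial_on B f)" if i: "i \<in> I" for i
    proof -
      obtain v0 where v0: "v0 \<in> U i" "v0 \<noteq> 0" using nz[OF i] subspace_0[OF sub[OF i]] by blast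
      have m_stab: "(\<rho> ^^ (m * k)) ` U i \<subseteq> U i" for k
        by (rule proportional_on_image[OF \<rho>_mk[OF i] sub[OF i]]) simp
      \<comment> \<open>The smallest positive rotation stabilising the summand; \<open>m\<close> is
        a candidate because \<open>\<rho>^m\<close> is a scalar there.\<close>
      define d where "d = (LEAST d. d > 0 \<and> (\<rho> ^^ d) ` U i \<subseteq> U i)"
      have d: "d > 0" "(\<rho> ^^ d) ` U i \<subseteq> U i"
        using LeastI[of "\<lambda>d. d > 0 \<and> (\<rho> ^^ d) ` U i \<subseteq> U i" m] m m_stab[of 1]
        by (auto simp: d_def)
      define R where "R = \<rho> ^^ d"
      have R: "lin R" "R ` U i \<subseteq> U i" using lin_\<rho> d by (auto simp: R_def)
      have Rk: "R ^^ k = \<rho> ^^ (d * k)" for k by (simp add: R_def funpow_mult mult.commute)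
      have Rk_stab: "(R ^^ k) ` U i \<subseteq> U i" for k
        using R(2) by (induction k) (auto simp: image_subset_iff)
      have Rm: "proportional_on (U i) (R ^^ m) id"
        using \<rho>_mk[OF i, of d] by (simp only: Rk mult.commute)
      \<comment> \<open>Division with remainder by \<open>d\<close>: the nonzero vector
        \<open>(\<rho> ^^ k) v0\<close> lies in \<open>U i\<close> and in the image summand of
        \<open>\<rho> ^^ (k mod d)\<close>, so the remainder stabilises \<open>U i\<close> too and
        must be 0 by minimality.\<close>
      have rot: "\<exists>q. \<rho> ^^ k = R ^^ q" if k: "(\<rho> ^^ k) ` U i \<subseteq> U i" for k
      proof -
        define w where "w = (R ^^ (k div d)) v0"
        have w: "w \<in> U i" using Rk_stab v0 by (auto simp: w_def)
        have split: "\<rho> ^^ k = \<rho> ^^ (k mod d) \<circ> R ^^ (k div d)"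
          by (simp add: Rk funpow_add[symmetric])
        have k0: "(\<rho> ^^ k) v0 \<noteq> 0"
        proof
          assume 0: "(\<rho> ^^ k) v0 = 0"
          obtain c where c: "c \<noteq> 0" "(\<rho> ^^ (m * k)) v0 = c *s v0"
            using \<rho>_mk[OF i] v0 by (auto simp: proportional_on_def)
          have "m * k = (m - 1) * k + k" using m by (cases m) auto
          then have "(\<rho> ^^ (m * k)) v0 = (\<rho> ^^ ((m - 1) * k)) 0"
            using 0 by (simp add: funpow_add)
          also have "\<dots> = 0" using lin_scale[OF lin_\<rho>, of "(m - 1) * k" 0 0] by simp
          finally show False using c v0 by simp
        qed
        obtain j where j: "j \<in> I" "(\<rho> ^^ (k mod d)) ` U i \<subseteq> U j" using perm_\<rho>[OF i] by blast
        have "(\<rho> ^^ k) v0 \<in> U j" using j w by (auto simp: split w_def)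
        moreover have "(\<rho> ^^ k) v0 \<in> U i" using k v0 by auto
        ultimately have "j = i" using direct_decomp_disjoint[OF dd j(1) i] k0 by blast
        then have "\<not> 0 < k mod d"
          using j not_less_Least[of "k mod d" "\<lambda>d. d > 0 \<and> (\<rho> ^^ d) ` U i \<subseteq> U i"] d(1)
          by (auto simp: d_def[symmetric])
        then show ?thesis using split by auto
      qed
      show ?thesis
      \<comment> \<open>With a stabilising reflection \<open>s\<close> present, every other one is a
        power of \<open>R\<close> times \<open>s\<close> up to a scalar. Without one, the stabiliser
        consists of powers of \<open>R\<close>, and an eigenbasis of \<open>R\<close> is
        enough.\<close>
      proof (cases "\<exists>k. (\<rho> ^^ k \<circ> P) ` U i \<subseteq> U i")
        case True
        then obtain k0 where k0: "(\<rho> ^^ k0 \<circ> P) ` U i \<subseteq> U i" by blast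
        define s where "s = \<rho> ^^ k0 \<circ> P"
        have s: "lin s" "s ` U i \<subseteq> U i" using k0 lin_\<rho> lin by (auto simp: s_def intro: lin_comp)
        obtain j where j: "j \<in> I" "P ` U i \<subseteq> U j" using P[OF i] by blast
        have ss: "proportional_on (U i) (s \<circ> s) id"
          unfolding s_def by (rule \<rho>P_square[OF i])
        have "proportional_on (U i) (\<rho> ^^ (d + k0) \<circ> (P \<circ> \<rho> ^^ d)) (\<rho> ^^ (d + k0) \<circ> (\<rho> ^^ ((m - 1) * d) \<circ> P))"
          by (intro proportional_on_comp_left lin_\<rho> P\<rho> i)
        also have "\<rho> ^^ (d + k0) \<circ> (\<rho> ^^ ((m - 1) * d) \<circ> P) = \<rho> ^^ k0 \<circ> (\<rho> ^^ (m * d) \<circ> P)"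
        proof -
          have "d + k0 + (m - 1) * d = k0 + m * d" using mk[of d] by linarith
          then show ?thesis by (simp only: o_assoc funpow_add[symmetric])
        qed
        also have "proportional_on (U i) (\<rho> ^^ k0 \<circ> (\<rho> ^^ (m * d) \<circ> P)) (\<rho> ^^ k0 \<circ> (id \<circ> P))"
          by (intro proportional_on_comp_left lin_\<rho> proportional_on_comp_right[OF \<rho>_mk[OF j(1)] j(2)])
        finally have RsR: "proportional_on (U i) (R \<circ> s \<circ> R) s"
          by (simp only: R_def s_def o_assoc funpow_add id_comp)
        obtain B where B: "basis_of B (U i)" "monomial_on B R" "monomial_on B s"
          by (rule rotation_reflection_basis[OF R(1) s(1) sub[OF i] R(2) s(2) m Rm ss RsR])
        have "monomial_on B f" if f: "f \<in> \<Gamma>" "f ` U i \<subseteq> U i" for f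
        proof -
          from f(1) consider k where "f = \<rho> ^^ k" | k where "f = \<rho> ^^ k \<circ> P"
            unfolding \<Gamma>_def by blast
          then show ?thesis
          proof cases
            case 1
            then obtain q where "\<rho> ^^ k = R ^^ q" using rot f(2) by blast
            then show ?thesis using 1 monomial_on_funpow[OF R(1) B(2)] by simp
          next
            case (2 k)
            \<comment> \<open>This represents \<open>k - k0\<close>, so that
              \<open>\<rho>^l s\<close> equals \<open>\<rho>^k P\<close> up to the scalar of
              \<open>\<rho>^(m * k0)\<close>.\<close>
            define l where "l = k + (m - 1) * k0"
            have "proportional_on (U i) (\<rho> ^^ k \<circ> (\<rho> ^^ (m * k0) \<circ> P)) (\<rho> ^^ k \<circ> (id \<circ> P))"
              by (intro proportional_on_comp_left lin_\<rho> proportional_on_comp_right[OF \<rho>_mk[OF j(1)] j(2)])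
            moreover have "\<rho> ^^ k \<circ> (\<rho> ^^ (m * k0) \<circ> P) = \<rho> ^^ l \<circ> s"
            proof -
              have "k + m * k0 = l + k0" using mk[of k0] unfolding l_def by linarith
              then show ?thesis by (simp only: s_def o_assoc funpow_add[symmetric])
            qed
            ultimately have ls: "proportional_on (U i) f (\<rho> ^^ l \<circ> s)"
              unfolding 2 using proportional_on_sym by (metis id_comp)
            have ls_im: "(\<rho> ^^ l \<circ> s) ` U i \<subseteq> U i"
              by (rule proportional_on_image[OF proportional_on_sym[OF ls] sub[OF i] f(2)])
            have "proportional_on (U i) (\<rho> ^^ l \<circ> (s \<circ> s)) (\<rho> ^^ l \<circ> id)"
              by (intro proportional_on_comp_left lin_\<rho> ss)
            then have "proportional_on (U i) (\<rho> ^^ l) ((\<rho> ^^ l \<circ> s) \<circ> s)"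
              unfolding comp_id o_assoc by (rule proportional_on_sym)
            then have "(\<rho> ^^ l) ` U i \<subseteq> U i"
              by (rule proportional_on_image[OF _ sub[OF i]]) (use ls_im s(2) in auto)
            then obtain q where "\<rho> ^^ l = R ^^ q" using rot by blast
            then have "monomial_on B (\<rho> ^^ l \<circ> s)"
              using monomial_on_comp[OF lin_\<rho> _ B(3), of l] monomial_on_funpow[OF R(1) B(2), of q] by simp
            then show ?thesis
              by (rule monomial_on_proportional[OF _ ls basis_of_subset[OF B(1)]])
          qed
        qed
        then show ?thesis using B(1) by blast
      next
        case False
        obtain c where c: "c \<noteq> 0" "\<And>v. v \<in> U i \<Longrightarrow> (R ^^ m) v = c *s v"
          using Rm by (auto simp: proportional_on_def)
        obtain B where B: "basis_of B (U i)" "\<And>b. b \<in> B \<Longrightarrow> \<exists>z. z \<noteq> 0 \<and> R b = z *s b"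
          using eigenbasis[OF R(1) sub[OF i] R(2) m c] by blast
        have "monomial_on B f" if f: "f \<in> \<Gamma>" "f ` U i \<subseteq> U i" for f
        proof -
          have "f \<noteq> \<rho> ^^ k \<circ> P" for k using False f(2) by blast
          then obtain k where "f = \<rho> ^^ k" using f(1) unfolding \<Gamma>_def by blast
          moreover from this obtain q where "\<rho> ^^ k = R ^^ q" using rot f(2) by blast
          ultimately show ?thesis
            using monomial_on_funpow[OF R(1) monomial_on_eigenvectors[of B R, OF B(2)], of q] by simp
        qed
        then show ?thesis using B(1) by blast
      qed
    qed
  qed auto
  \<comment> \<open>The second element is \<open>T \<circ> P \<circ> P\<close>, a nonzero multiple
    of \<open>T\<close> on each summand; this is how \<open>T\<close> itself is recovered.\<close>
  have "\<rho> ^^ 0 \<circ> P \<in> \<Gamma>" "\<rho> ^^ 1 \<circ> P \<in> \<Gamma>" unfolding \<Gamma>_def by blast+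
  then have "monomial_on B P" "monomial_on B (\<rho> \<circ> P)" using B(3) by (simp_all add: comp_def)
  moreover have "monomial_on B T"
    unfolding monomial_on_def
  proof
    fix b assume b: "b \<in> B"
    then obtain i where i: "i \<in> I" "b \<in> U i" using B(2) by blast
    obtain c where c: "c \<noteq> 0" "P (P b) = c *s b"
      using PP[OF i(1)] i(2) by (auto simp: proportional_on_def)
    obtain b' d where b': "b' \<in> B" "d \<noteq> 0" "T (P (P b)) = d *s b'"
      using \<open>monomial_on B (\<rho> \<circ> P)\<close> b by (auto simp: monomial_on_def \<rho>_def)
    have "T b = (inverse c * d) *s b'"
      using c b' lin_scale[OF lin(2), of c b] by (metis scale_scale scale_one left_inverse)
    then show "\<exists>b'\<in>B. \<exists>c. c \<noteq> 0 \<and> T b = c *s b'"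
      using b'(1,2) c(1) by (intro bexI[of _ b'] exI[of _ "inverse c * d"]) auto
  qed
  ultimately show ?thesis using that B by blast
qed

end

section \<open>Calculus of tensors as bilinear forms\<close>

definition bilin ::
  "('k::field \<Rightarrow> 'a::ab_group_add \<Rightarrow> 'a) \<Rightarrow> ('k \<Rightarrow> 'b::ab_group_add \<Rightarrow> 'b) \<Rightarrow>
   ('k \<Rightarrow> 'c::ab_group_add \<Rightarrow> 'c) \<Rightarrow> ('a \<Rightarrow> 'b \<Rightarrow> 'c) \<Rightarrow> bool"
  where "bilin sA sB sC \<beta> \<longleftrightarrow> vector_space sA \<and> vector_space sB \<and> vector_space sC \<and>
    (\<forall>b. Vector_Spaces.linear sA sC (\<lambda>a. \<beta> a b)) \<and> (\<forall>a. Vector_Spaces.linear sB sC (\<beta> a))"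

lemma bilinI:
  assumes "vector_space sA" "vector_space sB" "vector_space sC"
    and "\<And>a a' b. \<beta> (a + a') b = \<beta> a b + \<beta> a' b" "\<And>c a b. \<beta> (sA c a) b = sC c (\<beta> a b)"
    and "\<And>a b b'. \<beta> a (b + b') = \<beta> a b + \<beta> a b'" "\<And>c a b. \<beta> a (sB c b) = sC c (\<beta> a b)"
  shows "bilin sA sB sC \<beta>"
  using assms by (simp add: bilin_def Vector_Spaces.linear_iff)

lemma linear_add': "Vector_Spaces.linear s1 s2 f \<Longrightarrow> f (x + y) = f x + f y"
  and linear_scale': "Vector_Spaces.linear s1 s2 f \<Longrightarrow> f (s1 c x) = s2 c (f x)"
  and linear_vs1: "Vector_Spaces.linear s1 s2 f \<Longrightarrow> vector_space s1"
  and linear_vs2: "Vector_Spaces.linear s1 s2 f \<Longrightarrow> vector_space s2"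
  by (simp_all add: Vector_Spaces.linear_iff)

lemma linear_zero': "Vector_Spaces.linear s1 s2 f \<Longrightarrow> f 0 = 0"
  by (metis add_cancel_left_left linear_add')

lemma linear_sum': "Vector_Spaces.linear s1 s2 f \<Longrightarrow> f (\<Sum>i\<in>A. g i) = (\<Sum>i\<in>A. f (g i))"
  by (induction A rule: infinite_finite_induct) (auto simp: linear_zero' linear_add')

lemma tensor_eval:
  "Vector_Spaces.linear sA (*) f \<Longrightarrow> Vector_Spaces.linear sB (*) g \<Longrightarrow> tensor sA sB a b f g = f a * g b"
  by (simp add: tensor_def)

lemma tensor_add_left: "tensor sA sB (a + a') b = tensor sA sB a b + tensor sA sB a' b"
  and tensor_add_right: "tensor sA sB a (b + b') = tensor sA sB a b + tensor sA sB a b'"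
  and tensor_scale_left: "tensor sA sB (sA c a) b = tensor_scale c (tensor sA sB a b)"
  and tensor_scale_right: "tensor sA sB a (sB c b) = tensor_scale c (tensor sA sB a b)"
  by (auto simp: tensor_def tensor_scale_def fun_eq_iff algebra_simps linear_add' linear_scale')

lemma
  fixes sA :: "'k::field \<Rightarrow> 'a::ab_group_add \<Rightarrow> 'a" and sB :: "'k \<Rightarrow> 'b::ab_group_add \<Rightarrow> 'b"
  shows tensor_in_space: "tensor sA sB a b \<in> tensor_space sA sB"
    and tensor_space_add: "t \<in> tensor_space sA sB \<Longrightarrow> t' \<in> tensor_space sA sB \<Longrightarrow> t + t' \<in> tensor_space sA sB"
proof -
  interpret T: vector_space "tensor_scale :: 'k \<Rightarrow> ('k, 'a, 'b) tensor \<Rightarrow> _"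
    by (rule vector_space_tensor_scale)
  show "tensor sA sB a b \<in> tensor_space sA sB"
    by (auto simp: tensor_space_def intro: T.span_base)
  show "t \<in> tensor_space sA sB \<Longrightarrow> t' \<in> tensor_space sA sB \<Longrightarrow> t + t' \<in> tensor_space sA sB"
    by (auto simp: tensor_space_def intro: T.span_add)
qed

lemma tensor_space_sum_list:
  fixes sA :: "'k::field \<Rightarrow> 'a::ab_group_add \<Rightarrow> 'a" and sB :: "'k \<Rightarrow> 'b::ab_group_add \<Rightarrow> 'b"
  assumes "t \<in> tensor_space sA sB"
  obtains xs where "t = (\<Sum>(a, b)\<leftarrow>xs. tensor sA sB a b)"
proof -
  interpret T: vector_space "tensor_scale :: 'k \<Rightarrow> ('k, 'a, 'b) tensor \<Rightarrow> _"
    by (rule vector_space_tensor_scale)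
  have "\<exists>xs. t = (\<Sum>(a, b)\<leftarrow>xs. tensor sA sB a b)"
    using assms unfolding tensor_space_def
  proof (induction rule: T.span_induct_alt)
    case base
    show ?case by (rule exI[of _ "[]"]) simp
  next
    case (step c x y)
    then obtain a b xs where "x = tensor sA sB a b" "y = (\<Sum>(a, b)\<leftarrow>xs. tensor sA sB a b)" by blast
    then show ?case
      by (intro exI[of _ "(sA c a, b) # xs"]) (simp add: tensor_scale_left)
  qed
  then show ?thesis using that by blast
qed

lemma lift_sum_list:
  assumes "bilin sA sB sC \<beta>"
  shows "tensor_lift sA sB \<beta> (\<Sum>(a, b)\<leftarrow>xs. tensor sA sB a b) = (\<Sum>(a, b)\<leftarrow>xs. \<beta> a b)"
  by (rule tensor_lift_sum_list) (use assms in \<open>auto simp: bilin_def\<close>)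

lemma lift_tensor:
  assumes "bilin sA sB sC \<beta>"
  shows "tensor_lift sA sB \<beta> (tensor sA sB a b) = \<beta> a b"
  using lift_sum_list[OF assms, of "[(a, b)]"] by simp

lemma lift_add:
  assumes "bilin sA sB sC \<beta>" "t \<in> tensor_space sA sB" "t' \<in> tensor_space sA sB"
  shows "tensor_lift sA sB \<beta> (t + t') = tensor_lift sA sB \<beta> t + tensor_lift sA sB \<beta> t'"
proof -
  obtain xs ys where xs: "t = (\<Sum>(a, b)\<leftarrow>xs. tensor sA sB a b)"
    and ys: "t' = (\<Sum>(a, b)\<leftarrow>ys. tensor sA sB a b)"
    using assms(2,3) by (meson tensor_space_sum_list)
  have "t + t' = (\<Sum>(a, b)\<leftarrow>xs @ ys. tensor sA sB a b)" by (simp add: xs ys)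
  then show ?thesis
    using lift_sum_list[OF assms(1), of "xs @ ys"] lift_sum_list[OF assms(1), of xs]
      lift_sum_list[OF assms(1), of ys] by (simp add: xs ys)
qed

lemma linear_sum_list:
  assumes "Vector_Spaces.linear s1 s2 f"
  shows "f (\<Sum>(a, b)\<leftarrow>xs. \<beta> a b) = (\<Sum>(a, b)\<leftarrow>xs. f (\<beta> a b))"
  by (induction xs) (auto simp: linear_zero'[OF assms] linear_add'[OF assms])

lemma lift_scale:
  assumes "bilin sA sB sC \<beta>" "t \<in> tensor_space sA sB"
  shows "tensor_lift sA sB \<beta> (tensor_scale c t) = sC c (tensor_lift sA sB \<beta> t)"
proof -
  interpret C: vector_space sC using assms by (simp add: bilin_def)
  obtain xs where xs: "t = (\<Sum>(a, b)\<leftarrow>xs. tensor sA sB a b)"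
    using tensor_space_sum_list[OF assms(2)] .
  have lin: "Vector_Spaces.linear tensor_scale tensor_scale (tensor_scale c)"
    by (simp add: Vector_Spaces.linear_iff vector_space_tensor_scale)
      (auto simp: tensor_scale_def fun_eq_iff algebra_simps)
  have ts: "tensor_scale c t = (\<Sum>(a, b)\<leftarrow>map (\<lambda>(a, b). (sA c a, b)) xs. tensor sA sB a b)"
    unfolding xs linear_sum_list[OF lin] by (induction xs) (auto simp: tensor_scale_left)
  have "(\<Sum>(a, b)\<leftarrow>map (\<lambda>(a, b). (sA c a, b)) xs. \<beta> a b) = sC c (\<Sum>(a, b)\<leftarrow>xs. \<beta> a b)"
    using assms(1)
    by (induction xs) (auto simp: bilin_def Vector_Spaces.linear_iff C.scale_right_distrib)
  then show ?thesis
    unfolding ts lift_sum_list[OF assms(1)] by (simp add: xs lift_sum_list[OF assms(1)])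
qed

lemma linear_lift_comp:
  assumes "bilin sA sB sC \<beta>" "Vector_Spaces.linear sV tensor_scale F" "\<And>v. F v \<in> tensor_space sA sB"
  shows "Vector_Spaces.linear sV sC (\<lambda>v. tensor_lift sA sB \<beta> (F v))"
  using assms
  by (simp add: Vector_Spaces.linear_iff bilin_def[of _ _ sC] lift_add[OF assms(1)] lift_scale[OF assms(1)])

lemma linear_apply_lift:
  assumes "bilin sA sB sC \<beta>" "Vector_Spaces.linear sC sD h" "t \<in> tensor_space sA sB"
  shows "h (tensor_lift sA sB \<beta> t) = tensor_lift sA sB (\<lambda>a b. h (\<beta> a b)) t"
proof -
  obtain xs where xs: "t = (\<Sum>(a, b)\<leftarrow>xs. tensor sA sB a b)"
    using tensor_space_sum_list[OF assms(3)] .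
  have b: "bilin sA sB sD (\<lambda>a b. h (\<beta> a b))"
    using assms(1,2) by (simp add: bilin_def Vector_Spaces.linear_iff)
  show ?thesis
    unfolding xs lift_sum_list[OF assms(1)] lift_sum_list[OF b] by (rule linear_sum_list[OF assms(2)])
qed

text \<open>Nested Sweedler expressions use a \<open>\<beta>\<close> that depends on an outer tensor
  leg; this gives linearity in that leg, hence bilinearity of the outer map.\<close>

lemma linear_lift_param:
  assumes \<beta>: "\<And>p. bilin sA sB sC (\<beta> p)" and lin: "\<And>a b. Vector_Spaces.linear sP sC (\<lambda>p. \<beta> p a b)"
    and t: "t \<in> tensor_space sA sB"
  shows "Vector_Spaces.linear sP sC (\<lambda>p. tensor_lift sA sB (\<beta> p) t)"
proof -
  obtain xs where xs: "t = (\<Sum>(a, b)\<leftarrow>xs. tensor sA sB a b)"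
    using tensor_space_sum_list[OF t] .
  interpret C: vector_space sC using \<beta> by (simp add: bilin_def)
  have vs: "vector_space sP" using lin linear_vs1 by blast
  have 1: "(\<Sum>(a, b)\<leftarrow>xs. \<beta> (p + q) a b) = (\<Sum>(a, b)\<leftarrow>xs. \<beta> p a b) + (\<Sum>(a, b)\<leftarrow>xs. \<beta> q a b)" for p q
    by (induction xs) (auto simp: linear_add'[OF lin])
  have 2: "(\<Sum>(a, b)\<leftarrow>xs. \<beta> (sP c p) a b) = sC c (\<Sum>(a, b)\<leftarrow>xs. \<beta> p a b)" for c p
    by (induction xs) (auto simp: linear_scale'[OF lin] C.scale_right_distrib)
  show ?thesis
    unfolding xs lift_sum_list[OF \<beta>] Vector_Spaces.linear_iff
    using 1 2 vs C.vector_space_axioms by blast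
qed

text \<open>Tensors are functions of two functionals, so evaluation and contraction of the two legs
  coincide. This links the encoding to Sweedler notation.\<close>

lemma tensor_space_eval:
  assumes "vector_space sA" "vector_space sB" "t \<in> tensor_space sA sB"
    and f: "Vector_Spaces.linear sA (*) f" and g: "Vector_Spaces.linear sB (*) g"
  shows "t f g = tensor_lift sA sB (\<lambda>a b. f a * g b) t"
proof -
  obtain xs where xs: "t = (\<Sum>(a, b)\<leftarrow>xs. tensor sA sB a b)"
    using tensor_space_sum_list[OF assms(3)] .
  have "bilin sA sB (*) (\<lambda>a b. f a * g b)"
    by (intro bilinI assms linear_vs2[OF f])
      (simp_all add: linear_add'[OF f] linear_add'[OF g] linear_scale'[OF f] linear_scale'[OF g] algebra_simps)
  note L = lift_sum_list[OF this]
  show ?thesis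
    unfolding xs L by (simp add: sum_list_fun2 tensor_eval[OF f g])
qed

lemma vector_space_mult: "vector_space ((*) :: 'k::field \<Rightarrow> 'k \<Rightarrow> 'k)"
  by unfold_locales (auto simp: algebra_simps)

lemma linear_eval: "Vector_Spaces.linear tensor_scale (*) (\<lambda>t. t f g)"
  by (simp add: Vector_Spaces.linear_iff vector_space_tensor_scale vector_space_mult tensor_scale_def)

context vector_space
begin

lemma functional_separates:
  assumes "v \<noteq> 0"
  obtains f where "Vector_Spaces.linear scale (*) f" "f v = 1"
proof -
  have ind: "independent {v}" using assms by simp
  define B where "B = extend_basis {v}"
  have B: "independent B" "span B = UNIV" "v \<in> B"
    using independent_extend_basis[OF ind] span_extend_basis[OF ind] extend_basis_superset[OF ind]
    by (auto simp: B_def)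
  have "Vector_Spaces.linear scale (*) (\<lambda>x. representation B x v)"
    by (rule linear_representation) (use B in auto)
  moreover have "representation B v v = 1"
    using representation_basis[OF B(1,3)] by simp
  ultimately show ?thesis using that by blast
qed

lemma functional_eqI:
  assumes "\<And>f. Vector_Spaces.linear scale (*) f \<Longrightarrow> f x = f y"
  shows "x = y"
proof (rule ccontr)
  assume "x \<noteq> y"
  then obtain f where f: "Vector_Spaces.linear scale (*) f" "f (x - y) = 1"
    using functional_separates[of "x - y"] by auto
  have "f x = f (x - y) + f y" by (simp add: linear_add'[OF f(1), symmetric])
  then show False using assms[OF f(1)] f(2) by simp
qed

end

text \<open>Contraction of the second leg with \<open>g\<close> turns an equality of pure tensors
  into one of vectors.\<close>

lemma tensor_eq_left:
  assumes "vector_space sA" "vector_space sB" and eq: "tensor sA sB a b = tensor sA sB a' b'"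
    and g: "Vector_Spaces.linear sB (*) g"
  shows "sA (g b) a = sA (g b') a'"
proof -
  interpret A: vector_space sA by fact
  show ?thesis
  proof (rule A.functional_eqI)
    fix f assume f: "Vector_Spaces.linear sA (*) f"
    from eq have "tensor sA sB a b f g = tensor sA sB a' b' f g" by simp
    then show "f (sA (g b) a) = f (sA (g b') a')"
      by (simp add: tensor_eval[OF f g] linear_scale'[OF f] mult.commute)
  qed
qed

lemma tensor_eq_right:
  assumes vs: "vector_space sA" "vector_space sB" and eq: "tensor sA sB a b = tensor sA sB a b'" and "a \<noteq> 0"
  shows "b = b'"
proof -
  interpret A: vector_space sA by fact
  interpret B: vector_space sB by fact
  obtain f where f: "Vector_Spaces.linear sA (*) f" "f a = 1"
    using A.functional_separates[OF \<open>a \<noteq> 0\<close>] .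
  show ?thesis
  proof (rule B.functional_eqI)
    fix g assume g: "Vector_Spaces.linear sB (*) g"
    from eq have "tensor sA sB a b f g = tensor sA sB a b' f g" by simp
    then show "g b = g b'" by (simp add: tensor_eval[OF f(1) g] f(2))
  qed
qed

lemma tensor_zero_left: "tensor sA sB 0 b = 0" and tensor_zero_right: "tensor sA sB a 0 = 0"
proof -
  have "tensor sA sB (0 + 0) b = tensor sA sB 0 b + tensor sA sB 0 b"
    "tensor sA sB a (0 + 0) = tensor sA sB a 0 + tensor sA sB a 0"
    by (rule tensor_add_left tensor_add_right)+
  then show "tensor sA sB 0 b = 0" "tensor sA sB a 0 = 0" by simp_all
qed

lemma sum_list_two:
  fixes F :: "'a \<Rightarrow> 'b \<Rightarrow> 'c::comm_monoid_add"
  shows "(\<Sum>(a, b)\<leftarrow>[(a1, b1), (a2, b2)]. F a b) = F a1 b1 + F a2 b2"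
  by simp

text \<open>By its default value, \<open>tensor\<close> is 0 at pairs that are not both linear, so
  elements of the tensor space agree there automatically.\<close>

lemma tensor_space_eqI:
  assumes "t \<in> tensor_space sA sB" "t' \<in> tensor_space sA sB"
    and "\<And>f g. Vector_Spaces.linear sA (*) f \<Longrightarrow> Vector_Spaces.linear sB (*) g \<Longrightarrow> t f g = t' f g"
  shows "t = t'"
proof (intro ext)
  fix f g
  have "t f g = 0" if t: "t \<in> tensor_space sA sB"
      and fg: "\<not> (Vector_Spaces.linear sA (*) f \<and> Vector_Spaces.linear sB (*) g)" for t
  proof -
    obtain xs where xs: "t = (\<Sum>(a, b)\<leftarrow>xs. tensor sA sB a b)"
      using tensor_space_sum_list[OF t] .
    have "tensor sA sB a b f g = 0" for a b using fg by (auto simp: tensor_def)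
    then show ?thesis
      unfolding xs sum_list_fun2 by (induction xs) auto
  qed
  then show "t f g = t' f g" using assms by metis
qed

section \<open>Yetter-Drinfeld modules\<close>

context hopf_algebra
begin

text \<open>The product of the dual algebra: for linear arguments, applying the tensor
  \<open>comult h\<close> to them is exactly \<open>\<phi>(h1) \<psi>(h2)\<close>.\<close>

definition convolution :: "('h \<Rightarrow> 'k) \<Rightarrow> ('h \<Rightarrow> 'k) \<Rightarrow> 'h \<Rightarrow> 'k"
  where "convolution \<phi> \<psi> h = comult h \<phi> \<psi>"

abbreviation functional :: "('h \<Rightarrow> 'k) \<Rightarrow> bool"
  where "functional \<phi> \<equiv> Vector_Spaces.linear scale (*) \<phi>"

lemma convolution_linear: "functional \<phi> \<Longrightarrow> functional \<psi> \<Longrightarrow> functional (convolution \<phi> \<psi>)"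
  using comult_linear
  by (simp add: Vector_Spaces.linear_iff convolution_def[abs_def] vector_space_mult tensor_scale_def)

end

context yd_module
begin

text \<open>A comodule is a module over the dual algebra, \<open>\<phi>\<close> acting by
  \<open>\<phi>(v_(-1)) v_(0)\<close>. Idempotents and relations in the dual algebra thereby become
  projections and relations between operators on \<open>V\<close>.\<close>

definition coaction_op :: "('h \<Rightarrow> 'k) \<Rightarrow> 'v \<Rightarrow> 'v"
  where "coaction_op \<phi> v = tensor_lift scale scaleV (\<lambda>h u. scaleV (\<phi> h) u) (coact v)"

lemma bilin_coaction_op: "functional \<phi> \<Longrightarrow> bilin scale scaleV scaleV (\<lambda>h u. scaleV (\<phi> h) u)"
  by (intro bilinI vector_space_axioms V.vector_space_axioms)
    (simp_all add: linear_add' linear_scale' V.scale_left_distrib V.scale_right_distrib mult.commute)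

lemma coaction_op_linear: "functional \<phi> \<Longrightarrow> Vector_Spaces.linear scaleV scaleV (coaction_op \<phi>)"
  unfolding coaction_op_def[abs_def]
  by (rule linear_lift_comp[OF bilin_coaction_op coact_linear coact_in_tensor_space])

lemma functional_coaction_op:
  assumes \<phi>: "functional \<phi>" and f: "Vector_Spaces.linear scaleV (*) f"
  shows "f (coaction_op \<phi> v) = coact v \<phi> f"
  unfolding coaction_op_def linear_apply_lift[OF bilin_coaction_op[OF \<phi>] f coact_in_tensor_space]
    tensor_space_eval[OF vector_space_axioms V.vector_space_axioms coact_in_tensor_space \<phi> f]
  by (simp add: linear_scale'[OF f])

lemma coaction_op_counit: "coaction_op counit v = v"
  by (simp add: coaction_op_def coact_counit)

text \<open>Coassociativity, tested against \<open>\<phi>\<close>, \<open>\<psi>\<close> and a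
  functional on \<open>V\<close>. A left comodule gives a right module over the dual algebra, hence
  the operator of \<open>\<phi>\<close> is applied first.\<close>

lemma coaction_op_convolution:
  assumes \<phi>: "functional \<phi>" and \<psi>: "functional \<psi>"
  shows "coaction_op \<psi> (coaction_op \<phi> v) = coaction_op (convolution \<phi> \<psi>) v"
proof (rule V.functional_eqI)
  fix f assume f: "Vector_Spaces.linear scaleV (*) f"
  \<comment> \<open>\<open>F\<close> evaluates the inner tensor of a nested one, so that a threefold
    tensor is tested by evaluating it at \<open>\<phi>\<close> and \<open>F\<close>.\<close>
  define F where "F = (\<lambda>t :: ('k, 'h, 'v) tensor. t \<psi> f)"
  have F: "Vector_Spaces.linear tensor_scale (*) F"
    unfolding F_def by (rule linear_eval)
  note vs = vector_space_axioms V.vector_space_axioms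
  note ev = linear_eval[of \<phi> F]
  have b1: "bilin scale scaleV tensor_scale (\<lambda>p u. tensor scale tensor_scale p (coact u))"
    by (intro bilinI vs vector_space_tensor_scale)
      (simp_all add: tensor_add_left tensor_add_right tensor_scale_left tensor_scale_right
        linear_add'[OF coact_linear] linear_scale'[OF coact_linear])
  have b2: "bilin scale scale tensor_scale (\<lambda>a b. tensor scale tensor_scale a (tensor scale scaleV b u))" for u
    by (intro bilinI vs vector_space_tensor_scale)
      (simp_all add: tensor_add_left tensor_add_right tensor_scale_left tensor_scale_right)
  have b3: "bilin scale scaleV tensor_scale (\<lambda>p u. tensor_lift scale scale
           (\<lambda>a b. tensor scale tensor_scale a (tensor scale scaleV b u)) (comult p))"
    unfolding bilin_def
  proof (intro conjI allI vs vector_space_tensor_scale)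
    fix u show "Vector_Spaces.linear scale tensor_scale (\<lambda>p. tensor_lift scale scale
           (\<lambda>a b. tensor scale tensor_scale a (tensor scale scaleV b u)) (comult p))"
      by (rule linear_lift_comp[OF b2 comult_linear comult_in_tensor_space])
  next
    fix p show "Vector_Spaces.linear scaleV tensor_scale (\<lambda>u. tensor_lift scale scale
           (\<lambda>a b. tensor scale tensor_scale a (tensor scale scaleV b u)) (comult p))"
      by (rule linear_lift_param[OF b2 _ comult_in_tensor_space])
        (simp add: Vector_Spaces.linear_iff V.vector_space_axioms vector_space_tensor_scale
          tensor_add_right tensor_scale_right)
  qed
  have "f (coaction_op (convolution \<phi> \<psi>) v) =
      tensor_lift scale scaleV (\<lambda>p u. convolution \<phi> \<psi> p * f u) (coact v)"
    unfolding functional_coaction_op[OF convolution_linear[OF \<phi> \<psi>] f]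
    by (rule tensor_space_eval[OF vs coact_in_tensor_space convolution_linear[OF \<phi> \<psi>] f])
  also have "(\<lambda>p u. convolution \<phi> \<psi> p * f u) = (\<lambda>p u. (tensor_lift scale scale
           (\<lambda>a b. tensor scale tensor_scale a (tensor scale scaleV b u)) (comult p)) \<phi> F)"
  proof (intro ext)
    fix p u
    have "(tensor_lift scale scale (\<lambda>a b. tensor scale tensor_scale a (tensor scale scaleV b u)) (comult p)) \<phi> F
        = tensor_lift scale scale (\<lambda>a b. tensor scale tensor_scale a (tensor scale scaleV b u) \<phi> F) (comult p)"
      by (rule linear_apply_lift[OF b2 ev comult_in_tensor_space])
    also have "\<dots> = tensor_lift scale scale (\<lambda>a b. f u * (\<phi> a * \<psi> b)) (comult p)"
      unfolding tensor_eval[OF \<phi> F] unfolding F_def tensor_eval[OF \<psi> f] by (simp only: ac_simps)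
    also have "\<dots> = f u * tensor_lift scale scale (\<lambda>a b. \<phi> a * \<psi> b) (comult p)"
    proof (rule linear_apply_lift[symmetric, where sC = "(*)" and sD = "(*)"])
      show "bilin scale scale (*) (\<lambda>a b. \<phi> a * \<psi> b)"
        by (intro bilinI vs vector_space_mult)
          (simp_all add: linear_add'[OF \<phi>] linear_add'[OF \<psi>] linear_scale'[OF \<phi>] linear_scale'[OF \<psi>] algebra_simps)
      show "Vector_Spaces.linear (*) (*) ((*) (f u))"
        by (simp add: Vector_Spaces.linear_iff vector_space_mult algebra_simps)
    qed (rule comult_in_tensor_space)
    also have "\<dots> = convolution \<phi> \<psi> p * f u"
      unfolding convolution_def tensor_space_eval[OF vs(1) vs(1) comult_in_tensor_space \<phi> \<psi>]
      by (rule mult.commute)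
    finally show "convolution \<phi> \<psi> p * f u = (tensor_lift scale scale
           (\<lambda>a b. tensor scale tensor_scale a (tensor scale scaleV b u)) (comult p)) \<phi> F" ..
  qed
  also have "tensor_lift scale scaleV (\<lambda>p u. (tensor_lift scale scale
           (\<lambda>a b. tensor scale tensor_scale a (tensor scale scaleV b u)) (comult p)) \<phi> F) (coact v) =
      (tensor_lift scale scaleV (\<lambda>p u. tensor_lift scale scale
           (\<lambda>a b. tensor scale tensor_scale a (tensor scale scaleV b u)) (comult p)) (coact v)) \<phi> F"
    by (rule linear_apply_lift[OF b3 ev coact_in_tensor_space, symmetric])
  also have "\<dots> = (tensor_lift scale scaleV (\<lambda>p u. tensor scale tensor_scale p (coact u)) (coact v)) \<phi> F"
    by (simp only: coact_coassoc)
  also have "\<dots> = tensor_lift scale scaleV (\<lambda>p u. tensor scale tensor_scale p (coact u) \<phi> F) (coact v)"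
    by (rule linear_apply_lift[OF b1 ev coact_in_tensor_space])
  also have "(\<lambda>p u. tensor scale tensor_scale p (coact u) \<phi> F) =
      (\<lambda>p u. f (coaction_op \<psi> (scaleV (\<phi> p) u)))"
    unfolding tensor_eval[OF \<phi> F]
    by (simp add: fun_eq_iff F_def functional_coaction_op[OF \<psi> f, symmetric]
        linear_scale'[OF coaction_op_linear[OF \<psi>]] linear_scale'[OF f])
  also have "tensor_lift scale scaleV (\<lambda>p u. f (coaction_op \<psi> (scaleV (\<phi> p) u))) (coact v) =
      f (coaction_op \<psi> (coaction_op \<phi> v))"
    unfolding coaction_op_def[of \<phi>]
    using linear_apply_lift[OF bilin_coaction_op[OF \<phi>]
        Vector_Spaces.linear_compose[OF coaction_op_linear[OF \<psi>] f] coact_in_tensor_space]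
    by simp
  finally show "f (coaction_op \<psi> (coaction_op \<phi> v)) = f (coaction_op (convolution \<phi> \<psi>) v)" ..
qed

end

section \<open>The structure of the Suzuki algebras\<close>

context hopf_algebra
begin

lemma free_eval_superset:
  assumes "finite S" "Poly_Mapping.keys p \<subseteq> S"
  shows "free_eval scale X p =
    (\<Sum>u\<in>S. scale (Poly_Mapping.lookup p u) (prod_list (map X (letters u))))"
  unfolding free_eval_def
  by (rule sum.mono_neutral_left) (use assms in \<open>auto simp: in_keys_iff\<close>)

lemma free_eval_add: "free_eval scale X (p + q) = free_eval scale X p + free_eval scale X q"
proof -
  let ?S = "Poly_Mapping.keys p \<union> Poly_Mapping.keys q"
  have "Poly_Mapping.keys (p + q) \<subseteq> ?S" by (rule keys_add)
  then show ?thesis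
    using free_eval_superset[of ?S p] free_eval_superset[of ?S q] free_eval_superset[of ?S "p + q"]
    by (simp add: lookup_add scale_left_distrib sum.distrib)
qed

lemma free_eval_zero [simp]: "free_eval scale X 0 = 0"
  by (simp add: free_eval_def)

lemma free_eval_sum: "free_eval scale X (\<Sum>i\<in>I. p i) = (\<Sum>i\<in>I. free_eval scale X (p i))"
  by (induction I rule: infinite_finite_induct) (auto simp: free_eval_add)

lemma free_eval_diff: "free_eval scale X (p - q) = free_eval scale X p - free_eval scale X q"
  by (metis add_diff_cancel diff_add_cancel free_eval_add)

lemma free_eval_single:
  "free_eval scale X (Poly_Mapping.single u c) = scale c (prod_list (map X (letters u)))"
  by (cases "c = 0") (auto simp: free_eval_def)

lemma poly_mapping_sum_single:
  "p = (\<Sum>u\<in>Poly_Mapping.keys p. Poly_Mapping.single u (Poly_Mapping.lookup p u))"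
  by (rule poly_mapping_eqI) (auto simp: lookup_sum lookup_single when_def in_keys_iff)

lemma free_eval_mult: "free_eval scale X (p * q) = free_eval scale X p * free_eval scale X q"
proof -
  have single: "free_eval scale X (Poly_Mapping.single u c * Poly_Mapping.single v d) =
      free_eval scale X (Poly_Mapping.single u c) * free_eval scale X (Poly_Mapping.single v d)" for u v c d
    by (simp add: mult_single free_eval_single plus_word_def scale_mult_left[symmetric]
        scale_mult_right[symmetric] mult.commute)
  let ?s = "\<lambda>p u. Poly_Mapping.single u (Poly_Mapping.lookup p u)"
  have "free_eval scale X (p * q) =
      free_eval scale X ((\<Sum>u\<in>Poly_Mapping.keys p. ?s p u) * (\<Sum>v\<in>Poly_Mapping.keys q. ?s q v))"
    by (simp only: poly_mapping_sum_single[symmetric])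
  also have "\<dots> = (\<Sum>u\<in>Poly_Mapping.keys p. \<Sum>v\<in>Poly_Mapping.keys q. free_eval scale X (?s p u * ?s q v))"
    by (simp only: sum_product free_eval_sum)
  also have "\<dots> = (\<Sum>u\<in>Poly_Mapping.keys p. free_eval scale X (?s p u)) *
      (\<Sum>v\<in>Poly_Mapping.keys q. free_eval scale X (?s q v))"
    by (simp only: single sum_product)
  also have "\<dots> = free_eval scale X p * free_eval scale X q"
    by (simp only: free_eval_sum[symmetric] poly_mapping_sum_single[symmetric])
  finally show ?thesis .
qed

lemma free_eval_one [simp]: "free_eval scale X 1 = 1"
  using free_eval_single[of X 0 1] unfolding single_one by (simp add: zero_word_def)

lemma free_eval_power: "free_eval scale X (p ^ k) = free_eval scale X p ^ k"
  by (induction k) (auto simp: free_eval_mult)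

lemma free_eval_gen: "free_eval scale X (free_gen g) = X g"
  by (simp add: free_gen_def free_eval_single)

lemma free_eval_const: "free_eval scale X (free_const c) = scale c 1"
  by (simp add: free_const_def free_eval_single zero_word_def)

lemma free_eval_chi:
  "free_eval scale (\<lambda>(i, j). x i j) (chi (\<lambda>i j. free_gen (i, j)) i j k) = chi x i j k"
  by (induction k arbitrary: i j) (auto simp: free_eval_mult free_eval_gen)

end

section \<open>Indices and alternating words\<close>

lemma flip_flip [simp]: "flip (flip i) = i"
  by (cases i) auto

lemma flip_neq [simp]: "flip i \<noteq> i" "i \<noteq> flip i"
  by (cases i; simp)+

lemma flip_eq_iff [simp]: "flip i = flip j \<longleftrightarrow> i = j"
  by (cases i; cases j) auto

lemma idx_neq_iff: "i \<noteq> j \<longleftrightarrow> j = flip i"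
  by (cases i; cases j) auto

lemma UNIV_idx: "UNIV = {I1, I2}"
  by (auto intro: idx.exhaust)

primrec altword :: "idx \<Rightarrow> nat \<Rightarrow> idx list" where
  "altword i 0 = []"
| "altword i (Suc m) = i # altword (flip i) m"

text \<open>The reversed word ends with \<open>i\<close> (if nonempty), so a word starting with
  \<open>flip i\<close> continues the alternation. Its first letter depends on the parity of
  \<open>m\<close>, hence the existential.\<close>

lemma rev_altword_append: "\<exists>j. rev (altword i m) @ altword (flip i) k = altword j (m + k)"
proof (induction m arbitrary: i k)
  case (Suc m)
  show ?case using Suc[of "flip i" "Suc k"] by simp
qed auto

lemma altword_add: "\<exists>j. altword i (m + k) = altword i m @ altword j k"
  by (induction m arbitrary: i) auto

definition flip_if :: "bool \<Rightarrow> idx \<Rightarrow> idx"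
  where "flip_if c i = (if c then flip i else i)"

lemma flip_if_simps [simp]: "flip_if False i = i" "flip_if True i = flip i"
  "flip_if c (flip_if c i) = i"
  by (auto simp: flip_if_def)

lemma neq_flip_if [simp]: "i \<noteq> flip_if c i \<longleftrightarrow> c" "i = flip_if c i \<longleftrightarrow> \<not> c"
  by (auto simp: flip_if_def)

section \<open>Idempotents, words and the finite group\<close>

locale suzuki = suzuki_algebra N n \<mu> lam scale comult counit antipode x
  for N n :: nat and \<mu> lam :: "'k::{alg_closed_field, field_char_0}"
    and scale :: "'k \<Rightarrow> 'h::ring_1 \<Rightarrow> 'h"
    and comult :: "'h \<Rightarrow> ('k, 'h, 'h) tensor"
    and counit :: "'h \<Rightarrow> 'k"
    and antipode :: "'h \<Rightarrow> 'h"
    and x :: "idx \<Rightarrow> idx \<Rightarrow> 'h" +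
  assumes N: "N \<ge> 1" and n: "n \<ge> 1" and \<mu>\<mu>: "\<mu> * \<mu> = 1" and lam_nz: "lam \<noteq> 0"
begin

lemma relation: "p \<in> suzuki_relations N n \<mu> lam \<Longrightarrow> free_eval scale (\<lambda>(i, j). x i j) p = 0"
  using presentation hull_subset[of "suzuki_relations N n \<mu> lam" two_sided_ideal]
  by (auto simp: presented_by_def)

lemma relations:
  shows rel_sq: "x I1 I1 ^ 2 = x I2 I2 ^ 2" "x I1 I2 ^ 2 = x I2 I1 ^ 2"
    and rel_chi: "chi x I2 I1 n = scale lam (chi x I1 I2 n)" "chi x I1 I1 n = chi x I2 I2 n"
    and rel_one: "x I1 I1 ^ (2 * N) + scale \<mu> (x I1 I2 ^ (2 * N)) = 1"
    and rel_odd: "odd (idx_val i + idx_val j + idx_val k + idx_val l) \<Longrightarrow> x i j * x k l = 0"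
proof -
  let ?x = "\<lambda>i j. free_gen (i, j)"
  note ev = free_eval_diff free_eval_add free_eval_mult free_eval_power free_eval_gen
    free_eval_const free_eval_chi
  have mem: "?x I1 I1 ^ 2 - ?x I2 I2 ^ 2 \<in> suzuki_relations N n \<mu> lam"
    "?x I1 I2 ^ 2 - ?x I2 I1 ^ 2 \<in> suzuki_relations N n \<mu> lam"
    "chi ?x I2 I1 n - free_const lam * chi ?x I1 I2 n \<in> suzuki_relations N n \<mu> lam"
    "chi ?x I1 I1 n - chi ?x I2 I2 n \<in> suzuki_relations N n \<mu> lam"
    "?x I1 I1 ^ (2 * N) + free_const \<mu> * ?x I1 I2 ^ (2 * N) - 1 \<in> suzuki_relations N n \<mu> lam"
    "odd (idx_val i + idx_val j + idx_val k + idx_val l) \<Longrightarrow> ?x i j * ?x k l \<in> suzuki_relations N n \<mu> lam"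
    unfolding suzuki_relations_def Let_def by blast+
  show "x I1 I1 ^ 2 = x I2 I2 ^ 2" using relation[OF mem(1)] by (simp add: ev)
  show "x I1 I2 ^ 2 = x I2 I1 ^ 2" using relation[OF mem(2)] by (simp add: ev)
  show "chi x I2 I1 n = scale lam (chi x I1 I2 n)"
    using relation[OF mem(3)] by (simp add: ev scale_mult_left[symmetric])
  show "chi x I1 I1 n = chi x I2 I2 n" using relation[OF mem(4)] by (simp add: ev)
  show "x I1 I1 ^ (2 * N) + scale \<mu> (x I1 I2 ^ (2 * N)) = 1"
    using relation[OF mem(5)] by (simp add: ev scale_mult_left[symmetric])
  assume "odd (idx_val i + idx_val j + idx_val k + idx_val l)"
  from relation[OF mem(6)[OF this]] show "x i j * x k l = 0" by (simp add: ev)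
qed

lemma x_mult_zero: "(i = j) \<noteq> (k = l) \<Longrightarrow> x i j * x k l = 0"
  by (rule rel_odd) (cases i; cases j; cases k; cases l; simp)

text \<open>\<open>y I1\<close> and \<open>y I2\<close> are \<open>a\<close> and \<open>b\<close> of
  the overview.\<close>

definition y :: "idx \<Rightarrow> 'h"
  where "y i = x i i + x i (flip i)"

text \<open>\<open>E False\<close> and \<open>E True\<close> are \<open>e\<close> and
  \<open>f\<close>; the relation for 1 turns \<open>1 - e\<close> into a multiple of a power of
  \<open>x I1 I2\<close>, so both are given by generators.\<close>

definition E :: "bool \<Rightarrow> 'h"
  where "E b = (if b then scale \<mu> (x I1 I2 ^ (2 * N)) else x I1 I1 ^ (2 * N))"

lemma E_sum: "E False + E True = 1"
  by (simp add: E_def rel_one)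

text \<open>Products of a diagonal and an off-diagonal generator vanish, so each idempotent kills
  the generators of the other kind; as the two sum to 1, it fixes those of its own kind.\<close>

lemma E_mult_x: "E b * x i j = (if (i \<noteq> j) = b then x i j else 0)"
  and x_mult_E: "x i j * E b = (if (i \<noteq> j) = b then x i j else 0)"
proof -
  obtain N' where N': "2 * N = Suc N'" using N by (cases N) auto
  have 0: "E b * x i j = 0 \<and> x i j * E b = 0" if "(i \<noteq> j) \<noteq> b" for b
  proof (cases b)
    case True
    then have "x I1 I2 * x i j = 0" "x i j * x I1 I2 = 0"
      using that by (auto intro!: x_mult_zero)
    then have "x I1 I2 ^ (2 * N) * x i j = 0" "x i j * x I1 I2 ^ (2 * N) = 0"
      unfolding N' by (simp add: power_Suc2 mult.assoc del: power_Suc, simp add: mult.assoc[symmetric])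
    then show ?thesis
      using True by (simp add: E_def scale_mult_left[symmetric] scale_mult_right[symmetric])
  next
    case False
    then have "x I1 I1 * x i j = 0" "x i j * x I1 I1 = 0"
      using that by (auto intro!: x_mult_zero)
    then have "x I1 I1 ^ (2 * N) * x i j = 0" "x i j * x I1 I1 ^ (2 * N) = 0"
      unfolding N' by (simp add: power_Suc2 mult.assoc del: power_Suc, simp add: mult.assoc[symmetric])
    then show ?thesis using False by (simp add: E_def)
  qed
  have "E b * x i j + E (\<not> b) * x i j = x i j" "x i j * E b + x i j * E (\<not> b) = x i j"
    using E_sum by (cases b; simp add: distrib_right[symmetric] distrib_left[symmetric] add.commute)+
  then show "E b * x i j = (if (i \<noteq> j) = b then x i j else 0)"
    and "x i j * E b = (if (i \<noteq> j) = b then x i j else 0)"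
    using 0[of b] 0[of "\<not> b"] by auto
qed

lemma E_mult_y: "E b * y i = x i (flip_if b i)"
  by (cases b) (auto simp: y_def distrib_left E_mult_x)

lemma y_mult_E: "y i * E b = x i (flip_if b i)"
  by (cases b) (auto simp: y_def distrib_right x_mult_E)

lemma x_eq: "x i j = E (i \<noteq> j) * y i"
  by (cases "i = j") (auto simp: E_mult_y idx_neq_iff)

lemma E_E: "E b * E c = (if b = c then E b else 0)"
proof -
  obtain N' where N': "2 * N = Suc N'" using N by (cases N) auto
  have "E b * E True = (if b then E b else 0)"
    unfolding E_def[of True] N'
    by (simp add: scale_mult_right[symmetric] mult.assoc[symmetric] E_mult_x)
      (simp add: E_def N')
  moreover have "E b * E False = (if b then 0 else E b)"
    unfolding E_def[of False] N'
    by (simp add: mult.assoc[symmetric] E_mult_x) (simp add: E_def N')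
  ultimately show ?thesis by (cases b; cases c; simp)
qed

definition yw :: "idx list \<Rightarrow> 'h"
  where "yw W = prod_list (map y W)"

lemma yw_simps [simp]: "yw [] = 1" "yw (i # W) = y i * yw W" "yw (U @ W) = yw U * yw W"
  by (auto simp: yw_def)

lemma yw_replicate [simp]: "yw (replicate k i) = y i ^ k"
  by (induction k) auto

lemma yw_mult_E: "yw W * E b = E b * yw W"
proof (induction W)
  case (Cons i W)
  have "yw (i # W) * E b = (y i * E b) * yw W" using Cons by (simp add: mult.assoc)
  also have "y i * E b = E b * y i" by (simp add: E_mult_y y_mult_E)
  finally show ?case by (simp add: mult.assoc)
qed simp

text \<open>The spanning elements \<open>e W\<close> and \<open>f W\<close>. Generators multiply
  them without leaving the family, except for the value 0.\<close>

definition Z :: "bool \<Rightarrow> idx list \<Rightarrow> 'h"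
  where "Z b W = E b * yw W"

lemma x_mult_Z: "x i j * Z b W = (if (i \<noteq> j) = b then Z b (i # W) else 0)"
proof -
  have "x i j * Z b W = E (i \<noteq> j) * (y i * E b) * yw W"
    by (simp add: x_eq[of i j] Z_def mult.assoc)
  also have "y i * E b = E b * y i" by (simp add: E_mult_y y_mult_E)
  finally show ?thesis by (simp add: Z_def mult.assoc[symmetric] E_E)
qed

lemma y_mult_Z: "y i * Z b W = Z b (i # W)"
  unfolding Z_def by (simp add: mult.assoc[symmetric] E_mult_y y_mult_E)

lemma yw_mult_Z: "yw U * Z b W = Z b (U @ W)"
  by (induction U) (auto simp: mult.assoc y_mult_Z)

lemma Z_mult_yw: "Z b U * yw W = Z b (U @ W)"
  by (simp add: Z_def mult.assoc)

lemma E_mult_Z: "E b * Z c W = (if b = c then Z c W else 0)"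
  by (simp add: Z_def mult.assoc[symmetric] E_E)

text \<open>The span contains 1 and is stable under left multiplication by generators, hence
  contains all monomials.\<close>

lemma Z_span: "span (range (\<lambda>(b, W). Z b W)) = UNIV"
proof -
  let ?S = "span (range (\<lambda>(b, W). Z b W))"
  have mult: "x i j * h \<in> ?S" if "h \<in> ?S" for i j h
    using that
  proof (induction rule: span_induct_alt)
    case base
    then show ?case by (simp add: span_zero)
  next
    case (step c u h)
    then obtain b W where u: "u = Z b W" by auto
    have "Z b (i # W) \<in> ?S" by (rule span_base) auto
    then have "x i j * u \<in> ?S" by (simp add: u x_mult_Z span_zero)
    then show ?case
      using step by (simp add: distrib_left scale_mult_right[symmetric] span_add span_scale)
  qed
  have "Z False [] + Z True [] \<in> ?S" by (intro span_add span_base) auto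
  then have one: "1 \<in> ?S" by (simp add: Z_def E_sum)
  have "prod_list (map (\<lambda>(i, j). x i j) ps) \<in> ?S" for ps
    by (induction ps) (auto simp: one mult)
  then have "free_eval scale (\<lambda>(i, j). x i j) p \<in> ?S" for p
    unfolding free_eval_def by (intro span_sum span_scale)
  then show ?thesis using presentation unfolding presented_by_def by (metis UNIV_eq_I)
qed

lemma Z_induct [case_names Z add scale]:
  assumes "\<And>b W. P (Z b W)" "\<And>g h. P g \<Longrightarrow> P h \<Longrightarrow> P (g + h)" "\<And>c h. P h \<Longrightarrow> P (scale c h)"
  shows "P h"
proof -
  have "h \<in> span (range (\<lambda>(b, W). Z b W))" by (simp add: Z_span)
  then show ?thesis
  proof (induction rule: span_induct_alt)
    case base
    show ?case using assms(3)[OF assms(1), of 0] by simp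
  next
    case (step c u h)
    then show ?case using assms by auto
  qed
qed

lemma E_central: "E b * h = h * E b"
proof (induction h rule: Z_induct)
  case (Z c W)
  have "Z c W * E b = E c * (E b * yw W)"
    by (simp add: Z_def mult.assoc yw_mult_E)
  then show ?case by (simp add: Z_def mult.assoc[symmetric] E_E)
next
  case (scale c h)
  then show ?case by (simp add: scale_mult_left[symmetric] scale_mult_right[symmetric])
qed (simp add: algebra_simps)

lemma x_power: "m \<ge> 1 \<Longrightarrow> x i j ^ m = E (i \<noteq> j) * y i ^ m"
proof (induction m rule: dec_induct)
  case base
  then show ?case by (simp add: x_eq[of i j])
next
  case (step m)
  have "x i j ^ Suc m = x i j * Z (i \<noteq> j) (replicate m i)"
    using step by (simp add: Z_def)
  then show ?case by (simp add: x_mult_Z) (simp add: Z_def)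
qed

lemma y_sq: "y i * y i = y j * y j"
proof -
  have *: "y i * y i = x i i ^ 2 + x i (flip i) ^ 2" for i
    by (simp add: y_def distrib_left distrib_right x_mult_zero power2_eq_square)
  show ?thesis
    unfolding * using rel_sq by (cases i; cases j) auto
qed

definition zz :: 'h
  where "zz = y I1 * y I1"

lemma y_y: "y i * y i = zz"
  unfolding zz_def by (rule y_sq)

lemma zz_central: "zz * h = h * zz"
proof (induction h rule: Z_induct)
  case (Z b W)
  have y: "zz * y i = y i * zz" for i
    unfolding y_y[of i, symmetric] by (simp add: mult.assoc)
  have "zz * yw W = yw W * zz"
    by (induction W) (auto simp: y mult.assoc[symmetric], simp add: y mult.assoc)
  then show ?case
    unfolding Z_def by (metis E_central mult.assoc)
next
  case (scale c h)
  then show ?case by (simp add: scale_mult_left[symmetric] scale_mult_right[symmetric])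
qed (simp add: algebra_simps)

lemma zz_power_central: "zz ^ k * h = h * zz ^ k"
  by (induction k) (auto simp: mult.assoc zz_central, simp add: mult.assoc[symmetric] zz_central)

text \<open>The relation for 1 yields \<open>zz^N = e + \<mu> f\<close>, whose square is 1 because
  \<open>\<mu> * \<mu> = 1\<close>. This is the origin of the exponent \<open>2 * N\<close>.\<close>

lemma zz_order: "zz ^ (2 * N) = 1"
proof -
  have zN: "zz ^ N = y I1 ^ (2 * N)"
    by (simp add: power_mult zz_def power2_eq_square)
  have F: "E False * y I1 ^ (2 * N) = E False"
    using x_power[of "2 * N" I1 I1] N by (simp add: E_def)
  have "scale \<mu> (E True * y I1 ^ (2 * N)) = E True"
    using x_power[of "2 * N" I1 I2] N by (simp add: E_def)
  then have T: "E True * y I1 ^ (2 * N) = scale \<mu> (E True)"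
    by (metis \<mu>\<mu> scale_one scale_scale)
  have "zz ^ N = (E False + E True) * y I1 ^ (2 * N)"
    by (simp add: zN E_sum)
  also have "\<dots> = E False + scale \<mu> (E True)"
    by (simp only: distrib_right F T)
  finally have "zz ^ N * zz ^ N = E False + scale (\<mu> * \<mu>) (E True)"
    by (simp add: distrib_left distrib_right scale_mult_left[symmetric] scale_mult_right[symmetric] E_E)
  then show ?thesis
    by (simp add: \<mu>\<mu> E_sum mult_2 power_add)
qed

lemma y_order: "y i ^ (4 * N) = 1"
proof -
  have "y i ^ (4 * N) = (y i ^ 2) ^ (2 * N)" by (simp add: power_mult[symmetric])
  then show ?thesis by (simp add: power2_eq_square y_y zz_order)
qed

text \<open>The inverse as a positive power: it is the image of a word, and the exponent is that of
  the antipode.\<close>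

definition yinv :: "idx \<Rightarrow> 'h"
  where "yinv i = y i ^ (4 * N - 1)"

lemma y_yinv: "y i * yinv i = 1" and yinv_y: "yinv i * y i = 1"
proof -
  have "4 * N = Suc (4 * N - 1)" using N by simp
  then have "y i * yinv i = y i ^ (4 * N)" "yinv i * y i = y i ^ (4 * N)"
    unfolding yinv_def by (metis power_Suc, metis power_Suc2)
  then show "y i * yinv i = 1" "yinv i * y i = 1" by (simp_all add: y_order)
qed

lemma yw_inverse: "\<exists>V. yw W * yw V = 1 \<and> yw V * yw W = 1"
proof (induction W)
  case Nil
  show ?case by (intro exI[of _ "[]"]) simp
next
  case (Cons i W)
  then obtain V where V: "yw W * yw V = 1" "yw V * yw W = 1" by blast
  have yi: "yw (replicate (4 * N - 1) i) = yinv i" by (simp add: yinv_def)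
  have "yw (i # W) * yw (V @ replicate (4 * N - 1) i) = y i * (yw W * yw V) * yinv i"
    unfolding yw_simps yi by (simp only: mult.assoc)
  moreover have "yw (V @ replicate (4 * N - 1) i) * yw (i # W) = yw V * (yinv i * y i) * yw W"
    unfolding yw_simps yi by (simp only: mult.assoc)
  ultimately show ?case
    using V y_yinv yinv_y by (intro exI[of _ "V @ replicate (4 * N - 1) i"]) (simp add: yinv_y)
qed

lemma chi_eq: "m \<ge> 1 \<Longrightarrow> chi x i j m = Z (i \<noteq> j) (altword i m)"
proof (induction m arbitrary: i j rule: dec_induct)
  case base
  show ?case by (simp add: x_eq[of i j] Z_def)
next
  case (step m)
  then show ?case by (simp add: x_mult_Z)
qed

definition \<kappa> :: "bool \<Rightarrow> 'k"
  where "\<kappa> b = (if b then lam else 1)"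

lemma \<kappa>_nz: "\<kappa> b \<noteq> 0"
  using lam_nz by (simp add: \<kappa>_def)

lemma Z_altword_swap: "Z b (altword I2 n) = scale (\<kappa> b) (Z b (altword I1 n))"
  using rel_chi n by (cases b) (auto simp: chi_eq \<kappa>_def)

text \<open>Squares of letters are the central \<open>zz\<close>, so reversal inverts a word up to a
  power of \<open>zz\<close>.\<close>

lemma yw_rev: "yw (rev W) * yw W = zz ^ length W"
proof (induction W)
  case (Cons i W)
  have "yw (rev (i # W)) * yw (i # W) = yw (rev W) * ((y i * y i) * yw W)"
    by (simp add: mult.assoc)
  also have "\<dots> = zz * (yw (rev W) * yw W)"
    unfolding y_y by (metis mult.assoc zz_central)
  finally show ?case using Cons by simp
qed simp

text \<open>The reversed \<open>altword I1 n\<close> times \<open>altword I2 n\<close> alternates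
  and has length \<open>2 n\<close>, while times \<open>altword I1 n\<close> it is
  \<open>zz^n\<close>; the relations between the two words of length \<open>n\<close> identify both
  up to \<open>\<kappa> b\<close>.\<close>

lemma Z_altword_double: "\<exists>c. c \<noteq> 0 \<and> (c = 1 \<or> b) \<and> Z b (altword i (2 * n)) = scale c (E b * zz ^ n)"
proof -
  obtain j where j: "rev (altword I1 n) @ altword I2 n = altword j (2 * n)"
    using rev_altword_append[of I1 n n] by (auto simp: mult_2)
  have lenalt: "length (altword i m) = m" for i m by (induction m arbitrary: i) auto
  have "Z b (altword j (2 * n)) = yw (rev (altword I1 n)) * Z b (altword I2 n)"
    unfolding j[symmetric] yw_mult_Z ..
  also have "\<dots> = scale (\<kappa> b) (yw (rev (altword I1 n)) * Z b (altword I1 n))"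
    unfolding Z_altword_swap by (simp add: scale_mult_right)
  also have "yw (rev (altword I1 n)) * Z b (altword I1 n) = E b * (yw (rev (altword I1 n)) * yw (altword I1 n))"
    unfolding Z_def by (metis mult.assoc yw_mult_E)
  also have "\<dots> = E b * zz ^ n" by (simp add: yw_rev lenalt)
  finally have jj: "Z b (altword j (2 * n)) = scale (\<kappa> b) (E b * zz ^ n)" .
  \<comment> \<open>The two alternating words of even length are conjugate by a letter, which
    transfers the result from the start letter \<open>j\<close>, fixed by the parity of
    \<open>n\<close>, to the other one.\<close>
  have rot: "yw (altword (flip k) (2 * m)) * y (flip k) = y (flip k) * yw (altword k (2 * m))" for m k
    by (induction m) (auto simp: mult.assoc)
  have "Z b (altword (flip j) (2 * n)) * y (flip j) = Z b (flip j # altword j (2 * n))"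
    unfolding Z_def mult.assoc rot by simp
  also have "\<dots> = y (flip j) * Z b (altword j (2 * n))" by (simp add: y_mult_Z)
  also have "\<dots> = scale (\<kappa> b) (E b * zz ^ n) * y (flip j)"
    unfolding jj
    by (simp add: scale_mult_left[symmetric] scale_mult_right[symmetric])
      (metis E_central mult.assoc zz_power_central)
  finally have "Z b (altword (flip j) (2 * n)) * y (flip j) * yinv (flip j) =
      scale (\<kappa> b) (E b * zz ^ n) * y (flip j) * yinv (flip j)" by simp
  then have "Z b (altword (flip j) (2 * n)) = scale (\<kappa> b) (E b * zz ^ n)"
    by (simp add: mult.assoc y_yinv)
  with jj have "Z b (altword i (2 * n)) = scale (\<kappa> b) (E b * zz ^ n)"
    by (cases "i = j") (auto simp: idx_neq_iff)
  then show ?thesis using \<kappa>_nz by (intro exI[of _ "\<kappa> b"]) (auto simp: \<kappa>_def)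
qed

text \<open>A group under the multiplication of the algebra, with unit \<open>E False\<close>
  instead of 1; inverses come from \<open>yw_inverse\<close>.\<close>

definition grp :: "'h set"
  where "grp = range (Z False)"

text \<open>Extracting squares turns each word into a power of \<open>zz\<close> times an
  alternating word; \<open>zz_order\<close> bounds the power and \<open>Z_altword_double\<close> the
  length.\<close>

lemma finite_grp: "finite grp"
proof -
  define S where "S = (\<lambda>(k, i, l). zz ^ k * Z False (altword i l)) ` ({..<2 * N} \<times> UNIV \<times> {..<2 * n})"
  have zz_mod: "zz ^ k = zz ^ (k mod (2 * N))" for k
  proof -
    have "zz ^ k = (zz ^ (2 * N)) ^ (k div (2 * N)) * zz ^ (k mod (2 * N))"
      by (simp only: power_mult[symmetric] power_add[symmetric] mult_div_mod_eq)
    then show ?thesis by (simp add: zz_order)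
  qed
  have S: "zz ^ k * Z False (altword i l) \<in> S" for k i l
  proof (induction l arbitrary: k i rule: less_induct)
    case (less l)
    show ?case
    proof (cases "l < 2 * n")
      case True
      have "k mod (2 * N) < 2 * N" using N by simp
      then show ?thesis
        unfolding S_def using True by (subst zz_mod) (auto intro!: image_eqI[of _ _ "(k mod (2 * N), i, l)"])
    next
      case False
      then obtain r where r: "l = 2 * n + r" by (metis le_Suc_ex not_less)
      obtain j where j: "altword i l = altword i (2 * n) @ altword j r"
        using altword_add[of i "2 * n" r] r by auto
      have "Z False (altword i (2 * n)) = E False * zz ^ n"
        using Z_altword_double[of False i] by auto
      then have "Z False (altword i l) = zz ^ n * Z False (altword j r)"
        unfolding j Z_mult_yw[symmetric] by (metis Z_def mult.assoc zz_power_central)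
      then have "zz ^ k * Z False (altword i l) = zz ^ (k + n) * Z False (altword j r)"
        by (simp add: power_add mult.assoc)
      moreover have "r < l" using r n by simp
      ultimately show ?thesis using less by simp
    qed
  qed
  have "\<exists>k i l. Z False W = zz ^ k * Z False (altword i l)" for W
  proof (induction W)
    case Nil
    show ?case by (rule exI[of _ 0], rule exI, rule exI[of _ 0]) simp
  next
    case (Cons j W)
    then obtain k i l where W: "Z False W = zz ^ k * Z False (altword i l)" by blast
    have step: "Z False (j # W) = zz ^ k * Z False (j # altword i l)"
      unfolding y_mult_Z[symmetric] W by (metis mult.assoc zz_power_central)
    show ?case
    proof (cases l)
      case 0
      then have "Z False (j # W) = zz ^ k * Z False (altword j 1)" using step by simp
      then show ?thesis by blast
    next
      case (Suc m)
      show ?thesis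
      proof (cases "i = j")
        case True
        have "Z False (j # altword i l) = zz * Z False (altword (flip i) m)"
          using Suc True by (simp add: Z_def) (metis mult.assoc y_y zz_central)
        then have "Z False (j # W) = zz ^ Suc k * Z False (altword (flip i) m)"
          using step by (simp only: power_Suc2 mult.assoc)
        then show ?thesis by blast
      next
        case False
        then have "j # altword i l = altword j (Suc l)" by (cases i; cases j; simp)
        then show ?thesis using step by metis
      qed
    qed
  qed
  then have "grp \<subseteq> S" using S by (auto simp: grp_def) (metis S)
  moreover have "finite S" unfolding S_def by (simp add: UNIV_idx)
  ultimately show ?thesis by (rule finite_subset)
qed

end

section \<open>Comultiplication of words\<close>

context hopf_algebra
begin

lemma comult_mult_sum_list:
  assumes g: "comult g = (\<Sum>(a, b)\<leftarrow>xs. tensor scale scale a b)"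
    and h: "comult h = (\<Sum>(c, d)\<leftarrow>ys. tensor scale scale c d)"
  shows "comult (g * h) = (\<Sum>(a, b)\<leftarrow>xs. \<Sum>(c, d)\<leftarrow>ys. tensor scale scale (a * c) (b * d))"
proof -
  note vs = vector_space_axioms
  have b1: "bilin scale scale tensor_scale (\<lambda>c d. tensor scale scale (a * c) (b * d))" for a b
    by (intro bilinI vs vector_space_tensor_scale)
      (simp_all add: distrib_left tensor_add_left tensor_add_right scale_mult_right[symmetric]
        tensor_scale_left tensor_scale_right)
  have b2: "bilin scale scale tensor_scale
      (\<lambda>a b. tensor_lift scale scale (\<lambda>c d. tensor scale scale (a * c) (b * d)) (comult h))"
    unfolding bilin_def
    by (intro conjI allI vs vector_space_tensor_scale linear_lift_param[OF b1 _ comult_in_tensor_space])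
      (simp_all add: Vector_Spaces.linear_iff vs vector_space_tensor_scale distrib_right
        tensor_add_left tensor_add_right scale_mult_left[symmetric] tensor_scale_left tensor_scale_right)
  show ?thesis
    unfolding comult_mult g lift_sum_list[OF b2] unfolding h lift_sum_list[OF b1] ..
qed

end

context suzuki
begin

lemma comult_x: "comult (x i j) = tensor scale scale (x i I1) (x I1 j) + tensor scale scale (x i I2) (x I2 j)"
  using comult_chi[of 1 i j] by simp

text \<open>The summand with diagonal first leg is put first for either \<open>i\<close>, matching
  the order of terms in \<open>comult_Z\<close>.\<close>

lemma comult_x_list:
  "comult (x i j) = (\<Sum>(a, b)\<leftarrow>[(x i i, x i j), (x i (flip i), x (flip i) j)]. tensor scale scale a b)"
  unfolding sum_list_two by (cases i) (auto simp: comult_x add.commute)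

lemma comult_x_power:
  assumes "m \<ge> 1"
  shows "comult (x I1 I1 ^ m) =
    tensor scale scale (x I1 I1 ^ m) (x I1 I1 ^ m) + tensor scale scale (x I1 I2 ^ m) (x I2 I1 ^ m)"
  using assms
proof (induction m rule: dec_induct)
  case base
  then show ?case by (simp add: comult_x)
next
  case (step m)
  have cross: "x I1 I1 * x I1 I2 ^ m = 0" "x I1 I2 * x I1 I1 ^ m = 0"
    using step(1) by (cases m; simp add: mult.assoc[symmetric] x_mult_zero)+
  have "comult (x I1 I1 ^ m) = (\<Sum>(a, b)\<leftarrow>[(x I1 I1 ^ m, x I1 I1 ^ m), (x I1 I2 ^ m, x I2 I1 ^ m)]. tensor scale scale a b)"
    unfolding sum_list_two by (rule step.IH)
  from comult_mult_sum_list[OF comult_x_list[of I1 I1] this] show ?case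
    unfolding sum_list_two by (simp add: cross tensor_zero_left)
qed

text \<open>For \<open>e\<close> this is the formula for powers of \<open>x I1 I1\<close>, the two
  factors \<open>\<mu>\<close> in \<open>f \<otimes> f\<close> cancelling; for \<open>f\<close> it
  follows by subtraction from the group-like element 1.\<close>

lemma comult_E: "comult (E b) = tensor scale scale (E False) (E b) + tensor scale scale (E True) (E (\<not> b))"
proof -
  have F: "comult (E False) = tensor scale scale (E False) (E False) + tensor scale scale (E True) (E True)"
  proof -
    have "x I2 I1 ^ (2 * N) = x I1 I2 ^ (2 * N)"
      unfolding power_mult rel_sq(2)[symmetric] ..
    then have "tensor scale scale (E True) (E True) =
        tensor_scale (\<mu> * \<mu>) (tensor scale scale (x I1 I2 ^ (2 * N)) (x I2 I1 ^ (2 * N)))"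
      by (simp add: E_def tensor_scale_left tensor_scale_right) (simp add: tensor_scale_def mult.assoc)
    also have "\<dots> = tensor scale scale (x I1 I2 ^ (2 * N)) (x I2 I1 ^ (2 * N))"
      by (simp add: \<mu>\<mu>) (simp add: tensor_scale_def)
    finally show ?thesis
      using comult_x_power[of "2 * N"] N by (simp add: E_def)
  qed
  have "comult (E False) + comult (E True) = tensor scale scale (E False + E True) (E False + E True)"
    by (simp add: linear_add'[OF comult_linear, symmetric] E_sum comult_one)
  then have "comult (E True) = tensor scale scale (E False) (E True) + tensor scale scale (E True) (E False)"
    unfolding F by (simp add: tensor_add_left tensor_add_right algebra_simps)
  with F show ?thesis by (cases b) auto
qed

abbreviation flips :: "bool \<Rightarrow> idx list \<Rightarrow> idx list"
  where "flips c \<equiv> map (flip_if c)"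

text \<open>In the first leg a diagonal generator survives only against \<open>Z False\<close>, an
  off-diagonal one only against \<open>Z True\<close>, so multiplication by a letter creates no
  mixed terms.\<close>

lemma comult_Z:
  "comult (Z b W) = tensor scale scale (Z False W) (Z b W) + tensor scale scale (Z True W) (Z (\<not> b) (map flip W))"
proof (induction W)
  case Nil
  then show ?case by (simp add: Z_def comult_E)
next
  case (Cons i W)
  have Z: "Z b (i # W) = x i (flip_if b i) * Z b W" by (simp add: x_mult_Z)
  have "comult (Z b W) =
      (\<Sum>(a, b)\<leftarrow>[(Z False W, Z b W), (Z True W, Z (\<not> b) (map flip W))]. tensor scale scale a b)"
    unfolding sum_list_two by (rule Cons.IH)
  from comult_mult_sum_list[OF comult_x_list[of i "flip_if b i"] this]
  show ?case unfolding Z sum_list_two by (cases b) (auto simp: x_mult_Z tensor_zero_left tensor_zero_right)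
qed

lemma convolution_Z:
  assumes "functional \<phi>" "functional \<psi>"
  shows "convolution \<phi> \<psi> (Z b W) = \<phi> (Z False W) * \<psi> (Z b W) + \<phi> (Z True W) * \<psi> (Z (\<not> b) (map flip W))"
  by (simp add: convolution_def comult_Z tensor_eval[OF assms])

lemma functional_eq_on_Z:
  assumes "functional \<phi>" "functional \<psi>" "\<And>b W. \<phi> (Z b W) = \<psi> (Z b W)"
  shows "\<phi> = \<psi>"
proof
  fix h show "\<phi> h = \<psi> h"
    by (induction h rule: Z_induct) (simp_all add: assms(3) linear_add'[OF assms(1)] linear_add'[OF assms(2)]
        linear_scale'[OF assms(1)] linear_scale'[OF assms(2)])
qed

lemma counit_Z: "counit (Z b W) = (if b then 0 else 1)"
proof -
  have y: "counit (y i) = 1" for i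
    by (simp add: y_def linear_add'[OF counit_linear] counit_gen)
  have yw: "counit (yw W) = 1"
    by (induction W) (auto simp: counit_one counit_mult y)
  have pow: "counit (h ^ k) = counit h ^ k" for h k
    by (induction k) (auto simp: counit_one counit_mult)
  have "counit (E b) = (if b then 0 else 1)"
    using N by (simp add: E_def linear_scale'[OF counit_linear] pow counit_gen)
  then show ?thesis by (simp add: Z_def counit_mult yw)
qed

lemma Z_True_nonzero:
  assumes "E True \<noteq> 0" shows "Z True W \<noteq> 0"
proof
  assume 0: "Z True W = 0"
  obtain V where "yw W * yw V = 1" using yw_inverse by blast
  then have "E True = Z True W * yw V" by (simp add: Z_def mult.assoc)
  with 0 assms show False by simp
qed

text \<open>Equal \<open>e\<close>-parts have equal coproducts; cancelling
  \<open>e W \<otimes> e W\<close> leaves an equality of pure tensors, so the \<open>f\<close>-parts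
  are proportional. Comparing the coproducts of these \<open>f\<close>-parts then identifies the
  exchanged \<open>e\<close>-parts.\<close>

lemma Z_False_eq:
  assumes E: "E True \<noteq> 0" and eq: "Z False W = Z False U"
  shows "\<exists>\<alpha>. \<alpha> \<noteq> 0 \<and> Z True W = scale \<alpha> (Z True U)" and "Z False (map flip W) = Z False (map flip U)"
proof -
  note vs = vector_space_axioms
  have "tensor scale scale (Z True W) (Z True (map flip W)) = tensor scale scale (Z True U) (Z True (map flip U))"
    using comult_Z[of False W] comult_Z[of False U] eq by simp
  moreover obtain g where g: "functional g" "g (Z True (map flip W)) = 1"
    using functional_separates[OF Z_True_nonzero[OF E]] by metis
  ultimately have *: "Z True W = scale (g (Z True (map flip U))) (Z True U)"
    using tensor_eq_left[OF vs vs _ g(1)] by (metis g(2) scale_one)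
  define \<alpha> where "\<alpha> = g (Z True (map flip U))"
  have \<alpha>: "\<alpha> \<noteq> 0" "Z True W = scale \<alpha> (Z True U)"
    using * Z_True_nonzero[OF E, of W] by (auto simp: \<alpha>_def)
  then show "\<exists>\<alpha>. \<alpha> \<noteq> 0 \<and> Z True W = scale \<alpha> (Z True U)" by blast
  have "comult (Z True W) = tensor_scale \<alpha> (comult (Z True U))"
    by (simp add: \<alpha>(2) linear_scale'[OF comult_linear])
  also have "\<dots> = tensor scale scale (Z False W) (Z True W) + tensor scale scale (Z True W) (Z False (map flip U))"
    unfolding comult_Z \<alpha>(2) tensor_scale_left tensor_scale_right eq
    by (simp add: tensor_scale_def fun_eq_iff algebra_simps)
  finally have "tensor scale scale (Z True W) (Z False (map flip W)) =
      tensor scale scale (Z True W) (Z False (map flip U))"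
    unfolding comult_Z[of True W] by simp
  then show "Z False (map flip W) = Z False (map flip U)"
    by (rule tensor_eq_right[OF vs vs]) (rule Z_True_nonzero[OF E])
qed

section \<open>Linear independence of the group\<close>

lemma E_fix_grp: "g \<in> grp \<Longrightarrow> E False * g = g"
  by (auto simp: grp_def E_mult_Z)

text \<open>The classical proof for group-like elements, applied modulo \<open>f\<close>: the
  coordinates of a group element in a maximal independent subset are orthogonal idempotents of the
  field, so it is itself a member of the subset.\<close>

lemma independent_grp: "independent grp"
proof -
  obtain S where S: "S \<subseteq> grp" "independent S" "grp \<subseteq> span S"
    by (rule maximal_independent_subset)
  have finS: "finite S" using S(1) finite_grp by (rule finite_subset)
  define B where "B = extend_basis S"
  have B: "independent B" "span B = UNIV" "S \<subseteq> B"
    using independent_extend_basis[OF S(2)] span_extend_basis[OF S(2)] extend_basis_superset[OF S(2)]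
    by (auto simp: B_def)
  \<comment> \<open>The factor \<open>E False\<close> makes the coordinate blind to
    \<open>f\<close>-parts, so convolution of coordinates is multiplicative on
    \<open>grp\<close>.\<close>
  define \<phi> where "\<phi> = (\<lambda>h a. representation B (E False * a) h)"
  have rep: "functional (\<lambda>a. representation B a h)" for h
    by (rule linear_representation) (use B in auto)
  have \<phi>: "functional (\<phi> h)" for h
    unfolding Vector_Spaces.linear_iff \<phi>_def
    using linear_add'[OF rep] linear_scale'[OF rep]
    by (simp add: vector_space_axioms vector_space_mult distrib_left scale_mult_right[symmetric])
  have \<phi>S: "\<phi> h k = (if h = k then 1 else 0)" if "h \<in> S" "k \<in> S" for h k
  proof -
    have k: "k \<in> grp" "k \<in> B" using that S(1) B(3) by auto
    then show ?thesis
      using representation_basis[OF B(1) k(2)] by (simp add: \<phi>_def E_fix_grp)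
  qed
  have \<phi>T: "\<phi> h (Z True W) = 0" for h W
    by (simp add: \<phi>_def E_mult_Z representation_zero)
  have grpS: "g = (\<Sum>h\<in>S. scale (\<phi> h g) h)" if g: "g \<in> grp" for g
  proof -
    have "representation B g = representation S g"
      by (rule representation_extend[OF B(1) _ B(3)]) (use S(3) g in auto)
    moreover have "(\<Sum>h\<in>S. scale (representation S g h) h) = g"
      by (rule sum_representation_eq[OF S(2)]) (use S(3) g finS in auto)
    ultimately show ?thesis by (simp add: \<phi>_def E_fix_grp[OF g])
  qed
  have "g \<in> S" if g: "g \<in> grp" for g
  proof -
    obtain W where W: "g = Z False W" using g by (auto simp: grp_def)
    have S_W: "\<exists>W. l = Z False W" if "l \<in> S" for l using that S(1) by (auto simp: grp_def)
    \<comment> \<open>The convolution of two coordinates is evaluated at \<open>g\<close> in two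
      ways: from the coproduct of \<open>g\<close>, and linearly on the expansion of
      \<open>g\<close> in \<open>S\<close>.\<close>
    have conv: "\<phi> h g * \<phi> k g = (if h = k then \<phi> h g else 0)" if hk: "h \<in> S" "k \<in> S" for h k
    proof -
      note C = convolution_linear[OF \<phi>[of h] \<phi>[of k]]
      have "\<phi> h g * \<phi> k g = convolution (\<phi> h) (\<phi> k) g"
        by (simp add: W convolution_Z[OF \<phi> \<phi>] \<phi>T)
      also have "\<dots> = (\<Sum>l\<in>S. \<phi> l g * convolution (\<phi> h) (\<phi> k) l)"
        by (subst grpS[OF g]) (simp add: linear_sum'[OF C] linear_scale'[OF C])
      also have "\<dots> = (\<Sum>l\<in>S. if l = h then (if h = k then \<phi> h g else 0) else 0)"
      proof (rule sum.cong[OF refl])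
        fix l assume l: "l \<in> S"
        then obtain U where "l = Z False U" using S_W by blast
        then have "convolution (\<phi> h) (\<phi> k) l = \<phi> h l * \<phi> k l"
          by (simp add: convolution_Z[OF \<phi> \<phi>] \<phi>T)
        then show "\<phi> l g * convolution (\<phi> h) (\<phi> k) l = (if l = h then (if h = k then \<phi> h g else 0) else 0)"
          using l hk by (auto simp: \<phi>S)
      qed
      also have "\<dots> = (if h = k then \<phi> h g else 0)" using finS hk by simp
      finally show ?thesis .
    qed
    have eps: "counit g = 1" using W by (simp add: counit_Z)
    then have "g \<noteq> 0" using linear_zero'[OF counit_linear] by auto
    moreover have "g = 0" if "\<forall>h\<in>S. \<phi> h g = 0"
      by (rule trans[OF grpS[OF g]], rule sum.neutral) (use that in simp)
    ultimately obtain h where h: "h \<in> S" "\<phi> h g \<noteq> 0" by blast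
    have "\<phi> k g = 0" if "k \<in> S" "k \<noteq> h" for k
      using conv[OF that(1) h(1)] that h(2) by simp
    then have "(\<Sum>k\<in>S. scale (\<phi> k g) k) = (\<Sum>k\<in>S. if k = h then scale (\<phi> h g) h else 0)"
      by (intro sum.cong refl) auto
    also have "\<dots> = scale (\<phi> h g) h" using finS h(1) by simp
    finally have gh: "g = scale (\<phi> h g) h" by (rule trans[OF grpS[OF g]])
    have "\<phi> h g * \<phi> h g = \<phi> h g" using conv[OF h(1) h(1)] by simp
    then have "\<phi> h g = 1" using h(2) by simp
    then have "g = h" by (intro trans[OF gh]) simp
    then show ?thesis using h(1) by simp
  qed
  then have "S = grp" using S(1) by blast
  then show ?thesis using S(2) by simp
qed

section \<open>Dual functionals and their convolution products\<close>

definition \<phi> :: "'h \<Rightarrow> 'h \<Rightarrow> 'k"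
  where "\<phi> g a = representation (extend_basis grp) (E False * a) g"

lemma \<phi>_linear: "functional (\<phi> g)"
proof -
  have rep: "functional (\<lambda>a. representation (extend_basis grp) a g)"
    by (rule linear_representation)
      (simp_all add: independent_extend_basis[OF independent_grp] span_extend_basis[OF independent_grp])
  show ?thesis
    unfolding Vector_Spaces.linear_iff \<phi>_def
    using linear_add'[OF rep] linear_scale'[OF rep]
    by (simp add: vector_space_axioms vector_space_mult distrib_left scale_mult_right[symmetric])
qed

lemma \<phi>_Z: "\<phi> g (Z b W) = (if \<not> b \<and> Z False W = g then 1 else 0)"
proof (cases b)
  case True
  then show ?thesis by (simp add: \<phi>_def E_mult_Z representation_zero)
next
  case False
  have "Z False W \<in> extend_basis grp"
    using extend_basis_superset[OF independent_grp] by (auto simp: grp_def)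
  then show ?thesis
    using False representation_basis[OF independent_extend_basis[OF independent_grp], of "Z False W"]
    by (simp add: \<phi>_def E_mult_Z)
qed

definition word :: "'h \<Rightarrow> idx list"
  where "word g = (SOME W. Z False W = g)"

lemma Z_word: "g \<in> grp \<Longrightarrow> Z False (word g) = g"
  unfolding word_def grp_def by (rule someI_ex) auto

text \<open>A reference choice of \<open>f\<close>-part for \<open>g\<close>; another word for
  \<open>g\<close> changes it by a nonzero scalar (\<open>Z_True_cc\<close>).\<close>

definition cc :: "'h \<Rightarrow> 'h"
  where "cc g = Z True (word g)"

lemma Z_grp [simp]: "Z False W \<in> grp"
  by (simp add: grp_def)

lemma Z_True_cc: "\<exists>\<alpha>. \<alpha> \<noteq> 0 \<and> Z True W = scale \<alpha> (cc (Z False W))"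
proof (cases "E True = 0")
  case True
  then have "Z True W = scale 1 (cc (Z False W))" by (simp add: Z_def cc_def)
  then show ?thesis using one_neq_zero by blast
next
  case False
  show ?thesis unfolding cc_def by (rule Z_False_eq(1)[OF False]) (simp add: Z_word)
qed

text \<open>Any functional normalised at \<open>cc g\<close> will do: its values on
  \<open>f\<close>-parts of other degrees are filtered out in \<open>\<psi>\<close>. The default 0
  covers \<open>f = 0\<close>.\<close>

definition \<chi> :: "'h \<Rightarrow> 'h \<Rightarrow> 'k"
  where "\<chi> g = (if E True = 0 then (\<lambda>_. 0) else SOME f. functional f \<and> f (Z True (word g)) = 1)"

lemma \<chi>: "functional (\<chi> g)" "E True \<noteq> 0 \<Longrightarrow> \<chi> g (cc g) = 1"
proof -
  have *: "functional (\<chi> g) \<and> \<chi> g (Z True (word g)) = 1" if E: "E True \<noteq> 0"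
  proof -
    have "\<exists>f. functional f \<and> f (Z True (word g)) = 1"
      using functional_separates[OF Z_True_nonzero[OF E]] by metis
    then have "functional (SOME f. functional f \<and> f (Z True (word g)) = 1) \<and>
        (SOME f. functional f \<and> f (Z True (word g)) = 1) (Z True (word g)) = 1"
      by (rule someI_ex)
    then show ?thesis using E by (simp add: \<chi>_def)
  qed
  then show "E True \<noteq> 0 \<Longrightarrow> \<chi> g (cc g) = 1" by (simp add: cc_def)
  show "functional (\<chi> g)"
  proof (cases "E True = 0")
    case True
    then show ?thesis
      by (simp add: \<chi>_def Vector_Spaces.linear_iff vector_space_axioms vector_space_mult)
  next
    case False
    then show ?thesis using * by blast
  qed
qed

text \<open>
  Convolving with \<open>\<phi> g\<close> isolates the component of \<open>g\<close>, so \<open>\<psi>\<close> is dual to \<open>cc\<close> without first proving that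
  the elements \<open>cc g\<close> are linearly independent.
\<close>

definition \<psi> :: "'h \<Rightarrow> 'h \<Rightarrow> 'k"
  where "\<psi> g a = convolution (\<phi> g) (\<chi> g) (E True * a)"

lemma \<psi>_linear: "functional (\<psi> g)"
  using convolution_linear[OF \<phi>_linear[of g] \<chi>(1)[of g]] unfolding Vector_Spaces.linear_iff \<psi>_def
  by (simp add: distrib_left scale_mult_right[symmetric])

lemma \<psi>_Z_False: "\<psi> g (Z False W) = 0"
  using linear_zero'[OF convolution_linear[OF \<phi>_linear \<chi>(1)]] by (simp add: \<psi>_def E_mult_Z)

lemma \<psi>_Z_True: "\<psi> g (Z True W) = (if Z False W = g then \<chi> g (Z True W) else 0)"
  by (simp add: \<psi>_def E_mult_Z convolution_Z[OF \<phi>_linear \<chi>(1)] \<phi>_Z)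

lemma \<psi>_cc: "E True \<noteq> 0 \<Longrightarrow> g \<in> grp \<Longrightarrow> h \<in> grp \<Longrightarrow> \<psi> g (cc h) = (if g = h then 1 else 0)"
  using \<chi>(2)[of g] by (auto simp: \<psi>_Z_True cc_def Z_word)

lemma cc_zero: "E True = 0 \<Longrightarrow> cc g = 0"
  by (simp add: cc_def Z_def)

text \<open>
  On the comodule side this says that the coaction of a vector \<open>v\<close> of degree \<open>g\<close> is \<open>g \<otimes> v + cc g \<otimes> T v\<close>.
\<close>

lemma convolution_\<phi>:
  assumes "functional f" "g \<in> grp"
  shows "convolution (\<phi> g) f = (\<lambda>a. f g * \<phi> g a + f (cc g) * \<psi> g a)"
proof (rule functional_eq_on_Z)
  show "functional (convolution (\<phi> g) f)" by (rule convolution_linear[OF \<phi>_linear assms(1)])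
  show "functional (\<lambda>a. f g * \<phi> g a + f (cc g) * \<psi> g a)"
    unfolding Vector_Spaces.linear_iff
    by (simp add: vector_space_axioms vector_space_mult linear_add'[OF \<phi>_linear] linear_add'[OF \<psi>_linear]
        linear_scale'[OF \<phi>_linear] linear_scale'[OF \<psi>_linear] algebra_simps)
  fix b W
  show "convolution (\<phi> g) f (Z b W) = f g * \<phi> g (Z b W) + f (cc g) * \<psi> g (Z b W)"
  proof (cases b)
    case False
    then show ?thesis
      by (auto simp: convolution_Z[OF \<phi>_linear assms(1)] \<phi>_Z \<psi>_Z_False)
  next
    case True
    have "f (Z True W) = f (cc g) * \<chi> g (Z True W)" if W: "Z False W = g"
    proof -
      obtain \<alpha> where "Z True W = scale \<alpha> (cc g)" using Z_True_cc[of W] W by auto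
      then show ?thesis
        using \<chi>(2)[of g] cc_zero[of g]
        by (cases "E True = 0")
          (simp_all add: linear_scale'[OF assms(1)] linear_scale'[OF \<chi>(1)] linear_zero'[OF assms(1)] linear_zero'[OF \<chi>(1)])
    qed
    then show ?thesis
      using True by (auto simp: convolution_Z[OF \<phi>_linear assms(1)] \<phi>_Z \<psi>_Z_True)
  qed
qed

text \<open>In the dual algebra the \<open>\<phi> g\<close> thus sum to the unit, which yields the
  grading of every comodule.\<close>

lemma counit_eq: "counit = (\<lambda>a. \<Sum>g\<in>grp. \<phi> g a)"
proof (rule functional_eq_on_Z[OF counit_linear])
  show "functional (\<lambda>a. \<Sum>g\<in>grp. \<phi> g a)"
    unfolding Vector_Spaces.linear_iff
    by (simp add: vector_space_axioms vector_space_mult linear_add'[OF \<phi>_linear] linear_scale'[OF \<phi>_linear]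
        sum.distrib sum_distrib_left)
  fix b W show "counit (Z b W) = (\<Sum>g\<in>grp. \<phi> g (Z b W))"
    using finite_grp by (cases b) (auto simp: counit_Z \<phi>_Z sum.delta)
qed

text \<open>Exchange of \<open>a\<close> and \<open>b\<close> on group elements; by
  \<open>swap_Z\<close> independent of the chosen word as long as \<open>f\<close> is
  nonzero.\<close>

definition swap :: "'h \<Rightarrow> 'h"
  where "swap g = Z False (map flip (word g))"

lemma swap_Z: "E True \<noteq> 0 \<Longrightarrow> swap (Z False W) = Z False (map flip W)"
  unfolding swap_def by (rule Z_False_eq(2)) (simp_all add: Z_word)

text \<open>Only the term \<open>f W \<otimes> e W'\<close> in the coproduct of \<open>f W\<close>
  contributes. On comodules this says that \<open>T\<close> maps degree \<open>g\<close> to degree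
  \<open>swap g\<close>.\<close>

lemma convolution_\<psi>_\<phi>:
  assumes "g \<in> grp"
  shows "convolution (\<psi> g) (\<phi> h) = (\<lambda>a. if h = swap g then \<psi> g a else 0)"
\<comment> \<open>Here \<open>swap\<close> may depend on the choice of words, but both sides vanish
  together with \<open>\<psi>\<close>.\<close>
proof (cases "E True = 0")
  case True
  then have "\<psi> g a = 0" for a
    using linear_zero'[OF convolution_linear[OF \<phi>_linear \<chi>(1)]] by (simp add: \<psi>_def)
  then show ?thesis
    using True by (intro functional_eq_on_Z convolution_linear \<psi>_linear \<phi>_linear)
      (auto simp: Vector_Spaces.linear_iff vector_space_axioms vector_space_mult
        convolution_Z[OF \<psi>_linear \<phi>_linear])
next
  case False
  show ?thesis
  proof (rule functional_eq_on_Z[OF convolution_linear[OF \<psi>_linear \<phi>_linear]])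
    show "functional (\<lambda>a. if h = swap g then \<psi> g a else 0)"
      unfolding Vector_Spaces.linear_iff
      by (simp add: vector_space_axioms vector_space_mult linear_add'[OF \<psi>_linear] linear_scale'[OF \<psi>_linear])
    fix b W
    show "convolution (\<psi> g) (\<phi> h) (Z b W) = (if h = swap g then \<psi> g (Z b W) else 0)"
      by (cases b) (auto simp: convolution_Z[OF \<psi>_linear \<phi>_linear] \<psi>_Z_False \<psi>_Z_True \<phi>_Z
          swap_Z[OF False])
  qed
qed

text \<open>Only the term \<open>f W \<otimes> f W'\<close> in the coproduct of \<open>e W\<close>
  contributes. On comodules this says that the square of \<open>T\<close> is a nonzero scalar in
  degree \<open>g\<close>.\<close>

lemma convolution_\<psi>_\<psi>:
  assumes "g \<in> grp" "E True \<noteq> 0"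
  shows "\<exists>\<alpha>. \<alpha> \<noteq> 0 \<and> convolution (\<psi> g) (\<psi> (swap g)) = (\<lambda>a. \<alpha> * \<phi> g a)"
proof -
  define \<alpha> where "\<alpha> = \<psi> (swap g) (Z True (map flip (word g)))"
  have "convolution (\<psi> g) (\<psi> (swap g)) = (\<lambda>a. \<alpha> * \<phi> g a)"
  proof (rule functional_eq_on_Z[OF convolution_linear[OF \<psi>_linear \<psi>_linear]])
    show "functional (\<lambda>a. \<alpha> * \<phi> g a)"
      unfolding Vector_Spaces.linear_iff
      by (simp add: vector_space_axioms vector_space_mult linear_add'[OF \<phi>_linear] linear_scale'[OF \<phi>_linear] algebra_simps)
    fix b W
    show "convolution (\<psi> g) (\<psi> (swap g)) (Z b W) = \<alpha> * \<phi> g (Z b W)"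
    proof (cases "\<not> b \<and> Z False W = g")
      case True
      then have Z: "Z b W = Z False (word g)" using Z_word[OF assms(1)] by simp
      have "\<psi> g (Z True (word g)) = 1" "\<phi> g (Z False (word g)) = 1"
        using \<psi>_cc[OF assms(2,1,1)] \<phi>_Z[of g False "word g"] Z_word[OF assms(1)]
        by (simp_all add: cc_def)
      then show ?thesis
        unfolding Z convolution_Z[OF \<psi>_linear \<psi>_linear] \<psi>_Z_False \<alpha>_def by simp
    next
      case False
      then show ?thesis
        by (cases b) (auto simp: convolution_Z[OF \<psi>_linear \<psi>_linear] \<psi>_Z_False \<psi>_Z_True \<phi>_Z)
    qed
  qed
  moreover have "\<alpha> \<noteq> 0"
  proof -
    have s: "swap g \<in> grp" by (simp add: swap_def)
    obtain \<beta> where "\<beta> \<noteq> 0" "Z True (map flip (word g)) = scale \<beta> (cc (swap g))"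
      using Z_True_cc[of "map flip (word g)"] by (auto simp: swap_def)
    then show ?thesis
      using \<psi>_cc[OF assms(2) s s] by (simp add: \<alpha>_def linear_scale'[OF \<psi>_linear])
  qed
  ultimately show ?thesis by blast
qed

end

section \<open>Yetter-Drinfeld modules over the Suzuki algebras\<close>

context yd_module
begin

lemma coaction_op_combination:
  assumes "functional p" "functional q"
  shows "coaction_op (\<lambda>a. c * p a + d * q a) v = scaleV c (coaction_op p v) + scaleV d (coaction_op q v)"
proof (rule V.functional_eqI)
  fix F assume F: "Vector_Spaces.linear scaleV (*) F"
  have lin: "functional (\<lambda>a. c * p a + d * q a)"
    unfolding Vector_Spaces.linear_iff
    by (simp add: vector_space_axioms vector_space_mult linear_add'[OF assms(1)] linear_add'[OF assms(2)]
        linear_scale'[OF assms(1)] linear_scale'[OF assms(2)] algebra_simps)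
  obtain xs where xs: "coact v = (\<Sum>(a, u)\<leftarrow>xs. tensor scale scaleV a u)"
    using tensor_space_sum_list[OF coact_in_tensor_space] .
  have "coact v (\<lambda>a. c * p a + d * q a) F = c * coact v p F + d * coact v q F"
    unfolding xs sum_list_fun2
    by (induction xs) (auto simp: tensor_eval[OF lin F] tensor_eval[OF assms(1) F] tensor_eval[OF assms(2) F] algebra_simps)
  then show "F (coaction_op (\<lambda>a. c * p a + d * q a) v) = F (scaleV c (coaction_op p v) + scaleV d (coaction_op q v))"
    by (simp add: functional_coaction_op[OF _ F] lin assms linear_add'[OF F] linear_scale'[OF F])
qed

lemma coaction_op_zero: "coaction_op (\<lambda>a. 0) v = 0"
proof -
  have "functional (\<lambda>a. 0)"
    by (simp add: Vector_Spaces.linear_iff vector_space_axioms vector_space_mult)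
  from coaction_op_combination[OF this this, of 0 0 v] show ?thesis by simp
qed

lemmas act_add = linear_add'[OF act_linear_right] and act_scale = linear_scale'[OF act_linear_right]
  and act_add_left = linear_add'[OF act_linear_left] and act_scale_left = linear_scale'[OF act_linear_left]

lemma act_zero [simp]: "act h 0 = 0" "act 0 v = 0"
  using linear_zero'[OF act_linear_right] linear_zero'[OF act_linear_left] by auto

end

locale suzuki_yd =
  suzuki N n \<mu> lam scale comult counit antipode x +
  yd_module scale comult counit antipode scaleV act coact
  for N n :: nat and \<mu> lam :: "'k::{alg_closed_field, field_char_0}"
    and scale :: "'k \<Rightarrow> 'h::ring_1 \<Rightarrow> 'h"
    and comult :: "'h \<Rightarrow> ('k, 'h, 'h) tensor"
    and counit :: "'h \<Rightarrow> 'k"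
    and antipode :: "'h \<Rightarrow> 'h"
    and x :: "idx \<Rightarrow> idx \<Rightarrow> 'h"
    and scaleV :: "'k \<Rightarrow> 'v::ab_group_add \<Rightarrow> 'v"
    and act :: "'h \<Rightarrow> 'v \<Rightarrow> 'v"
    and coact :: "'v \<Rightarrow> ('k, 'h, 'v) tensor"
begin

section \<open>The Yetter-Drinfeld condition on generators\<close>

lemma functional_sandwich:
  assumes "functional f" shows "functional (\<lambda>a. f (p * a * q))"
  unfolding Vector_Spaces.linear_iff
  by (simp add: vector_space_axioms vector_space_mult distrib_left distrib_right linear_add'[OF assms]
      linear_scale'[OF assms] scale_mult_left[symmetric] scale_mult_right[symmetric])

text \<open>The Yetter-Drinfeld condition with its first leg tested by \<open>f\<close>, the
  iterated coproduct of \<open>x i j\<close> being the sum of all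
  \<open>x i k \<otimes> x k l \<otimes> x l j\<close>.\<close>

lemma coaction_op_act_x:
  assumes f: "functional f"
  shows "coaction_op f (act (x i j) v) = (\<Sum>k\<in>{I1, I2}. \<Sum>l\<in>{I1, I2}.
    act (x k l) (coaction_op (\<lambda>a. f (x i k * a * antipode (x l j))) v))"
proof (rule V.functional_eqI)
  fix F assume F: "Vector_Spaces.linear scaleV (*) F"
  note vs = vector_space_axioms V.vector_space_axioms
  define \<beta>3 where "\<beta>3 = (\<lambda>h1 h2 h3 a u. tensor scale scaleV (h1 * a * antipode h3) (act h2 u))"
  define \<beta>2 where "\<beta>2 = (\<lambda>h1 h2 h3. tensor_lift scale scaleV (\<beta>3 h1 h2 h3) (coact v))"
  note tensor_lin = tensor_add_left tensor_add_right tensor_scale_left tensor_scale_right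
    act_add act_scale
    act_add_left act_scale_left
    linear_add'[OF antipode_linear] linear_scale'[OF antipode_linear]
    distrib_left distrib_right scale_mult_left[symmetric] scale_mult_right[symmetric]
  have b3: "bilin scale scaleV tensor_scale (\<beta>3 h1 h2 h3)" for h1 h2 h3
    unfolding \<beta>3_def by (intro bilinI vs vector_space_tensor_scale) (simp_all add: tensor_lin)
  have b2: "bilin scale scale tensor_scale (\<beta>2 h1)" for h1
    unfolding bilin_def \<beta>2_def
    by (intro conjI allI vs vector_space_tensor_scale linear_lift_param[OF b3 _ coact_in_tensor_space])
      (simp_all add: \<beta>3_def Vector_Spaces.linear_iff vs vector_space_tensor_scale tensor_lin)
  have b1: "bilin scale scale tensor_scale (\<lambda>h1 h'. tensor_lift scale scale (\<beta>2 h1) (comult h'))"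
    unfolding bilin_def
  proof (intro conjI allI vs vector_space_tensor_scale)
    fix h'
    have "Vector_Spaces.linear scale tensor_scale (\<lambda>h1. \<beta>2 h1 a b)" for a b
      unfolding \<beta>2_def
      by (rule linear_lift_param[OF b3 _ coact_in_tensor_space])
        (simp add: \<beta>3_def Vector_Spaces.linear_iff vs vector_space_tensor_scale tensor_lin)
    then show "Vector_Spaces.linear scale tensor_scale (\<lambda>h1. tensor_lift scale scale (\<beta>2 h1) (comult h'))"
      by (rule linear_lift_param[OF b2 _ comult_in_tensor_space])
  next
    fix h1
    show "Vector_Spaces.linear scale tensor_scale (\<lambda>h'. tensor_lift scale scale (\<beta>2 h1) (comult h'))"
      by (rule linear_lift_comp[OF b2 comult_linear comult_in_tensor_space])
  qed
  have cx: "comult (x i j) = (\<Sum>(a, b)\<leftarrow>[(x i I1, x I1 j), (x i I2, x I2 j)]. tensor scale scale a b)" for i j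
    unfolding sum_list_two by (rule comult_x)
  have "coact (act (x i j) v) = tensor_lift scale scale (\<lambda>h1 h'. tensor_lift scale scale (\<beta>2 h1) (comult h')) (comult (x i j))"
    unfolding yetter_drinfeld \<beta>2_def \<beta>3_def ..
  also have "\<dots> = \<beta>2 (x i I1) (x I1 I1) (x I1 j) + \<beta>2 (x i I1) (x I1 I2) (x I2 j) +
      (\<beta>2 (x i I2) (x I2 I1) (x I1 j) + \<beta>2 (x i I2) (x I2 I2) (x I2 j))"
  proof -
    have "tensor_lift scale scale (\<beta>2 h1) (comult (x k j)) = \<beta>2 h1 (x k I1) (x I1 j) + \<beta>2 h1 (x k I2) (x I2 j)" for h1 k
      unfolding cx[of k j] lift_sum_list[OF b2] by (rule sum_list_two)
    moreover have "tensor_lift scale scale (\<lambda>h1 h'. tensor_lift scale scale (\<beta>2 h1) (comult h')) (comult (x i j)) =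
        (\<Sum>(a, b)\<leftarrow>[(x i I1, x I1 j), (x i I2, x I2 j)]. tensor_lift scale scale (\<beta>2 a) (comult b))"
      unfolding cx[of i j] by (rule lift_sum_list[OF b1])
    ultimately show ?thesis unfolding sum_list_two by simp
  qed
  finally have co: "coact (act (x i j) v) f F = (\<Sum>k\<in>{I1, I2}. \<Sum>l\<in>{I1, I2}. \<beta>2 (x i k) (x k l) (x l j) f F)"
    by (simp add: add.assoc)
  have \<beta>: "\<beta>2 h1 h2 h3 f F = F (act h2 (coaction_op (\<lambda>a. f (h1 * a * antipode h3)) v))" for h1 h2 h3
  proof -
    have Fa: "Vector_Spaces.linear scaleV (*) (\<lambda>u. F (act h2 u))"
      using Vector_Spaces.linear_compose[OF act_linear_right F] by (simp add: o_def)
    have fs: "functional (\<lambda>a. f (h1 * a * antipode h3))" by (rule functional_sandwich[OF f])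
    have "\<beta>2 h1 h2 h3 f F = tensor_lift scale scaleV (\<lambda>a u. \<beta>3 h1 h2 h3 a u f F) (coact v)"
      unfolding \<beta>2_def by (rule linear_apply_lift[OF b3 linear_eval coact_in_tensor_space])
    also have "\<dots> = tensor_lift scale scaleV (\<lambda>a u. f (h1 * a * antipode h3) * F (act h2 u)) (coact v)"
      unfolding \<beta>3_def tensor_eval[OF f F] ..
    also have "\<dots> = coact v (\<lambda>a. f (h1 * a * antipode h3)) (\<lambda>u. F (act h2 u))"
      by (rule tensor_space_eval[OF vs coact_in_tensor_space fs Fa, symmetric])
    also have "\<dots> = F (act h2 (coaction_op (\<lambda>a. f (h1 * a * antipode h3)) v))"
      by (rule functional_coaction_op[OF fs Fa, symmetric])
    finally show ?thesis .
  qed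
  show "F (coaction_op f (act (x i j) v)) = F (\<Sum>k\<in>{I1, I2}. \<Sum>l\<in>{I1, I2}.
    act (x k l) (coaction_op (\<lambda>a. f (x i k * a * antipode (x l j))) v))"
    unfolding functional_coaction_op[OF f F] co \<beta> linear_sum'[OF F] ..
qed

section \<open>Degrees, parity and the operator \<open>T\<close>\<close>

definition deg :: "'h \<Rightarrow> 'v \<Rightarrow> bool"
  where "deg g v \<longleftrightarrow> g \<in> grp \<and> coaction_op (\<phi> g) v = v"

definition par :: "bool \<Rightarrow> 'v \<Rightarrow> bool"
  where "par b v \<longleftrightarrow> act (E b) v = v"

text \<open>Summing over the finite group gives one operator \<open>T\<close> for all degrees; on
  degree \<open>g\<close> only the summand \<open>\<psi> g\<close> acts.\<close>

definition \<Psi> :: "'h \<Rightarrow> 'k"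
  where "\<Psi> a = (\<Sum>g\<in>grp. \<psi> g a)"

definition T :: "'v \<Rightarrow> 'v"
  where "T = coaction_op \<Psi>"

lemma \<Psi>_linear: "functional \<Psi>"
  unfolding Vector_Spaces.linear_iff \<Psi>_def
  by (simp add: vector_space_axioms vector_space_mult linear_add'[OF \<psi>_linear] linear_scale'[OF \<psi>_linear]
      sum.distrib sum_distrib_left)

lemma T_linear: "Vector_Spaces.linear scaleV scaleV T"
  unfolding T_def by (rule coaction_op_linear[OF \<Psi>_linear])

lemma \<psi>_zero: "E True = 0 \<Longrightarrow> \<psi> g a = 0"
  using linear_zero'[OF convolution_linear[OF \<phi>_linear \<chi>(1)]] by (simp add: \<psi>_def)

lemma T_zero: "E True = 0 \<Longrightarrow> T v = 0"
  using coaction_op_zero by (simp add: T_def \<Psi>_def[abs_def] \<psi>_zero)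

lemma \<Psi>_Z_False: "\<Psi> (Z False W) = 0"
  by (simp add: \<Psi>_def \<psi>_Z_False)

lemma \<Psi>_grp: "g \<in> grp \<Longrightarrow> \<Psi> g = 0"
  by (auto simp: grp_def \<Psi>_Z_False)

lemma \<Psi>_cc: "E True \<noteq> 0 \<Longrightarrow> g \<in> grp \<Longrightarrow> \<Psi> (cc g) = 1"
  using finite_grp by (simp add: \<Psi>_def \<psi>_cc)

lemma coaction_op_deg':
  assumes "deg g v" "functional f"
  shows "coaction_op f v = scaleV (f g) v + scaleV (f (cc g)) (coaction_op (\<psi> g) v)"
proof -
  have g: "g \<in> grp" "coaction_op (\<phi> g) v = v" using assms(1) by (auto simp: deg_def)
  have "coaction_op f v = coaction_op f (coaction_op (\<phi> g) v)" by (simp add: g)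
  also have "\<dots> = coaction_op (\<lambda>a. f g * \<phi> g a + f (cc g) * \<psi> g a) v"
    by (simp add: coaction_op_convolution[OF \<phi>_linear assms(2)] convolution_\<phi>[OF assms(2) g(1)])
  also have "\<dots> = scaleV (f g) v + scaleV (f (cc g)) (coaction_op (\<psi> g) v)"
    by (simp add: coaction_op_combination[OF \<phi>_linear \<psi>_linear] g)
  finally show ?thesis .
qed

lemma T_deg: "deg g v \<Longrightarrow> T v = coaction_op (\<psi> g) v"
proof (cases "E True = 0")
  case True
  then have "\<psi> g = (\<lambda>a. 0)" using \<psi>_zero by blast
  then show ?thesis using True coaction_op_zero by (simp add: T_zero)
next
  case False
  assume g: "deg g v"
  then have "g \<in> grp" by (simp add: deg_def)
  then show ?thesis
    using coaction_op_deg'[OF g \<Psi>_linear] False by (simp add: T_def \<Psi>_grp \<Psi>_cc)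
qed

lemma coaction_op_deg:
  "deg g v \<Longrightarrow> functional f \<Longrightarrow> coaction_op f v = scaleV (f g) v + scaleV (f (cc g)) (T v)"
  using coaction_op_deg' T_deg by simp

lemma swap_grp: "swap g \<in> grp"
  by (simp add: swap_def)

lemma deg_T: "deg g v \<Longrightarrow> deg (swap g) (T v)"
proof -
  assume g: "deg g v"
  then have gg: "g \<in> grp" by (simp add: deg_def)
  have "coaction_op (\<phi> (swap g)) (T v) = T v"
    unfolding T_deg[OF g] coaction_op_convolution[OF \<psi>_linear \<phi>_linear]
    by (simp add: convolution_\<psi>_\<phi>[OF gg])
  then show ?thesis by (simp add: deg_def swap_grp)
qed

lemma T_T:
  assumes gg: "g \<in> grp" and E: "E True \<noteq> 0"
  shows "\<exists>\<alpha>. \<alpha> \<noteq> 0 \<and> (\<forall>v. deg g v \<longrightarrow> T (T v) = scaleV \<alpha> v)"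
proof -
  obtain \<alpha> where \<alpha>: "\<alpha> \<noteq> 0" "convolution (\<psi> g) (\<psi> (swap g)) = (\<lambda>a. \<alpha> * \<phi> g a)"
    using convolution_\<psi>_\<psi>[OF gg E] by blast
  have "T (T v) = scaleV \<alpha> v" if g: "deg g v" for v
  proof -
    have gv: "coaction_op (\<phi> g) v = v" using g by (simp add: deg_def)
    have "T (T v) = coaction_op (\<psi> (swap g)) (coaction_op (\<psi> g) v)"
      using T_deg[OF deg_T[OF g]] T_deg[OF g] by simp
    also have "\<dots> = coaction_op (\<lambda>a. \<alpha> * \<phi> g a + 0 * \<phi> g a) v"
      by (simp add: coaction_op_convolution[OF \<psi>_linear \<psi>_linear] \<alpha>(2))
    also have "\<dots> = scaleV \<alpha> v"
      unfolding coaction_op_combination[OF \<phi>_linear \<phi>_linear] gv by simp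
    finally show ?thesis .
  qed
  then show ?thesis using \<alpha>(1) by blast
qed

lemma deg_unique: "deg g v \<Longrightarrow> h \<in> grp \<Longrightarrow> coaction_op (\<phi> h) v = (if h = g then v else 0)"
proof -
  assume g: "deg g v" and h: "h \<in> grp"
  then obtain W where W: "g = Z False W" by (auto simp: deg_def grp_def)
  have "\<phi> h g = (if h = g then 1 else 0)" "\<phi> h (cc g) = 0" by (auto simp: W cc_def \<phi>_Z)
  then show ?thesis using coaction_op_deg[OF g \<phi>_linear, of h] by simp
qed

lemma antipode_x: "antipode (x i j) = E (i \<noteq> j) * yinv j"
proof -
  have "antipode (x i j) = x j i ^ (4 * N - 1)" by (rule antipode_gen)
  also have "\<dots> = E (j \<noteq> i) * yinv j" unfolding yinv_def by (rule x_power) (use N in simp)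
  finally show ?thesis by (simp add: eq_commute)
qed

lemma act_x_par:
  assumes "par b v"
  shows "act (x k l) v = (if l = flip_if b k then act (y k) v else 0)"
proof -
  have "act (x k l) v = act (x k l * E b) v"
    using assms by (simp add: par_def act_mult)
  moreover have "act (y k) v = act (y k * E b) v"
    using assms by (simp add: par_def act_mult)
  moreover have "(k \<noteq> l) = b \<longleftrightarrow> l = flip_if b k"
    by (cases k; cases l; cases b) auto
  ultimately show ?thesis by (auto simp: x_mult_E y_mult_E)
qed

lemma sandwich_E: "(E b * p) * a * (E c * q) = (if b = c then E b * (p * a * q) else 0)"
proof -
  have "(E b * p) * a * (E c * q) = E b * ((p * a) * E c) * q" by (simp only: mult.assoc)
  also have "(p * a) * E c = E c * (p * a)" by (rule E_central[symmetric])
  also have "E b * (E c * (p * a)) * q = (E b * E c) * (p * a * q)" by (simp only: mult.assoc)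
  finally show ?thesis by (simp add: E_E)
qed

lemma par_act_E: "par b (act (E b) v)"
  by (simp add: par_def act_mult[symmetric] E_E)

lemma par_act: "par b v \<Longrightarrow> par b (act h v)"
  unfolding par_def by (metis E_central act_mult)

text \<open>\<open>e V\<close> and \<open>f V\<close> are subcomodules. The vector is written as
  \<open>x I1 j\<close> applied to \<open>w\<close>; in the resulting Yetter-Drinfeld sum, the
  factors around \<open>a\<close> carry orthogonal idempotents unless \<open>x k l\<close> has
  parity \<open>b\<close>.\<close>

lemma par_coaction_op:
  assumes v: "par b v" and f: "functional f"
  shows "par b (coaction_op f v)"
proof -
  \<comment> \<open>\<open>j\<close> is chosen so that \<open>x I1 j\<close> lies in the ideal of
    \<open>E b\<close>, where it is invertible with inverse \<open>E b * yinv I1\<close>.\<close>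
  define j where "j = flip_if b I1"
  define w where "w = act (yinv I1) v"
  have "E b = x I1 j * yinv I1"
    by (simp add: j_def E_mult_y[symmetric] mult.assoc y_yinv)
  then have v_eq: "v = act (x I1 j) w"
    using v by (simp add: par_def w_def act_mult)
  have "par b (act (x k l) (coaction_op (\<lambda>a. f (x I1 k * a * antipode (x l j))) w))" for k l
  proof (cases "(I1 \<noteq> k) = (l \<noteq> j)")
    case True
    then have "(k \<noteq> l) = b" unfolding j_def by (cases k; cases l; cases b) auto
    then have "x k l = E b * x k l" by (simp add: E_mult_x)
    then show ?thesis by (metis act_mult par_act_E)
  next
    case False
    then have "x I1 k * a * antipode (x l j) = 0" for a
      unfolding antipode_x x_eq[of I1 k] by (simp add: sandwich_E)
    then have "coaction_op (\<lambda>a. f (x I1 k * a * antipode (x l j))) w = 0"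
      using coaction_op_zero linear_zero'[OF f] by simp
    then show ?thesis by (simp add: par_def)
  qed
  note p = this
  have sum: "par b (\<Sum>k\<in>A. g k)" if "\<And>k. par b (g k)" for A :: "idx set" and g
    using that unfolding par_def by (simp add: linear_sum'[OF act_linear_right])
  show ?thesis
    unfolding v_eq coaction_op_act_x[OF f] by (intro sum p)
qed

text \<open>On parity \<open>b\<close> the index \<open>l\<close> is determined by \<open>k\<close>.
  The summand \<open>k = i\<close> carries \<open>E False\<close> and sees only \<open>g\<close>;
  the summand \<open>k = flip i\<close> carries \<open>E True\<close> and sees only
  \<open>cc g\<close>, which explains the letter \<open>y (flip i)\<close> in front of
  \<open>T v\<close>.\<close>

lemma coaction_op_act_y:
  assumes v: "par b v" "deg g v" and f: "functional f"
  shows "coaction_op f (act (y i) v) =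
    scaleV (f (y i * g * yinv (flip_if b i))) (act (y i) v) +
    scaleV (f (y i * cc g * yinv (flip_if b i))) (act (y (flip i)) (T v))"
proof -
  define j where "j = flip_if b i"
  define u where "u = (\<lambda>k. coaction_op (\<lambda>a. f (x i k * a * antipode (x (flip_if b k) j))) v)"
  have "coaction_op f (act (y i) v) = coaction_op f (act (x i j) v)"
    using act_x_par[OF v(1), of i j] by (simp add: j_def)
  also have "\<dots> = (\<Sum>k\<in>{I1, I2}. \<Sum>l\<in>{I1, I2}. if l = flip_if b k then act (y k) (u k) else 0)"
    unfolding coaction_op_act_x[OF f] u_def
    by (intro sum.cong refl) (simp add: act_x_par[OF par_coaction_op[OF v(1) functional_sandwich[OF f]]])
  also have "\<dots> = (\<Sum>k\<in>{I1, I2}. act (y k) (u k))"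
  proof (rule sum.cong[OF refl])
    fix k
    have "flip_if b k \<in> {I1, I2}" by (cases "flip_if b k") auto
    then show "(\<Sum>l\<in>{I1, I2}. if l = flip_if b k then act (y k) (u k) else 0) = act (y k) (u k)"
      by (subst sum.delta) auto
  qed
  also have "\<dots> = act (y i) (u i) + act (y (flip i)) (u (flip i))"
    by (cases i) (auto simp: add.commute)
  finally have *: "coaction_op f (act (y i) v) = act (y i) (u i) + act (y (flip i)) (u (flip i))" .
  have gg: "g \<in> grp" using v by (simp add: deg_def)
  have uk: "u k = scaleV (f (E (i \<noteq> k) * (y i * g * yinv j))) v +
      scaleV (f (E (i \<noteq> k) * (y i * cc g * yinv j))) (T v)" for k
  proof -
    have "(i \<noteq> k) = (flip_if b k \<noteq> j)" unfolding j_def by (cases i; cases k; cases b) auto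
    then have "x i k * a * antipode (x (flip_if b k) j) = E (i \<noteq> k) * (y i * a * yinv j)" for a
      unfolding antipode_x x_eq[of i k] sandwich_E by simp
    then show ?thesis
      unfolding u_def using coaction_op_deg[OF v(2) functional_sandwich[OF f]] by metis
  qed
  have E_in: "E c * (y i * h * yinv j) = y i * (E c * h) * yinv j" for c h
  proof -
    have "E c * (y i * h * yinv j) = (E c * y i) * (h * yinv j)" by (simp only: mult.assoc)
    also have "E c * y i = y i * E c" by (rule E_central)
    finally show ?thesis by (simp only: mult.assoc)
  qed
  have "E False * g = g" "E True * g = 0" "E False * cc g = 0" "E True * cc g = cc g"
    using gg by (auto simp: grp_def cc_def E_mult_Z)
  then have "u i = scaleV (f (y i * g * yinv j)) v" "u (flip i) = scaleV (f (y i * cc g * yinv j)) (T v)"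
    unfolding uk E_in using linear_zero'[OF f] by simp_all
  then show ?thesis
    unfolding * j_def[symmetric] by (simp add: act_scale)
qed

text \<open>The new degree is \<open>g\<close> conjugated with a twist: \<open>y i\<close> on the
  left, the inverse of \<open>y (flip_if b i)\<close> on the right. The scalar
  \<open>\<kappa>\<close> compares the twisted conjugate of \<open>cc g\<close> with the reference
  element \<open>cc g'\<close>, and the same \<open>\<kappa>\<close> appears when \<open>T\<close>
  passes \<open>y i\<close>.\<close>

lemma act_y_homogeneous:
  assumes gg: "g \<in> grp"
  shows "\<exists>g' \<kappa>. g' \<in> grp \<and> \<kappa> \<noteq> 0 \<and>
    y i * g = g' * y (flip_if b i) \<and> y i * cc g = scale \<kappa> (cc g' * y (flip_if b i)) \<and>
    (\<forall>v. par b v \<and> deg g v \<longrightarrow>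
      deg g' (act (y i) v) \<and> T (act (y i) v) = scaleV \<kappa> (act (y (flip i)) (T v)))"
proof -
  define j where "j = flip_if b i"
  \<comment> \<open>A word for the twisted conjugate, the inverse letter being spelled as a
    power.\<close>
  define W where "W = i # word g @ replicate (4 * N - 1) j"
  define g' where "g' = Z False W"
  have Zc: "Z c W = y i * Z c (word g) * yinv j" for c
    unfolding W_def yinv_def yw_replicate[symmetric] y_mult_Z Z_mult_yw by simp
  have g': "y i * g * yinv j = g'" "g' \<in> grp"
  proof -
    show "y i * g * yinv j = g'" using Zc[of False] unfolding Z_word[OF gg] g'_def by (rule sym)
    show "g' \<in> grp" unfolding g'_def by (rule Z_grp)
  qed
  obtain \<kappa> where \<kappa>: "\<kappa> \<noteq> 0" "y i * cc g * yinv j = scale \<kappa> (cc g')"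
    using Z_True_cc[of W] Zc[of True] by (auto simp: g'_def cc_def)
  have "deg g' (act (y i) v) \<and> T (act (y i) v) = scaleV \<kappa> (act (y (flip i)) (T v))"
    if v: "par b v" "deg g v" for v
  proof
    have "coaction_op (\<phi> g') (act (y i) v) = act (y i) v"
    proof -
      have "\<phi> g' g' = 1" "\<phi> g' (cc g') = 0" by (auto simp: g'_def cc_def \<phi>_Z)
      then show ?thesis
        unfolding coaction_op_act_y[OF v \<phi>_linear] j_def[symmetric] g' \<kappa>
        by (simp add: linear_scale'[OF \<phi>_linear])
    qed
    then show "deg g' (act (y i) v)" using g' by (simp add: deg_def)
    show "T (act (y i) v) = scaleV \<kappa> (act (y (flip i)) (T v))"
    proof (cases "E True = 0")
      case True
      then show ?thesis by (simp add: T_zero)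
    next
      case False
      have "T (act (y i) v) = coaction_op \<Psi> (act (y i) v)" by (simp add: T_def)
      also have "\<dots> = scaleV \<kappa> (act (y (flip i)) (T v))"
        unfolding coaction_op_act_y[OF v \<Psi>_linear] j_def[symmetric] g'(1) \<kappa>
        by (simp add: linear_scale'[OF \<Psi>_linear] \<Psi>_grp[OF g'(2)] \<Psi>_cc[OF False g'(2)])
      finally show ?thesis .
    qed
  qed
  moreover have "y i * g = g' * y j" "y i * cc g = scale \<kappa> (cc g' * y j)"
  proof -
    have "h = h * yinv j * y j" for h by (simp add: mult.assoc yinv_y)
    from this[of "y i * g"] this[of "y i * cc g"]
    show "y i * g = g' * y j" "y i * cc g = scale \<kappa> (cc g' * y j)"
      unfolding g'(1) \<kappa>(2) scale_mult_left by simp_all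
  qed
  ultimately show ?thesis using \<kappa>(1) g'(2) unfolding j_def by blast
qed

text \<open>Letter by letter; the scalars multiply, and their product still serves both for the
  \<open>f\<close>-parts and for the passage of \<open>T\<close>.\<close>

lemma act_yw_homogeneous:
  assumes gg: "g \<in> grp"
  shows "\<exists>g' \<kappa>. g' \<in> grp \<and> \<kappa> \<noteq> 0 \<and>
    Z False W * g = g' * Z False (flips b W) \<and> Z True W * cc g = scale \<kappa> (cc g' * Z True (flips b W)) \<and>
    (\<forall>v. par b v \<and> deg g v \<longrightarrow>
      deg g' (act (yw W) v) \<and> T (act (yw W) v) = scaleV \<kappa> (act (yw (map flip W)) (T v)))"
proof (induction W)
  case Nil
  have "E False * g = g * E False" "E True * cc g = scale 1 (cc g * E True)"
    by (simp_all add: E_central)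
  then show ?case
    using gg by (intro exI[of _ g] exI[of _ 1]) (simp add: act_one Z_def)
next
  case (Cons i W)
  then obtain g1 \<kappa>1 where 1: "g1 \<in> grp" "\<kappa>1 \<noteq> 0"
    "Z False W * g = g1 * Z False (flips b W)" "Z True W * cc g = scale \<kappa>1 (cc g1 * Z True (flips b W))"
    and IH1: "\<And>v. par b v \<Longrightarrow> deg g v \<Longrightarrow> deg g1 (act (yw W) v)"
    "\<And>v. par b v \<Longrightarrow> deg g v \<Longrightarrow> T (act (yw W) v) = scaleV \<kappa>1 (act (yw (map flip W)) (T v))"
    by blast
  obtain g2 \<kappa>2 where 2: "g2 \<in> grp" "\<kappa>2 \<noteq> 0"
    "y i * g1 = g2 * y (flip_if b i)" "y i * cc g1 = scale \<kappa>2 (cc g2 * y (flip_if b i))"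
    and st2: "\<And>v. par b v \<Longrightarrow> deg g1 v \<Longrightarrow> deg g2 (act (y i) v)"
    "\<And>v. par b v \<Longrightarrow> deg g1 v \<Longrightarrow> T (act (y i) v) = scaleV \<kappa>2 (act (y (flip i)) (T v))"
    using act_y_homogeneous[OF 1(1)] by blast
  have "Z False (i # W) * g = y i * (Z False W * g)"
    by (simp add: y_mult_Z[symmetric] mult.assoc)
  also have "\<dots> = (y i * g1) * Z False (flips b W)" by (simp add: 1 mult.assoc)
  also have "\<dots> = g2 * Z False (flips b (i # W))" by (simp add: 2 mult.assoc y_mult_Z)
  finally have F: "Z False (i # W) * g = g2 * Z False (flips b (i # W))" .
  have "Z True (i # W) * cc g = y i * (Z True W * cc g)"
    by (simp add: y_mult_Z[symmetric] mult.assoc)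
  also have "\<dots> = scale \<kappa>1 ((y i * cc g1) * Z True (flips b W))"
    by (simp add: 1 mult.assoc scale_mult_right)
  also have "\<dots> = scale (\<kappa>1 * \<kappa>2) (cc g2 * Z True (flips b (i # W)))"
    unfolding 2(4) scale_mult_left[symmetric] by (simp add: mult.assoc y_mult_Z)
  finally have T: "Z True (i # W) * cc g = scale (\<kappa>1 * \<kappa>2) (cc g2 * Z True (flips b (i # W)))" .
  have "deg g2 (act (yw (i # W)) v) \<and>
      T (act (yw (i # W)) v) = scaleV (\<kappa>1 * \<kappa>2) (act (yw (map flip (i # W))) (T v))"
    if v: "par b v" "deg g v" for v
    using IH1[OF v] st2[OF par_act[OF v(1)] IH1(1)[OF v]]
    by (simp add: act_mult act_scale mult.commute)
  then show ?case
    using F T 1(2) 2(1,2) by (intro exI[of _ g2] exI[of _ "\<kappa>1 * \<kappa>2"]) simp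
qed

lemma coact_deg:
  assumes "deg g v"
  shows "coact v = tensor scale scaleV g v + tensor scale scaleV (cc g) (T v)"
proof (rule tensor_space_eqI[OF coact_in_tensor_space tensor_space_add[OF tensor_in_space tensor_in_space]])
  fix f F assume f: "functional f" and F: "Vector_Spaces.linear scaleV (*) F"
  show "coact v f F = (tensor scale scaleV g v + tensor scale scaleV (cc g) (T v)) f F"
    unfolding functional_coaction_op[OF f F, symmetric] coaction_op_deg[OF assms f]
    by (simp add: linear_add'[OF F] linear_scale'[OF F] tensor_eval[OF f F])
qed

lemma act_Z_par: "par c w \<Longrightarrow> act (Z b W) w = (if b = c then act (yw W) w else 0)"
proof -
  assume w: "par c w"
  then have "act (Z b W) w = act (Z b W * E c) w" by (simp add: par_def act_mult)
  also have "Z b W * E c = (E b * E c) * yw W" by (simp add: Z_def mult.assoc yw_mult_E)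
  also have "act \<dots> w = (if b = c then act (yw W * E c) w else 0)"
    by (simp add: E_E yw_mult_E)
  also have "act (yw W * E c) w = act (yw W) w" using w by (simp add: par_def act_mult)
  finally show ?thesis .
qed

text \<open>Of the two terms of the coaction, \<open>g\<close> annihilates \<open>f V\<close> and
  \<open>cc g\<close> annihilates \<open>e V\<close>, so the braiding of a homogeneous pair is a
  pure tensor.\<close>

lemma braiding_homogeneous:
  assumes "deg g v" "par c w"
  shows "yd_braiding scale scaleV act coact (tensor scaleV scaleV v w) =
    tensor scaleV scaleV (act (yw (word g)) w) (if c then T v else v)"
proof -
  note vs = vector_space_axioms V.vector_space_axioms
  have g: "g = Z False (word g)" using assms(1) by (simp add: deg_def Z_word)
  note tensor_lin = tensor_add_left tensor_add_right tensor_scale_left tensor_scale_right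
    act_add act_scale
    act_add_left act_scale_left
  have b2: "bilin scale scaleV tensor_scale (\<lambda>h u. tensor scaleV scaleV (act h w) u)" for w
    by (intro bilinI vs vector_space_tensor_scale) (simp_all add: tensor_lin)
  have b1: "bilin scaleV scaleV tensor_scale
      (\<lambda>v w. tensor_lift scale scaleV (\<lambda>h u. tensor scaleV scaleV (act h w) u) (coact v))"
    unfolding bilin_def
  proof (intro conjI allI vs vector_space_tensor_scale)
    fix w show "Vector_Spaces.linear scaleV tensor_scale
        (\<lambda>v. tensor_lift scale scaleV (\<lambda>h u. tensor scaleV scaleV (act h w) u) (coact v))"
      by (rule linear_lift_comp[OF b2 coact_linear coact_in_tensor_space])
  next
    fix v show "Vector_Spaces.linear scaleV tensor_scale
        (\<lambda>w. tensor_lift scale scaleV (\<lambda>h u. tensor scaleV scaleV (act h w) u) (coact v))"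
      by (rule linear_lift_param[OF b2 _ coact_in_tensor_space])
        (simp add: Vector_Spaces.linear_iff vs vector_space_tensor_scale tensor_lin)
  qed
  have "yd_braiding scale scaleV act coact (tensor scaleV scaleV v w) =
      tensor scaleV scaleV (act g w) v + tensor scaleV scaleV (act (cc g) w) (T v)"
    unfolding yd_braiding_def lift_tensor[OF b1] coact_deg[OF assms(1)]
      lift_add[OF b2 tensor_in_space tensor_in_space] lift_tensor[OF b2] ..
  moreover have "act g w = (if c then 0 else act (yw (word g)) w)"
    by (subst g) (simp add: act_Z_par[OF assms(2)])
  moreover have "act (cc g) w = (if c then act (yw (word g)) w else 0)"
    by (simp add: cc_def act_Z_par[OF assms(2)])
  ultimately show ?thesis by (simp add: tensor_zero_left)
qed

end

section \<open>Braided vector spaces with a monomial braiding\<close>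

lemma (in vector_space) scaled_basis_vectors_eq:
  assumes "independent (w ` X)" "inj_on w X" "p \<in> X" "q \<in> X" "a \<noteq> 0" "scale a (w p) = scale b (w q)"
  shows "p = q \<and> a = b"
proof -
  have rep: "representation (w ` X) (w r) = (\<lambda>v. if v = w r then 1 else 0)" if "r \<in> X" for r
    using that by (intro representation_basis assms) auto
  have sc: "representation (w ` X) (scale c (w r)) (w p) = c * representation (w ` X) (w r) (w p)" if "r \<in> X" for c r
    using representation_scale[OF assms(1) span_base, of "w r"] that by auto
  have "a * 1 = b * (if w p = w q then 1 else 0)"
    using sc[OF assms(3), of a] sc[OF assms(4), of b] assms(6) rep[OF assms(3)] rep[OF assms(4)] by simp
  then have "w p = w q" "a = b" using assms(5) by (auto split: if_splits)
  then show ?thesis using assms by (auto dest: inj_onD)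
qed

lemma (in ac_vector_space) monomial_permutation:
  assumes basis: "inj_on w X" "independent (w ` X)" "finite X"
    and f: "monomial_on (w ` X) f"
    and inj: "\<And>i j a b. i \<in> X \<Longrightarrow> j \<in> X \<Longrightarrow> a \<noteq> 0 \<Longrightarrow> a *s f (w i) = b *s f (w j) \<Longrightarrow> i = j"
  shows "\<exists>\<pi> a. bij_betw \<pi> X X \<and> (\<forall>i\<in>X. a i \<noteq> 0 \<and> f (w i) = a i *s w (\<pi> i))"
proof -
  have "\<forall>i\<in>X. \<exists>j a. j \<in> X \<and> a \<noteq> 0 \<and> f (w i) = a *s w j"
    using f by (simp add: monomial_on_def) blast
  then obtain \<pi> a where \<pi>: "\<And>i. i \<in> X \<Longrightarrow> \<pi> i \<in> X" "\<And>i. i \<in> X \<Longrightarrow> a i \<noteq> 0 \<and> f (w i) = a i *s w (\<pi> i)"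
    by metis
  have "inj_on \<pi> X"
  proof (rule inj_onI)
    fix i j assume ij: "i \<in> X" "j \<in> X" "\<pi> i = \<pi> j"
    then have "a j *s f (w i) = a i *s f (w j)" using \<pi>(2) by (simp add: mult.commute)
    then show "i = j" using inj ij \<pi>(2) by blast
  qed
  moreover from this have "\<pi> ` X = X" using \<pi>(1) by (intro endo_inj_surj basis(3)) auto
  ultimately show ?thesis using \<pi>(2) unfolding bij_betw_def by blast
qed

text \<open>The permutation \<open>\<tau> j\<close> depends on \<open>j\<close> only through the
  parity \<open>\<epsilon> j\<close>, which all maps preserve. Given this, \<open>compat\<close> on
  basis vectors yields both conditions at once: its indices give the Yang-Baxter equation, its
  coefficients the equation for \<open>R\<close>.\<close>

lemma set_theoretical_typeI:
  fixes scaleV :: "'k::field \<Rightarrow> 'v::ab_group_add \<Rightarrow> 'v" and X :: "nat set" and \<sigma> :: "nat \<Rightarrow> nat \<Rightarrow> nat"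
    and t :: "nat \<Rightarrow> nat" and \<epsilon> :: "nat \<Rightarrow> bool" and Y :: "nat \<Rightarrow> 'v \<Rightarrow> 'v"
    and T :: "'v \<Rightarrow> 'v"
  defines "\<tau> \<equiv> \<lambda>j i. if \<epsilon> j then t i else i"
    and "\<T> \<equiv> \<lambda>b v. if b then T v else v"
  assumes V: "vector_space scaleV" and X: "finite X" "card X \<ge> 2"
    and basis: "inj_on w X" "\<not> module.dependent scaleV (w ` X)" "module.span scaleV (w ` X) = UNIV"
    and braid: "\<And>i j. i \<in> X \<Longrightarrow> j \<in> X \<Longrightarrow>
      c (tensor scaleV scaleV (w i) (w j)) = tensor scaleV scaleV (Y i (w j)) (\<T> (\<epsilon> j) (w i))"
    and linY: "\<And>i. Vector_Spaces.linear scaleV scaleV (Y i)"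
    and linT: "Vector_Spaces.linear scaleV scaleV T"
    and Y: "\<And>i j. i \<in> X \<Longrightarrow> j \<in> X \<Longrightarrow> A i j \<noteq> 0 \<and> Y i (w j) = scaleV (A i j) (w (\<sigma> i j))"
    and \<sigma>: "\<And>i. i \<in> X \<Longrightarrow> bij_betw (\<sigma> i) X X" "\<And>i j. i \<in> X \<Longrightarrow> j \<in> X \<Longrightarrow> \<epsilon> (\<sigma> i j) = \<epsilon> j"
    and T: "\<And>i. i \<in> X \<Longrightarrow> \<theta> i \<noteq> 0 \<and> T (w i) = scaleV (\<theta> i) (w (t i))"
    and t: "bij_betw t X X" "\<And>i. i \<in> X \<Longrightarrow> \<epsilon> (t i) = \<epsilon> i"
    and compat: "\<And>i j k. i \<in> X \<Longrightarrow> j \<in> X \<Longrightarrow> k \<in> X \<Longrightarrow> \<exists>\<kappa>. \<kappa> \<noteq> 0 \<and>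
      \<T> (\<epsilon> k) (Y i (w j)) = scaleV \<kappa> (Y (\<tau> k i) (\<T> (\<epsilon> k) (w j))) \<and>
      Y i (Y j (w k)) = scaleV \<kappa> (Y (\<sigma> i j) (Y (\<tau> j i) (w k)))"
  shows "set_theoretical_type scaleV c"
proof -
  interpret V: vector_space scaleV by fact
  define \<Theta> where "\<Theta> = (\<lambda>i j. if \<epsilon> j then \<theta> i else 1)"
  define R where "R = (\<lambda>i j. A i j * \<Theta> i j)"
  define r where "r = (\<lambda>(i, j). (\<sigma> i j, \<tau> j i))"
  have \<sigma>X: "\<sigma> i j \<in> X" if "i \<in> X" "j \<in> X" for i j
    using \<sigma>(1)[OF that(1)] that(2) by (auto dest: bij_betwE)
  have tX: "t i \<in> X" if "i \<in> X" for i using t(1) that by (auto dest: bij_betwE)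
  have \<tau>X: "\<tau> j i \<in> X" if "i \<in> X" for i j using that tX by (simp add: \<tau>_def)
  have \<tau>_bij: "bij_betw (\<tau> j) X X" for j
    unfolding \<tau>_def using t(1) by (cases "\<epsilon> j") (auto simp: bij_betw_def inj_on_def)
  have \<epsilon>\<tau>: "\<epsilon> (\<tau> j i) = \<epsilon> i" if "i \<in> X" for i j using that t(2) by (simp add: \<tau>_def)
  have \<tau>_cong: "\<tau> j = \<tau> k" if "\<epsilon> j = \<epsilon> k" for j k using that by (simp add: \<tau>_def)
  have \<Theta>_cong: "\<Theta> i j = \<Theta> i k" if "\<epsilon> j = \<epsilon> k" for i j k using that by (simp add: \<Theta>_def)
  have \<tau>_comm: "\<tau> k (\<tau> j i) = \<tau> j (\<tau> k i)" for i j k by (simp add: \<tau>_def)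
  have \<Theta>_comm: "\<Theta> i j * \<Theta> (\<tau> j i) k = \<Theta> i k * \<Theta> (\<tau> k i) j" for i j k
    by (simp add: \<Theta>_def \<tau>_def)
  have A: "A i j \<noteq> 0" if "i \<in> X" "j \<in> X" for i j using Y that by blast
  have \<Theta>: "\<Theta> i j \<noteq> 0" if "i \<in> X" for i j using T that by (simp add: \<Theta>_def)
  have \<T>w: "\<T> (\<epsilon> j) (w i) = scaleV (\<Theta> i j) (w (\<tau> j i))" if "i \<in> X" for i j
    using T[OF that] by (simp add: \<T>_def \<Theta>_def \<tau>_def)
  have lin\<T>: "\<T> b (scaleV a v) = scaleV a (\<T> b v)" for a b v
    by (simp add: \<T>_def linear_scale'[OF linT])
  \<comment> \<open>Both sides of each identity in \<open>compat\<close> are multiples of basis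
    vectors, so vectors and coefficients can be compared separately, keeping the common
    \<open>\<kappa>\<close>.\<close>
  have key: "\<sigma> (\<sigma> i j) (\<sigma> (\<tau> j i) k) = \<sigma> i (\<sigma> j k) \<and> \<tau> k (\<sigma> i j) = \<sigma> (\<tau> k i) (\<tau> k j) \<and>
      (\<exists>\<kappa>. \<kappa> \<noteq> 0 \<and> A i j * \<Theta> (\<sigma> i j) k = \<kappa> * (\<Theta> j k * A (\<tau> k i) (\<tau> k j)) \<and>
        A j k * A i (\<sigma> j k) = \<kappa> * (A (\<tau> j i) k * A (\<sigma> i j) (\<sigma> (\<tau> j i) k)))"
    if ijk: "i \<in> X" "j \<in> X" "k \<in> X" for i j k
  proof -
    obtain \<kappa> where \<kappa>: "\<kappa> \<noteq> 0" "\<T> (\<epsilon> k) (Y i (w j)) = scaleV \<kappa> (Y (\<tau> k i) (\<T> (\<epsilon> k) (w j)))"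
      "Y i (Y j (w k)) = scaleV \<kappa> (Y (\<sigma> i j) (Y (\<tau> j i) (w k)))"
      using compat[OF ijk] by blast
    have "\<T> (\<epsilon> k) (Y i (w j)) = scaleV (A i j * \<Theta> (\<sigma> i j) k) (w (\<tau> k (\<sigma> i j)))"
      using ijk by (simp add: Y lin\<T> \<T>w \<sigma>X)
    moreover have "scaleV \<kappa> (Y (\<tau> k i) (\<T> (\<epsilon> k) (w j))) =
        scaleV (\<kappa> * (\<Theta> j k * A (\<tau> k i) (\<tau> k j))) (w (\<sigma> (\<tau> k i) (\<tau> k j)))"
      using ijk by (simp add: \<T>w linear_scale'[OF linY] Y \<tau>X)
    ultimately have 1: "scaleV (A i j * \<Theta> (\<sigma> i j) k) (w (\<tau> k (\<sigma> i j))) =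
        scaleV (\<kappa> * (\<Theta> j k * A (\<tau> k i) (\<tau> k j))) (w (\<sigma> (\<tau> k i) (\<tau> k j)))"
      using \<kappa>(2) by simp
    have "Y i (Y j (w k)) = scaleV (A j k * A i (\<sigma> j k)) (w (\<sigma> i (\<sigma> j k)))"
      using ijk by (simp add: Y linear_scale'[OF linY] \<sigma>X)
    moreover have "scaleV \<kappa> (Y (\<sigma> i j) (Y (\<tau> j i) (w k))) =
        scaleV (\<kappa> * (A (\<tau> j i) k * A (\<sigma> i j) (\<sigma> (\<tau> j i) k))) (w (\<sigma> (\<sigma> i j) (\<sigma> (\<tau> j i) k)))"
      using ijk by (simp add: Y linear_scale'[OF linY] \<sigma>X \<tau>X)
    ultimately have 2: "scaleV (A j k * A i (\<sigma> j k)) (w (\<sigma> i (\<sigma> j k))) =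
        scaleV (\<kappa> * (A (\<tau> j i) k * A (\<sigma> i j) (\<sigma> (\<tau> j i) k))) (w (\<sigma> (\<sigma> i j) (\<sigma> (\<tau> j i) k)))"
      using \<kappa>(3) by simp
    have "\<tau> k (\<sigma> i j) = \<sigma> (\<tau> k i) (\<tau> k j) \<and> A i j * \<Theta> (\<sigma> i j) k = \<kappa> * (\<Theta> j k * A (\<tau> k i) (\<tau> k j))"
      by (rule V.scaled_basis_vectors_eq[OF basis(2,1) _ _ _ 1]) (use ijk \<sigma>X \<tau>X A \<Theta> in auto)
    moreover have "\<sigma> i (\<sigma> j k) = \<sigma> (\<sigma> i j) (\<sigma> (\<tau> j i) k) \<and>
        A j k * A i (\<sigma> j k) = \<kappa> * (A (\<tau> j i) k * A (\<sigma> i j) (\<sigma> (\<tau> j i) k))"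
      by (rule V.scaled_basis_vectors_eq[OF basis(2,1) _ _ _ 2]) (use ijk \<sigma>X \<tau>X A in auto)
    ultimately show ?thesis using \<kappa>(1) by metis
  qed
  have sig: "sigma r i j = \<sigma> i j" and ta: "tau r j i = \<tau> j i" for i j
    by (simp_all add: sigma_def tau_def r_def)
  \<comment> \<open>The first component has the parity of \<open>j\<close>, which fixes the map
    \<open>\<tau> j\<close>; this recovers \<open>i\<close> from the second component and then
    \<open>j\<close> from the first.\<close>
  have inj_r: "inj_on r (X \<times> X)"
  proof (rule inj_onI)
    fix p q assume p: "p \<in> X \<times> X" and q: "q \<in> X \<times> X" and eq: "r p = r q"
    obtain i j i' j' where pq: "p = (i, j)" "q = (i', j')" by fastforce
    have X': "i \<in> X" "j \<in> X" "i' \<in> X" "j' \<in> X" using p q pq by auto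
    have e: "\<sigma> i j = \<sigma> i' j'" "\<tau> j i = \<tau> j' i'" using eq pq by (auto simp: r_def)
    then have "\<epsilon> j = \<epsilon> j'" using \<sigma>(2) X' by metis
    then have "\<tau> j i = \<tau> j i'" using e(2) \<tau>_cong by metis
    then have "i = i'" using \<tau>_bij[of j] X' by (auto simp: bij_betw_def dest: inj_onD)
    moreover from this have "j = j'"
      using e(1) \<sigma>(1)[of i] X' by (auto simp: bij_betw_def dest: inj_onD)
    ultimately show "p = q" using pq by simp
  qed
  have "r ` (X \<times> X) \<subseteq> X \<times> X" using \<sigma>X \<tau>X by (auto simp: r_def)
  then have "r ` (X \<times> X) = X \<times> X" using inj_r X by (intro endo_inj_surj) auto
  then have bij_r: "bij_betw r (X \<times> X) (X \<times> X)" using inj_r by (simp add: bij_betw_def)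
  have braid_eq: "r_times_id r (id_times_r r (r_times_id r (i, j, k))) =
      id_times_r r (r_times_id r (id_times_r r (i, j, k)))" if "i \<in> X" "j \<in> X" "k \<in> X" for i j k
  proof -
    have e: "\<epsilon> (\<sigma> (\<tau> j i) k) = \<epsilon> k" "\<epsilon> (\<sigma> j k) = \<epsilon> k" "\<epsilon> (\<tau> k j) = \<epsilon> j"
      using that \<sigma>(2) \<epsilon>\<tau> \<tau>X by auto
    show ?thesis
      using key[OF that] \<tau>_comm[of k j i] \<tau>_cong[OF e(1)] \<tau>_cong[OF e(2)] \<tau>_cong[OF e(3)]
      by (simp add: r_times_id_def id_times_r_def r_def)
  qed
  have Req: "R i j * R (tau r j i) k * R (sigma r i j) (sigma r (tau r j i) k) =
      R j k * R i (sigma r j k) * R (tau r (sigma r j k) i) (tau r k j)" if ijk: "i \<in> X" "j \<in> X" "k \<in> X" for i j k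
  proof -
    have e: "\<epsilon> (\<sigma> (\<tau> j i) k) = \<epsilon> k" "\<epsilon> (\<sigma> j k) = \<epsilon> k" "\<epsilon> (\<tau> k j) = \<epsilon> j"
      using ijk \<sigma>(2) \<epsilon>\<tau> \<tau>X by auto
    obtain \<kappa> where \<kappa>: "A i j * \<Theta> (\<sigma> i j) k = \<kappa> * (\<Theta> j k * A (\<tau> k i) (\<tau> k j))"
        "A j k * A i (\<sigma> j k) = \<kappa> * (A (\<tau> j i) k * A (\<sigma> i j) (\<sigma> (\<tau> j i) k))"
      using key[OF ijk] by blast
    define a where "a = A i j * \<Theta> (\<sigma> i j) k"
    define b where "b = \<Theta> j k * A (\<tau> k i) (\<tau> k j)"
    define p where "p = A j k * A i (\<sigma> j k)"
    define q where "q = A (\<tau> j i) k * A (\<sigma> i j) (\<sigma> (\<tau> j i) k)"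
    have "R i j * R (tau r j i) k * R (sigma r i j) (sigma r (tau r j i) k) = a * q * (\<Theta> i j * \<Theta> (\<tau> j i) k)"
      unfolding R_def sig ta \<Theta>_cong[OF e(1)] a_def q_def by (simp only: ac_simps)
    moreover have "R j k * R i (sigma r j k) * R (tau r (sigma r j k) i) (tau r k j) = p * b * (\<Theta> i k * \<Theta> (\<tau> k i) j)"
      unfolding R_def sig ta \<Theta>_cong[OF e(2)] \<Theta>_cong[OF e(3)] \<tau>_cong[OF e(2)] p_def b_def by (simp only: ac_simps)
    \<comment> \<open>Here \<open>\<kappa>\<close> cancels, as \<open>a = \<kappa> * b\<close> and
      \<open>p = \<kappa> * q\<close>. The remaining factors \<open>\<Theta>\<close> agree by
      \<open>\<Theta>_comm\<close>.\<close>
    moreover have "a * q = p * b" using \<kappa> by (simp add: a_def b_def p_def q_def)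
    ultimately show ?thesis using \<Theta>_comm[of i j k] by simp
  qed
  have c: "c (tensor scaleV scaleV (w i) (w j)) =
      tensor_scale (R i j) (tensor scaleV scaleV (w (sigma r i j)) (w (tau r j i)))" if "i \<in> X" "j \<in> X" for i j
  proof -
    have "c (tensor scaleV scaleV (w i) (w j)) =
        tensor scaleV scaleV (scaleV (A i j) (w (\<sigma> i j))) (scaleV (\<Theta> i j) (w (\<tau> j i)))"
      using that by (simp add: braid Y \<T>w)
    then show ?thesis
      unfolding tensor_scale_left tensor_scale_right sig ta R_def by (simp add: tensor_scale_def mult.assoc)
  qed
  have ybe: "ybe_solution X r"
    unfolding ybe_solution_def using X bij_r braid_eq by auto
  have nondeg: "nondegenerate X r"
    unfolding nondegenerate_def
  proof (intro ballI conjI)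
    fix i assume "i \<in> X"
    moreover have "sigma r i = \<sigma> i" "tau r i = \<tau> i" by (simp_all add: fun_eq_iff sig ta)
    ultimately show "bij_betw (sigma r i) X X" "bij_betw (tau r i) X X" using \<sigma>(1) \<tau>_bij by simp_all
  qed
  have "R i j \<noteq> 0" if "i \<in> X" "j \<in> X" for i j using A \<Theta> that by (simp add: R_def)
  then show ?thesis
    unfolding set_theoretical_type_def
    using X basis ybe nondeg Req c by (intro exI[of _ X] exI[of _ r] exI[of _ R] exI[of _ w]) blast
qed

context ac_vector_space
begin

lemma idempotent_decomp:
  assumes "finite I" and W: "subspace W" and lin: "\<And>i. i \<in> I \<Longrightarrow> lin (p i)"
    and pW: "\<And>i v. i \<in> I \<Longrightarrow> v \<in> W \<Longrightarrow> p i v \<in> W"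
    and orth: "\<And>i j v. i \<in> I \<Longrightarrow> j \<in> I \<Longrightarrow> v \<in> W \<Longrightarrow> p i (p j v) = (if i = j then p i v else 0)"
    and sum: "\<And>v. v \<in> W \<Longrightarrow> (\<Sum>i\<in>I. p i v) = v"
  shows "direct_decomp I (\<lambda>i. {v \<in> W. p i v = v}) W"
  unfolding direct_decomp_def
proof (intro conjI ballI allI impI)
  show "finite I" by fact
  fix i assume i: "i \<in> I"
  show "subspace {v \<in> W. p i v = v}"
    using W by (auto simp: subspace_def linear_add'[OF lin[OF i]] linear_scale'[OF lin[OF i]] linear_zero'[OF lin[OF i]])
next
  show "W = span (\<Union>i\<in>I. {v \<in> W. p i v = v})"
  proof
    show "W \<subseteq> span (\<Union>i\<in>I. {v \<in> W. p i v = v})"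
    proof
      fix v assume v: "v \<in> W"
      have "(\<Sum>i\<in>I. p i v) \<in> span (\<Union>i\<in>I. {v \<in> W. p i v = v})"
        by (intro span_sum span_base) (use v pW orth in auto)
      then show "v \<in> span (\<Union>i\<in>I. {v \<in> W. p i v = v})" using sum[OF v] by simp
    qed
    show "span (\<Union>i\<in>I. {v \<in> W. p i v = v}) \<subseteq> W"
      by (rule span_minimal) (use W in auto)
  qed
next
  fix v i assume v: "(\<forall>i\<in>I. v i \<in> {v \<in> W. p i v = v}) \<and> (\<Sum>i\<in>I. v i) = 0" and i: "i \<in> I"
  have "p i (v j) = (if i = j then v i else 0)" if j: "j \<in> I" for j
    using v orth[OF i j, of "v j"] that by auto
  then have "p i (\<Sum>j\<in>I. v j) = (\<Sum>j\<in>I. if i = j then v i else 0)"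
    unfolding linear_sum'[OF lin[OF i]] by (intro sum.cong) auto
  then show "v i = 0"
    using v i \<open>finite I\<close> linear_zero'[OF lin[OF i]] by simp
qed

end

section \<open>Monomial bases of Yetter-Drinfeld modules\<close>

context suzuki_yd
begin

sublocale W: ac_vector_space scaleV ..

lemma deg_coaction_op: "g \<in> grp \<Longrightarrow> deg g (coaction_op (\<phi> g) v)"
proof -
  assume g: "g \<in> grp"
  then obtain W where W: "g = Z False W" by (auto simp: grp_def)
  have "\<phi> g g = 1" "\<phi> g (cc g) = 0" by (auto simp: W cc_def \<phi>_Z)
  then have "coaction_op (\<phi> g) (coaction_op (\<phi> g) v) = coaction_op (\<phi> g) v"
    by (simp add: coaction_op_convolution[OF \<phi>_linear \<phi>_linear] convolution_\<phi>[OF \<phi>_linear g])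
  then show ?thesis using g by (simp add: deg_def)
qed

lemma coaction_op_sum:
  assumes "\<And>i. functional (p i)" "finite I"
  shows "coaction_op (\<lambda>a. \<Sum>i\<in>I. p i a) v = (\<Sum>i\<in>I. coaction_op (p i) v)"
  using assms(2)
proof (induction I)
  case empty
  show ?case by (simp add: coaction_op_zero)
next
  case (insert i I)
  have "functional (\<lambda>a. \<Sum>i\<in>I. p i a)"
    unfolding Vector_Spaces.linear_iff
    by (simp add: vector_space_axioms vector_space_mult linear_add'[OF assms(1)] linear_scale'[OF assms(1)]
        sum.distrib sum_distrib_left)
  from coaction_op_combination[OF assms(1) this, of 1 i 1 v]
  show ?case using insert by simp
qed

lemma par_decomp: "W.direct_decomp UNIV (\<lambda>b. {v \<in> UNIV. act (E b) v = v}) UNIV"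
proof (rule W.idempotent_decomp)
  fix b c :: bool and v
  show "act (E b) (act (E c) v) = (if b = c then act (E b) v else 0)"
    by (simp add: act_mult[symmetric] E_E)
  show "(\<Sum>b\<in>UNIV. act (E b) v) = v"
    by (simp add: UNIV_bool linear_add'[OF act_linear_left, symmetric] E_sum act_one)
qed (simp_all add: act_linear_right)

text \<open>The operators of the \<open>\<phi> g\<close> are orthogonal idempotents; they sum to the
  identity because the \<open>\<phi> g\<close> sum to the counit, and they preserve parity by
  \<open>par_coaction_op\<close>.\<close>

lemma deg_decomp: "W.direct_decomp grp (\<lambda>g. {v \<in> {v. par b v}. coaction_op (\<phi> g) v = v}) {v. par b v}"
proof (rule W.idempotent_decomp)
  show "V.subspace {v. par b v}"
    by (simp add: V.subspace_def par_def act_add act_scale)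
  show "coaction_op (\<phi> g) v \<in> {v. par b v}" if "v \<in> {v. par b v}" for g v
    using that par_coaction_op[OF _ \<phi>_linear] by simp
  show "coaction_op (\<phi> g) (coaction_op (\<phi> h) v) = (if g = h then coaction_op (\<phi> g) v else 0)"
    if "g \<in> grp" "h \<in> grp" for g h v
    using deg_unique[OF deg_coaction_op[OF that(2)] that(1)] by simp
  show "(\<Sum>g\<in>grp. coaction_op (\<phi> g) v) = v" for v
    by (simp add: coaction_op_sum[OF \<phi>_linear finite_grp, symmetric] counit_eq[symmetric] coaction_op_counit)
qed (simp_all add: finite_grp coaction_op_linear \<phi>_linear)

lemma act_zz: "act zz v = act (y i) (act (y i) v)"
  by (simp add: y_y act_mult[symmetric])

text \<open>For the word \<open>[I1, I1]\<close> the twist disappears, since both letters have the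
  same square. The element is central and invertible, so the conjugation is trivial: the degree is
  unchanged and \<open>\<kappa> = 1\<close>. Hence eigenspaces of \<open>zz\<close> are compatible
  with the grading and with \<open>T\<close>.\<close>

lemma zz_homogeneous:
  assumes gg: "g \<in> grp" and v: "par b v" "deg g v"
  shows "deg g (act zz v)" and "E True \<noteq> 0 \<Longrightarrow> T (act zz v) = act zz (T v)"
proof -
  have zz: "yw [I1, I1] = zz" "yw [I2, I2] = zz" by (simp_all add: y_y)
  have flips: "yw (flips b [I1, I1]) = zz" by (cases b) (simp_all add: y_y)
  obtain g' \<kappa> where *: "g' \<in> grp" "\<kappa> \<noteq> 0"
    "Z False [I1, I1] * g = g' * Z False (flips b [I1, I1])"
    "Z True [I1, I1] * cc g = scale \<kappa> (cc g' * Z True (flips b [I1, I1]))"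
    "deg g' (act zz v)" "T (act zz v) = scaleV \<kappa> (act zz (T v))"
    using act_yw_homogeneous[OF gg, of "[I1, I1]" b] v zz by (auto simp: y_y)
  have inv: "zz * zz ^ (2 * N - 1) = 1"
    using zz_order N by (cases "2 * N") auto
  have zz_cancel: "h = h'" if "h * zz = h' * zz" for h h'
    using arg_cong[OF that, of "\<lambda>h. h * zz ^ (2 * N - 1)"] inv by (simp add: mult.assoc)
  have Zzz: "Z c [I1, I1] = zz * E c" "Z c (flips b [I1, I1]) = E c * zz" for c
    unfolding Z_def zz flips by (rule zz_central[symmetric]) simp
  have "g * zz = g' * zz"
  proof -
    have "zz * (E False * g) = (g' * E False) * zz"
      using *(3) unfolding Zzz by (simp only: mult.assoc)
    then show ?thesis
      using E_fix_grp[OF gg] E_fix_grp[OF *(1)] by (simp add: E_central[symmetric] zz_central)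
  qed
  then have g': "g' = g" using zz_cancel by simp
  then show "deg g (act zz v)" using *(5) by simp
  assume E: "E True \<noteq> 0"
  have Ecc: "E True * cc g = cc g" by (simp add: cc_def E_mult_Z)
  have "zz * (E True * cc g) = scale \<kappa> ((cc g * E True) * zz)"
    using *(4) unfolding Zzz g' by (simp only: mult.assoc)
  then have "cc g * zz = scale \<kappa> (cc g) * zz"
    by (simp add: E_central[of True "cc g", symmetric] Ecc zz_central scale_mult_left)
  then have "cc g = scale \<kappa> (cc g)" by (rule zz_cancel)
  then have "scale 1 (cc g) = scale \<kappa> (cc g)" by simp
  moreover have "cc g \<noteq> 0" unfolding cc_def by (rule Z_True_nonzero[OF E])
  ultimately have "\<kappa> = 1" by (metis scale_right_imp_eq)
  then show "T (act zz v) = act zz (T v)" using *(6) by simp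
qed

section \<open>Pieces and the dihedral relations on them\<close>

definition piece :: "bool \<times> 'h \<times> 'k \<Rightarrow> 'v set"
  where "piece = (\<lambda>(b, g, z). {v. par b v \<and> deg g v \<and> act zz v = scaleV z v})"

definition pieces :: "(bool \<times> 'h \<times> 'k) set"
  where "pieces = {i \<in> UNIV \<times> grp \<times> {z. z ^ (2 * N) = 1}. piece i \<noteq> {0}}"

lemma piece_decomp: "W.direct_decomp pieces piece UNIV"
proof -
  let ?\<Lambda> = "{z :: 'k. z ^ (2 * N) = 1}"
  have "W.direct_decomp (SIGMA g:grp. ?\<Lambda>) (\<lambda>(g, z). {v \<in> {v \<in> {v. par b v}. coaction_op (\<phi> g) v = v}. act zz v = scaleV z v})
      {v. par b v}" for b
  proof (rule W.direct_decomp_refine[OF deg_decomp])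
    fix g assume g: "g \<in> grp"
    let ?D = "{v \<in> {v. par b v}. coaction_op (\<phi> g) v = v}"
    show "W.direct_decomp ?\<Lambda> (\<lambda>z. {v \<in> ?D. act zz v = scaleV z v}) ?D"
    proof (rule W.eigenspace_decomp[OF act_linear_right])
      show "V.subspace ?D" using deg_decomp[of b] g unfolding W.direct_decomp_def by blast
      show "act zz ` ?D \<subseteq> ?D"
        using zz_homogeneous(1)[OF g, of b] par_act[of b _ zz] g by (auto simp: deg_def)
      have "(act zz ^^ k) v = act (zz ^ k) v" for k v
        by (induction k) (simp_all add: act_one act_mult)
      then show "(act zz ^^ (2 * N)) v = scaleV 1 v" for v by (simp add: zz_order act_one)
    qed (use N in simp_all)
  qed
  then have "W.direct_decomp (SIGMA b:UNIV. SIGMA g:grp. ?\<Lambda>)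
      (\<lambda>(b, g, z). {v \<in> {v \<in> {v. par b v}. coaction_op (\<phi> g) v = v}. act zz v = scaleV z v}) UNIV"
    by (intro W.direct_decomp_refine[OF par_decomp]) (simp add: par_def)
  then have "W.direct_decomp (UNIV \<times> grp \<times> ?\<Lambda>) piece UNIV"
    by (rule W.direct_decomp_cong) (auto simp: piece_def deg_def)
  from W.direct_decomp_nonzero[OF this] show ?thesis unfolding pieces_def .
qed

lemma pieces_in_grp: "(b, g, z) \<in> pieces \<Longrightarrow> g \<in> grp"
  by (simp add: pieces_def)

lemma pieces_z_nonzero: "(b, g, z) \<in> pieces \<Longrightarrow> z \<noteq> 0"
  using N by (auto simp: pieces_def power_0_left)

lemma par_T: "par b v \<Longrightarrow> par b (T v)"
  unfolding T_def by (rule par_coaction_op[OF _ \<Psi>_linear])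

lemma zero_in_piece: "i \<in> pieces \<Longrightarrow> 0 \<in> piece i"
  using piece_decomp V.subspace_0 by (auto simp: W.direct_decomp_def)

text \<open>Injectivity sends a nonzero vector into the target, which is therefore a nonzero piece
  and belongs to \<open>pieces\<close>.\<close>

lemma permutes_pieces:
  assumes i: "(b, g, z) \<in> pieces" and g': "g' \<in> grp"
    and im: "f ` piece (b, g, z) \<subseteq> piece (b, g', z)"
    and inj: "\<And>v. v \<in> piece (b, g, z) \<Longrightarrow> f v = 0 \<Longrightarrow> v = 0"
  shows "\<exists>j\<in>pieces. f ` piece (b, g, z) \<subseteq> piece j"
proof -
  obtain v where "v \<in> piece (b, g, z)" "v \<noteq> 0"
    using i zero_in_piece[OF i] by (auto simp: pieces_def)
  then have "f v \<in> piece (b, g', z)" "f v \<noteq> 0" using im inj by blast+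
  then have "(b, g', z) \<in> pieces" using i g' by (auto simp: pieces_def)
  then show ?thesis using im by blast
qed

lemma act_y_permutes:
  assumes i: "(b, g, z) \<in> pieces"
  shows "\<exists>j\<in>pieces. act (y k) ` piece (b, g, z) \<subseteq> piece j"
proof -
  obtain g' where g': "g' \<in> grp" "\<And>v. par b v \<Longrightarrow> deg g v \<Longrightarrow> deg g' (act (y k) v)"
    using act_y_homogeneous[OF pieces_in_grp[OF i], of k b] by blast
  have zy: "act zz (act (y k) v) = act (y k) (act zz v)" for v
    by (simp add: act_mult[symmetric] zz_central)
  show ?thesis
  proof (rule permutes_pieces[OF i g'(1)])
    show "act (y k) ` piece (b, g, z) \<subseteq> piece (b, g', z)"
      using g'(2) par_act by (auto simp: piece_def zy act_scale)
    show "v = 0" if "act (y k) v = 0" for v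
      using that act_mult[of "yinv k" "y k" v] by (simp add: yinv_y act_one)
  qed
qed

lemma act_y_square:
  assumes "(b, g, z) \<in> pieces"
  shows "W.proportional_on (piece (b, g, z)) (act (y k) \<circ> act (y k)) id"
  unfolding W.proportional_on_def
  using pieces_z_nonzero[OF assms] by (intro exI[of _ z]) (auto simp: piece_def act_zz[symmetric])

lemma T_square:
  assumes "(b, g, z) \<in> pieces" "E True \<noteq> 0"
  shows "W.proportional_on (piece (b, g, z)) (T \<circ> T) id"
  unfolding W.proportional_on_def
  using T_T[OF pieces_in_grp[OF assms(1)] assms(2)] by (auto simp: piece_def)

lemma T_permutes:
  assumes i: "(b, g, z) \<in> pieces" and E: "E True \<noteq> 0"
  shows "\<exists>j\<in>pieces. T ` piece (b, g, z) \<subseteq> piece j"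
proof (rule permutes_pieces[OF i swap_grp])
  show "T ` piece (b, g, z) \<subseteq> piece (b, swap g, z)"
  proof
    fix w assume "w \<in> T ` piece (b, g, z)"
    then obtain v where v: "w = T v" "par b v" "deg g v" "act zz v = scaleV z v" by (auto simp: piece_def)
    have "act zz (T v) = T (act zz v)"
      using zz_homogeneous(2)[OF pieces_in_grp[OF i] v(2,3) E] by simp
    then show "w \<in> piece (b, swap g, z)"
      using v par_T deg_T by (simp add: piece_def linear_scale'[OF T_linear])
  qed
  show "v = 0" if v: "v \<in> piece (b, g, z)" "T v = 0" for v
  proof -
    obtain c where "c \<noteq> 0" "T (T v) = scaleV c v"
      using T_square[OF i E] v(1) by (auto simp: W.proportional_on_def)
    then show ?thesis using v(2) linear_zero'[OF T_linear] by simp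
  qed
qed

lemma T_act_y:
  assumes i: "(b, g, z) \<in> pieces"
  shows "W.proportional_on (piece (b, g, z)) (T \<circ> act (y k)) (act (y (flip k)) \<circ> T)"
  using act_y_homogeneous[OF pieces_in_grp[OF i], of k b]
  unfolding W.proportional_on_def by (auto simp: piece_def)

text \<open>\<open>(b a)^n\<close> is the alternating word of length \<open>2 n\<close>, which by
  \<open>Z_altword_double\<close> acts on parity \<open>b\<close> as a multiple of
  \<open>zz^n\<close>, hence as a scalar on the piece.\<close>

lemma rotation_power:
  assumes i: "(b, g, z) \<in> pieces"
  shows "W.proportional_on (piece (b, g, z)) ((act (y I2) \<circ> act (y I1)) ^^ n) id"
proof -
  have alt: "yw (altword I2 (2 * k)) = (y I2 * y I1) ^ k" for k
    by (induction k) (auto simp: mult.assoc)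
  have pow: "((act (y I2) \<circ> act (y I1)) ^^ k) v = act ((y I2 * y I1) ^ k) v" for k v
    by (induction k) (simp_all add: act_one act_mult)
  have zpow: "act (zz ^ k) v = scaleV (z ^ k) v" if "v \<in> piece (b, g, z)" for k v
    using that by (induction k)
      (auto simp: act_one act_mult piece_def act_scale mult.commute)
  obtain c where c: "c \<noteq> 0" "Z b (altword I2 (2 * n)) = scale c (E b * zz ^ n)"
    using Z_altword_double by blast
  have "((act (y I2) \<circ> act (y I1)) ^^ n) v = scaleV (c * z ^ n) v" if v: "v \<in> piece (b, g, z)" for v
  proof -
    have pv: "par b v" using v by (simp add: piece_def)
    have "((act (y I2) \<circ> act (y I1)) ^^ n) v = act (Z b (altword I2 (2 * n))) v"
      by (simp add: pow act_Z_par[OF pv] alt)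
    also have "\<dots> = scaleV c (act (E b) (act (zz ^ n) v))"
      unfolding c(2) by (simp add: act_scale_left act_mult)
    also have "\<dots> = scaleV (c * z ^ n) v"
      using pv by (simp add: zpow[OF v] act_scale par_def)
    finally show ?thesis .
  qed
  then show ?thesis
    unfolding W.proportional_on_def using c(1) pieces_z_nonzero[OF i]
    by (intro exI[of _ "c * z ^ n"]) auto
qed

text \<open>Moving the outer \<open>T\<close> past the inner \<open>a\<close> gives
  \<open>b T T a\<close>, and \<open>T T\<close> is a scalar on a piece.\<close>

lemma rotation_square:
  assumes i: "i \<in> pieces" and E: "E True \<noteq> 0"
  shows "W.proportional_on (piece i) ((T \<circ> act (y I1)) \<circ> (T \<circ> act (y I1))) (act (y I2) \<circ> act (y I1))"
proof -
  let ?P = "act (y I1)" and ?Q = "act (y I2)"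
  obtain b g z where bgz: "i = (b, g, z)" by (cases i)
  obtain j where j: "j \<in> pieces" "?P ` piece i \<subseteq> piece j" using act_y_permutes i bgz by blast
  obtain k where k: "k \<in> pieces" "T ` piece j \<subseteq> piece k" using T_permutes[OF _ E] j by (cases j) blast
  have TPi: "(T \<circ> ?P) ` piece i \<subseteq> piece k" using j k by auto
  have "W.proportional_on (piece i) ((T \<circ> ?P) \<circ> (T \<circ> ?P)) ((?Q \<circ> T) \<circ> (T \<circ> ?P))"
    by (rule W.proportional_on_comp_right[OF _ TPi]) (use T_act_y[of _ _ _ I1] k in \<open>cases k; simp\<close>)
  also have "(?Q \<circ> T) \<circ> (T \<circ> ?P) = ?Q \<circ> ((T \<circ> T) \<circ> ?P)" by (simp only: o_assoc)
  also have "W.proportional_on (piece i) (?Q \<circ> ((T \<circ> T) \<circ> ?P)) (?Q \<circ> (id \<circ> ?P))"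
    by (intro W.proportional_on_comp_left act_linear_right W.proportional_on_comp_right[OF _ j(2)])
      (use T_square[OF _ E] j in \<open>cases j; simp\<close>)
  finally show ?thesis unfolding id_comp .
qed

lemma rotation_power_T:
  assumes i: "i \<in> pieces" and E: "E True \<noteq> 0"
  shows "W.proportional_on (piece i) ((T \<circ> act (y I1)) ^^ (2 * n)) id"
proof -
  let ?P = "act (y I1)" and ?Q = "act (y I2)"
  define \<rho> where "\<rho> = T \<circ> ?P"
  have lin\<rho>: "W.lin (\<rho> ^^ k)" for k
    unfolding \<rho>_def by (intro W.funpow_scale_linear W.lin_comp T_linear act_linear_right)
  have "W.proportional_on (piece i) (\<rho> ^^ (2 * k)) ((?Q \<circ> ?P) ^^ k)" if "i \<in> pieces" for k i
    using that
  proof (induction k arbitrary: i)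
    case (Suc k)
    obtain j where j: "j \<in> pieces" "?P ` piece i \<subseteq> piece j" using act_y_permutes Suc.prems by (cases i) blast
    obtain l where l: "l \<in> pieces" "?Q ` piece j \<subseteq> piece l" using act_y_permutes j by (cases j) blast
    have "2 * Suc k = 2 * k + 2" by simp
    then have "\<rho> ^^ (2 * Suc k) = \<rho> ^^ (2 * k) \<circ> (\<rho> \<circ> \<rho>)"
      by (simp only: funpow_add) (simp add: numeral_2_eq_2 comp_def)
    moreover have "W.proportional_on (piece i) (\<rho> ^^ (2 * k) \<circ> (\<rho> \<circ> \<rho>)) (\<rho> ^^ (2 * k) \<circ> (?Q \<circ> ?P))"
      by (intro W.proportional_on_comp_left lin\<rho>) (use rotation_square[OF Suc.prems E] in \<open>simp only: \<rho>_def\<close>)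
    moreover have "W.proportional_on (piece i) (\<rho> ^^ (2 * k) \<circ> (?Q \<circ> ?P)) ((?Q \<circ> ?P) ^^ k \<circ> (?Q \<circ> ?P))"
      by (rule W.proportional_on_comp_right[OF Suc.IH[OF l(1)]]) (use j l in auto)
    moreover have "(?Q \<circ> ?P) ^^ k \<circ> (?Q \<circ> ?P) = (?Q \<circ> ?P) ^^ Suc k"
      by (simp only: funpow_Suc_right)
    ultimately show ?case using W.proportional_on_trans by metis
  qed (simp add: id_def[symmetric])
  from this[OF i, of n] have "W.proportional_on (piece i) (\<rho> ^^ (2 * n)) ((?Q \<circ> ?P) ^^ n)" .
  also have "W.proportional_on (piece i) ((?Q \<circ> ?P) ^^ n) id"
    using rotation_power i by (cases i) blast
  finally show ?thesis unfolding \<rho>_def .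
qed

text \<open>
  Only the relations of the presentation are used, so \<open>E True = 0\<close> is not excluded; the coaction then has no \<open>T\<close>-part,
  and \<open>y I2\<close> takes over the role of the second involution.
\<close>

lemma monomial_basis:
  obtains B where "W.basis_of B UNIV" "B \<subseteq> (\<Union>i\<in>pieces. piece i)"
    "\<And>k. W.monomial_on B (act (y k))" "E True \<noteq> 0 \<Longrightarrow> W.monomial_on B T"
proof (cases "E True = 0")
  case True
  obtain B where B: "W.basis_of B UNIV" "B \<subseteq> (\<Union>i\<in>pieces. piece i)"
    "W.monomial_on B (act (y I1))" "W.monomial_on B (act (y I2))"
  proof (rule W.dihedral_monomial_basis[OF piece_decomp act_linear_right[of "y I1"] act_linear_right[of "y I2"]])
    fix i assume i: "i \<in> pieces"
    obtain b g z where bgz: "i = (b, g, z)" by (cases i)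
    show "\<exists>j\<in>pieces. act (y I1) ` piece i \<subseteq> piece j" "\<exists>j\<in>pieces. act (y I2) ` piece i \<subseteq> piece j"
      "W.proportional_on (piece i) (act (y I1) \<circ> act (y I1)) id"
      "W.proportional_on (piece i) (act (y I2) \<circ> act (y I2)) id"
      "W.proportional_on (piece i) ((act (y I2) \<circ> act (y I1)) ^^ n) id"
      using i unfolding bgz by (simp_all add: act_y_permutes act_y_square rotation_power)
    show "piece i \<noteq> {0}" using i by (simp add: pieces_def)
  next
    show "0 < n" using n by simp
  qed
  have "W.monomial_on B (act (y k))" for k using B by (cases k) auto
  then show ?thesis using that B True by blast
next
  case False
  obtain B where B: "W.basis_of B UNIV" "B \<subseteq> (\<Union>i\<in>pieces. piece i)"
    "W.monomial_on B (act (y I1))" "W.monomial_on B T"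
  proof (rule W.dihedral_monomial_basis[OF piece_decomp act_linear_right[of "y I1"] T_linear])
    fix i assume i: "i \<in> pieces"
    obtain b g z where bgz: "i = (b, g, z)" by (cases i)
    show "\<exists>j\<in>pieces. act (y I1) ` piece i \<subseteq> piece j" "\<exists>j\<in>pieces. T ` piece i \<subseteq> piece j"
      "W.proportional_on (piece i) (act (y I1) \<circ> act (y I1)) id"
      "W.proportional_on (piece i) (T \<circ> T) id"
      using i False unfolding bgz by (simp_all add: act_y_permutes act_y_square T_permutes T_square)
    show "W.proportional_on (piece i) ((T \<circ> act (y I1)) ^^ (2 * n)) id"
      by (rule rotation_power_T[OF i False])
    show "piece i \<noteq> {0}" using i by (simp add: pieces_def)
  next
    show "0 < 2 * n" using n by simp
  qed
  \<comment> \<open>\<open>T a T\<close> is proportional to \<open>b T T\<close>, hence to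
    \<open>b\<close>, on each piece; so monomiality of \<open>b\<close> follows from that of
    \<open>a\<close> and \<open>T\<close>.\<close>
  have TP: "W.monomial_on B (T \<circ> act (y I1) \<circ> T)"
    by (intro W.monomial_on_comp T_linear act_linear_right B W.lin_comp)
  have "W.monomial_on B (act (y I2))"
    unfolding W.monomial_on_def
  proof
    fix b assume b: "b \<in> B"
    then obtain i where i: "i \<in> pieces" "b \<in> piece i" using B(2) by blast
    obtain j where j: "j \<in> pieces" "T ` piece i \<subseteq> piece j" using T_permutes[OF _ False] i by (cases i) blast
    have "W.proportional_on (piece i) (T \<circ> act (y I1) \<circ> T) (act (y I2) \<circ> T \<circ> T)"
      by (rule W.proportional_on_comp_right[OF _ j(2)]) (use T_act_y[of _ _ _ I1] j in \<open>cases j; simp\<close>)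
    also have "W.proportional_on (piece i) (act (y I2) \<circ> T \<circ> T) (act (y I2) \<circ> id)"
      unfolding o_assoc[symmetric]
      by (intro W.proportional_on_comp_left act_linear_right) (use T_square[OF _ False] i in \<open>cases i; simp\<close>)
    finally obtain c where c: "c \<noteq> 0" "T (act (y I1) (T b)) = scaleV c (act (y I2) b)"
      using i(2) by (auto simp: W.proportional_on_def)
    obtain b' d where b': "b' \<in> B" "d \<noteq> 0" "T (act (y I1) (T b)) = scaleV d b'"
      using TP b by (auto simp: W.monomial_on_def)
    have "act (y I2) b = scaleV (inverse c * d) b'"
      using c b' by (metis V.scale_scale V.scale_one left_inverse)
    then show "\<exists>b'\<in>B. \<exists>c. c \<noteq> 0 \<and> act (y I2) b = scaleV c b'"
      using b'(1,2) c(1) by (intro bexI[of _ b'] exI[of _ "inverse c * d"]) auto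
  qed
  then have "W.monomial_on B (act (y k))" for k using B by (cases k) auto
  then show ?thesis using that B by blast
qed

section \<open>Assembly of the set-theoretical data\<close>

lemma act_yw_monomial:
  assumes "\<And>k. W.monomial_on B (act (y k))"
  shows "W.monomial_on B (act (yw W))"
proof (induction W)
  case Nil
  have "act (yw []) = id" by (simp add: fun_eq_iff act_one)
  then show ?case by (simp only: W.monomial_on_id)
next
  case (Cons k W)
  have "act (yw (k # W)) = act (y k) \<circ> act (yw W)" by (simp add: fun_eq_iff act_mult)
  then show ?case by (simp only: W.monomial_on_comp[OF act_linear_right assms Cons])
qed

lemma act_yw_inj: "act (yw W) u = act (yw W) v \<Longrightarrow> u = v"
  by (metis yw_inverse act_mult act_one)

lemma par_nonzero_unique: "par b v \<Longrightarrow> par c v \<Longrightarrow> v \<noteq> 0 \<Longrightarrow> b = c"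
  unfolding par_def by (metis E_E act_mult act_zero(2))

lemma deg_nonzero_unique: "deg g v \<Longrightarrow> deg h v \<Longrightarrow> v \<noteq> 0 \<Longrightarrow> g = h"
  using deg_unique[of g v h] by (auto simp: deg_def split: if_splits)

lemma par_scale: "par b (scaleV c v) \<Longrightarrow> c \<noteq> 0 \<Longrightarrow> par b v"
  by (simp add: par_def act_scale)

lemma deg_scale: "deg g (scaleV c v) \<Longrightarrow> c \<noteq> 0 \<Longrightarrow> deg g v"
  by (simp add: deg_def linear_scale'[OF coaction_op_linear[OF \<phi>_linear]])

theorem set_theoretical_type_yd_braiding:
  assumes fin: "finite S" "V.span S = UNIV" and dim: "V.dim (UNIV :: 'v set) \<ge> 2"
  shows "set_theoretical_type scaleV (yd_braiding scale scaleV act coact)"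
proof -
  obtain B where B: "W.basis_of B UNIV" "B \<subseteq> (\<Union>i\<in>pieces. piece i)"
    and Bmon: "\<And>k. W.monomial_on B (act (y k))" and BT: "E True \<noteq> 0 \<Longrightarrow> W.monomial_on B T"
    by (rule monomial_basis) blast
  have indB: "V.independent B" "V.span B = UNIV" using B(1) by (simp_all add: W.basis_of_def)
  have finB: "finite B" using V.independent_span_bound[OF fin(1) indB(1)] fin(2) by simp
  have cardB: "card B \<ge> 2" using dim V.dim_eq_card[OF _ indB(1), of UNIV] indB(2) by simp
  have B0: "0 \<notin> B" using indB(1) V.dependent_zero by blast
  define X where "X = {0..<card B}"
  obtain w where w: "bij_betw w X B" unfolding X_def using ex_bij_betw_nat_finite[OF finB] by blast
  have wB: "w i \<in> B" if "i \<in> X" for i using w that by (auto dest: bij_betwE)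
  have w0: "w i \<noteq> 0" if "i \<in> X" for i using wB[OF that] B0 by metis
  have inj_w: "inj_on w X" and im_w: "w ` X = B" using w by (auto simp: bij_betw_def)
  have index: "\<exists>j\<in>X. b = w j" if "b \<in> B" for b using that im_w by blast
  have "\<exists>e d. d \<in> grp \<and> par e (w i) \<and> deg d (w i)" if "i \<in> X" for i
    using wB[OF that] B(2) by (fastforce simp: piece_def deg_def)
  then obtain e d where e: "\<And>i. i \<in> X \<Longrightarrow> par (e i) (w i)" and d: "\<And>i. i \<in> X \<Longrightarrow> deg (d i) (w i)"
    and d_grp: "\<And>i. i \<in> X \<Longrightarrow> d i \<in> grp"
    by metis
  have line_inj: "i = j" if "i \<in> X" "j \<in> X" "a \<noteq> 0" "scaleV a (w i) = scaleV b (w j)" for i j a b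
    using V.scaled_basis_vectors_eq[of w X i j a b] that indB(1) inj_w im_w by simp
  have finX: "finite X" by (simp add: X_def)
  note permutation = W.monomial_permutation[OF inj_w indB(1)[folded im_w] finX, unfolded im_w]
  have "\<exists>\<sigma> A. bij_betw \<sigma> X X \<and> (\<forall>j\<in>X. A j \<noteq> 0 \<and> act (yw (word (d i))) (w j) = scaleV (A j) (w (\<sigma> j)))" for i
  proof (rule permutation[OF act_yw_monomial[OF Bmon]])
    fix j k a b assume *: "j \<in> X" "k \<in> X" "a \<noteq> 0"
      "scaleV a (act (yw (word (d i))) (w j)) = scaleV b (act (yw (word (d i))) (w k))"
    then have "scaleV a (w j) = scaleV b (w k)"
      by (intro act_yw_inj[of "word (d i)" "scaleV a (w j)" "scaleV b (w k)"]) (simp add: act_scale)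
    then show "j = k" using line_inj * by blast
  qed
  then obtain \<sigma> A where \<sigma>_bij: "\<And>i. bij_betw (\<sigma> i) X X"
    and A: "\<And>i j. j \<in> X \<Longrightarrow> A i j \<noteq> 0 \<and> act (yw (word (d i))) (w j) = scaleV (A i j) (w (\<sigma> i j))"
    by metis
  have \<sigma>X: "\<sigma> i j \<in> X" if "j \<in> X" for i j using \<sigma>_bij that by (auto dest: bij_betwE)
  \<comment> \<open>When \<open>f = 0\<close> the operator \<open>T\<close> is 0 and induces no
    permutation; the identity replaces it. Then no basis vector has parity \<open>True\<close>, so
    the braiding does not see the replacement.\<close>
  define T' where "T' = (if E True = 0 then id else T)"
  have linT': "Vector_Spaces.linear scaleV scaleV T'"
    unfolding T'_def using T_linear W.lin_id by simp
  have "W.monomial_on B T'" unfolding T'_def using BT W.monomial_on_id by simp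
  then have "\<exists>t \<theta>. bij_betw t X X \<and> (\<forall>i\<in>X. \<theta> i \<noteq> 0 \<and> T' (w i) = scaleV (\<theta> i) (w (t i)))"
  proof (rule permutation)
    \<comment> \<open>Applying \<open>T'\<close> once more leads back to multiples of
      \<open>w i\<close> and \<open>w j\<close>, which are distinct lines unless
      \<open>i = j\<close>.\<close>
    fix i j a b assume ij: "i \<in> X" "j \<in> X" "a \<noteq> 0" "scaleV a (T' (w i)) = scaleV b (T' (w j))"
    have TT: "\<exists>\<alpha>. \<alpha> \<noteq> 0 \<and> T' (T' (w i)) = scaleV \<alpha> (w i)" if "i \<in> X" for i
    proof (cases "E True = 0")
      case True
      then show ?thesis by (intro exI[of _ 1]) (simp add: T'_def)
    next
      case False
      then show ?thesis using T_T[OF d_grp[OF that] False] d[OF that] by (auto simp: T'_def)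
    qed
    obtain \<alpha> where \<alpha>: "\<alpha> \<noteq> 0" "T' (T' (w i)) = scaleV \<alpha> (w i)" using TT ij by blast
    obtain \<beta> where \<beta>: "T' (T' (w j)) = scaleV \<beta> (w j)" using TT ij by blast
    from ij(4) have "T' (scaleV a (T' (w i))) = T' (scaleV b (T' (w j)))" by simp
    then have "scaleV (a * \<alpha>) (w i) = scaleV (b * \<beta>) (w j)"
      by (simp add: linear_scale'[OF linT'] \<alpha>(2) \<beta>)
    moreover have "a * \<alpha> \<noteq> 0" using ij(3) \<alpha>(1) by simp
    ultimately show "i = j" using line_inj[OF ij(1,2)] by blast
  qed
  then obtain t \<theta> where t_bij: "bij_betw t X X"
    and \<theta>: "\<And>i. i \<in> X \<Longrightarrow> \<theta> i \<noteq> 0 \<and> T' (w i) = scaleV (\<theta> i) (w (t i))"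
    by blast
  have tX: "t i \<in> X" if "i \<in> X" for i using t_bij that by (auto dest: bij_betwE)
  have E_e: "E True \<noteq> 0" if "i \<in> X" "e i" for i
    using e[OF that(1)] that(2) w0[OF that(1)] by (auto simp: par_def)
  have T'_eq: "T' = T" if "i \<in> X" "e i" for i using E_e[OF that] by (simp add: T'_def)
  have e\<sigma>: "e (\<sigma> i j) = e j" if "i \<in> X" "j \<in> X" for i j
  proof -
    have "par (e j) (w (\<sigma> i j))"
      using par_act[OF e[OF that(2)]] A[OF that(2)] par_scale by metis
    then show ?thesis using par_nonzero_unique e w0 \<sigma>X that by metis
  qed
  have et: "e (t i) = e i" if "i \<in> X" for i
  proof -
    have "par (e i) (T' (w i))" unfolding T'_def using par_T e[OF that] by simp
    then have "par (e i) (w (t i))" using \<theta>[OF that] par_scale by metis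
    then show ?thesis using par_nonzero_unique e w0 tX that by metis
  qed
  have dt: "d (t i) = swap (d i)" if "i \<in> X" "E True \<noteq> 0" for i
  proof -
    have "deg (swap (d i)) (T' (w i))" unfolding T'_def using deg_T d[OF that(1)] that(2) by simp
    then have "deg (swap (d i)) (w (t i))" using \<theta>[OF that(1)] deg_scale by metis
    then show ?thesis using deg_nonzero_unique d w0 tX that by metis
  qed
  let ?Y = "\<lambda>i. act (yw (word (d i)))"
  show ?thesis
  proof (rule set_theoretical_typeI[where X = X and w = w and \<sigma> = \<sigma> and t = t and \<epsilon> = e and Y = ?Y
        and T = T' and A = A and \<theta> = \<theta>])
    show "finite X" "2 \<le> card X" using cardB by (auto simp: X_def)
    show "\<not> V.dependent (w ` X)" "V.span (w ` X) = UNIV" using indB im_w by simp_all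
    show "yd_braiding scale scaleV act coact (tensor scaleV scaleV (w i) (w j)) =
        tensor scaleV scaleV (?Y i (w j)) (if e j then T' (w i) else w i)" if "i \<in> X" "j \<in> X" for i j
      using braiding_homogeneous[OF d[OF that(1)] e[OF that(2)]] T'_eq[OF that(2)] by simp
    fix i j k assume ijk: "i \<in> X" "j \<in> X" "k \<in> X"
    let ?W = "word (d i)"
    obtain g' \<kappa> where g': "g' \<in> grp" "\<kappa> \<noteq> 0"
      "Z False ?W * d j = g' * Z False (flips (e j) ?W)"
      "Z True ?W * cc (d j) = scale \<kappa> (cc g' * Z True (flips (e j) ?W))"
      "deg g' (?Y i (w j))" "T (?Y i (w j)) = scaleV \<kappa> (act (yw (map flip ?W)) (T (w j)))"
      using act_yw_homogeneous[OF d_grp[OF ijk(2)], of ?W "e j"] e[OF ijk(2)] d[OF ijk(2)] by blast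
    have "deg g' (w (\<sigma> i j))" using g'(5) A[OF ijk(2)] deg_scale by metis
    then have g'_eq: "g' = d (\<sigma> i j)" using deg_nonzero_unique d w0 \<sigma>X ijk by metis
    \<comment> \<open>\<open>m\<close> is the index \<open>\<tau> j i\<close>; the twisted word
      \<open>flips (e j) ?W\<close> is a word for its degree.\<close>
    define m where "m = (if e j then t i else i)"
    have mX: "m \<in> X" using tX ijk by (simp add: m_def)
    have par_k: "par (e k) (w k)" using e ijk by blast
    have act_k: "act (Z (e k) U) (act (yw U') (w k)) = act (yw U) (act (yw U') (w k))" for U U'
      using act_Z_par[OF par_act[OF par_k]] by simp
    have prod_k: "act (Z (e k) U * Z (e k) U') (w k) = act (yw U) (act (yw U') (w k))" for U U'
      unfolding act_mult using act_Z_par[OF par_k] act_k by simp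
    have dm_False: "Z False (flips (e j) ?W) = d m"
    proof (cases "e j")
      case True
      then show ?thesis
        using dt[OF ijk(1) E_e[OF ijk(2) True]] by (simp add: m_def swap_def flip_if_def[abs_def])
    next
      case False
      then show ?thesis
        using Z_word[OF d_grp[OF ijk(1)]] by (simp add: m_def flip_if_def[abs_def])
    qed
    \<comment> \<open>\<open>\<alpha>\<close> measures the flipped word against the reference word
      of \<open>d m\<close>. Without flipping the two words coincide, so
      \<open>\<alpha> = 1\<close>; this value is used below when \<open>e j\<close> is
      false.\<close>
    have "\<exists>\<alpha>. \<alpha> \<noteq> 0 \<and> Z True (flips (e j) ?W) = scale \<alpha> (cc (d m)) \<and> (\<not> e j \<longrightarrow> \<alpha> = 1)"
    proof (cases "e j")
      case True
      then show ?thesis using Z_True_cc[of "flips (e j) ?W"] dm_False by auto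
    next
      case False
      then show ?thesis by (intro exI[of _ 1]) (simp add: m_def cc_def flip_if_def[abs_def])
    qed
    then obtain \<alpha> where \<alpha>: "\<alpha> \<noteq> 0" "Z True (flips (e j) ?W) = scale \<alpha> (cc (d m))" "\<not> e j \<Longrightarrow> \<alpha> = 1"
      by blast
    show "\<exists>\<kappa>. \<kappa> \<noteq> 0 \<and>
        (if e k then T' (?Y i (w j)) else ?Y i (w j)) =
          scaleV \<kappa> (?Y (if e k then t i else i) (if e k then T' (w j) else w j)) \<and>
        ?Y i (?Y j (w k)) = scaleV \<kappa> (?Y (\<sigma> i j) (?Y (if e j then t i else i) (w k)))"
    \<comment> \<open>On \<open>e V\<close> the group elements act, the product identity for degrees
      is exact and the scalar is 1. On \<open>f V\<close> the elements \<open>cc\<close> act, and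
      the scalar is \<open>\<kappa> * \<alpha>\<close> in both identities.\<close>
    proof (cases "e k")
      case False
      have "?Y i (?Y j (w k)) = act (d i * d j) (w k)"
        using prod_k[of ?W "word (d j)"] False Z_word d_grp ijk by simp
      also have "d i * d j = d (\<sigma> i j) * d m"
        using g'(3) Z_word[OF d_grp[OF ijk(1)]] by (simp add: g'_eq dm_False)
      also have "act (d (\<sigma> i j) * d m) (w k) = ?Y (\<sigma> i j) (?Y m (w k))"
        using prod_k[of "word (d (\<sigma> i j))" "word (d m)"] False Z_word d_grp \<sigma>X mX ijk by simp
      finally show ?thesis using False by (intro exI[of _ 1]) (simp add: m_def)
    next
      case True
      have T': "T' = T" by (rule T'_eq[OF ijk(3) True])
      have Ek: "E True \<noteq> 0" by (rule E_e[OF ijk(3) True])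
      have "?Y i (?Y j (w k)) = act (Z True ?W * cc (d j)) (w k)"
        using prod_k[of ?W "word (d j)"] True by (simp add: cc_def)
      also have "Z True ?W * cc (d j) = scale (\<kappa> * \<alpha>) (cc (d (\<sigma> i j)) * cc (d m))"
        unfolding g'(4) \<alpha>(2) g'_eq scale_mult_right[symmetric] by simp
      also have "act \<dots> (w k) = scaleV (\<kappa> * \<alpha>) (?Y (\<sigma> i j) (?Y m (w k)))"
        using prod_k[of "word (d (\<sigma> i j))" "word (d m)"] True
        by (simp add: act_scale_left cc_def)
      finally have 2: "?Y i (?Y j (w k)) = scaleV (\<kappa> * \<alpha>) (?Y (\<sigma> i j) (?Y m (w k)))" .
      have par_Tj: "par (e j) (T (w j))" using par_T e ijk by blast
      \<comment> \<open>The same \<open>\<alpha>\<close> must occur here. On parity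
        \<open>True\<close> it compares the \<open>f\<close>-parts of two words of equal degree; on
        parity \<open>False\<close> their actions agree and \<open>\<alpha> = 1\<close>.\<close>
      have "act (yw (map flip ?W)) (T (w j)) = scaleV \<alpha> (?Y (t i) (T (w j)))"
      proof -
        have sw: "d (t i) = Z False (map flip ?W)" using dt[OF ijk(1) Ek] by (simp add: swap_def)
        have "act (yw (map flip ?W)) (T (w j)) = act (Z (e j) (map flip ?W)) (T (w j))"
          using act_Z_par[OF par_Tj] by simp
        also have "\<dots> = scaleV \<alpha> (act (Z (e j) (word (d (t i)))) (T (w j)))"
        proof (cases "e j")
          case True
          then have "Z True (map flip ?W) = scale \<alpha> (cc (d (t i)))"
            using \<alpha>(2) by (simp add: m_def flip_if_def[abs_def])
          then show ?thesis using True by (simp add: act_scale_left cc_def)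
        next
          case False
          then show ?thesis using Z_word[OF d_grp[OF tX[OF ijk(1)]]] sw \<alpha>(3) by simp
        qed
        also have "act (Z (e j) (word (d (t i)))) (T (w j)) = ?Y (t i) (T (w j))"
          using act_Z_par[OF par_Tj] by simp
        finally show ?thesis .
      qed
      then have "T (?Y i (w j)) = scaleV (\<kappa> * \<alpha>) (?Y (t i) (T (w j)))"
        using g'(6) by simp
      then show ?thesis
        using 2 True T' \<alpha>(1) g'(2) by (intro exI[of _ "\<kappa> * \<alpha>"]) (simp add: m_def)
    qed
  qed (use inj_w V.vector_space_axioms act_linear_right linT' A \<sigma>_bij e\<sigma> \<theta> t_bij et in auto)
qed

end

theorem lemma2p8:
  fixes N n :: nat
    and \<mu> lam :: "'k::{alg_closed_field, field_char_0}"
    and scale :: "'k \<Rightarrow> 'h::ring_1 \<Rightarrow> 'h"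
    and comult :: "'h \<Rightarrow> ('k, 'h, 'h) tensor"
    and counit :: "'h \<Rightarrow> 'k"
    and antipode :: "'h \<Rightarrow> 'h"
    and x :: "idx \<Rightarrow> idx \<Rightarrow> 'h"
  assumes "N \<ge> 1" and "n \<ge> 2" and "\<mu> \<in> {1, -1}" and "lam \<in> {1, -1}"
    and "suzuki_algebra N n \<mu> lam scale comult counit antipode x"
  shows "hopf_of_set_theoretical_type TYPE('v::ab_group_add) scale comult counit antipode"
  unfolding hopf_of_set_theoretical_type_def
proof (intro allI impI, elim conjE exE)
  fix scaleV :: "'k \<Rightarrow> 'v \<Rightarrow> 'v" and act coact B
  assume yd: "yd_module scale comult counit antipode scaleV act coact"
    and B: "finite B" "module.span scaleV B = UNIV" and dim: "vector_space.dim scaleV UNIV \<ge> 2"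
  interpret suzuki_algebra N n \<mu> lam scale comult counit antipode x by fact
  interpret yd_module scale comult counit antipode scaleV act coact by fact
  interpret suzuki_yd N n \<mu> lam scale comult counit antipode x scaleV act coact
    by unfold_locales (use assms(1-4) in auto)
  show "set_theoretical_type scaleV (yd_braiding scale scaleV act coact)"
    by (rule set_theoretical_type_yd_braiding[OF B dim])
qed

end
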